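(* If $y>\exp(4.2\sqrt{\log x})$, then there exists a positive constant $c_{13}$ such that, as $x\to\infty$, $$ \frac1y\sum_{a\leq y}N_a(x)=\sum_{n\leq x}\frac{R(n)}{n}+O\!\left(x\exp(-c_{13}\sqrt{\log x})\right). $$
   Context: $a$ and $n$ run over positive integers. Carmichael's function $\lambda(n)$ is the exponent of the group $(\mathbb{Z}/n\mathbb{Z})^*$. For $a$ coprime to $n$, $\ell_a(n)$ is the multiplicative order of $a$ modulo $n$, and $a$ is called a $\lambda$-primitive root modulo $n$ if $\gcd(a,n)=1$ and $\ell_a(n)=\lambda(n)$. $R(n)=\#\{a\in(\mathbb{Z}/n\mathbb{Z})^*: a \text{ is a } \lambda\text{-primitive root modulo } n\}$ and $N_a(x)=\#\{n\leq x: a \text{ is a } \lambda\text{-primitive root modulo } n\}$. *)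

theory Defs
  imports "HOL-Number_Theory.Number_Theory" "HOL-Analysis.Analysis"
begin

definition carmichael :: "nat \<Rightarrow> nat" where
  "carmichael n = (LEAST k. k > 0 \<and> (\<forall>a. coprime a n \<longrightarrow> [a ^ k = 1] (mod n)))"

definition lambda_prim_root :: "nat \<Rightarrow> nat \<Rightarrow> bool" where
  "lambda_prim_root a n \<longleftrightarrow> coprime a n \<and> ord n a = carmichael n"

definition R :: "nat \<Rightarrow> nat" where
  "R n = card {a \<in> {0..<n}. lambda_prim_root a n}"

definition N :: "nat \<Rightarrow> real \<Rightarrow> nat" where
  "N a x = card {n \<in> {1..nat \<lfloor>x\<rfloor>}. lambda_prim_root a n}"

end

theory Submission
  imports Defs "HOL-Real_Asymp.Real_Asymp"
begin

text \<open>
  The residue \<open>a\<close> is a \<open>\<lambda>\<close>-primitive root modulo \<open>n\<close> iff it avoids the subgroups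
  \<open>a\<^sup>\<lambda>\<^sup>/\<^sup>q = 1\<close> for all primes \<open>q\<close> dividing \<open>\<lambda>(n)\<close>. Inclusion-exclusion over these \<open>q\<close>, cut off by
  Bonferroni's inequalities after about \<open>L / ln L\<close> steps with \<open>L = sqrt (ln x)\<close>, costs only
  \<open>exp (\<epsilon> L)\<close> terms and leaves a main term error \<open>exp (- c L)\<close>, because the intersection
  belonging to a set \<open>B\<close> of primes has index at least \<open>\<Prod>B\<close>. Each intersection is detected by
  Dirichlet characters modulo \<open>n\<close>.

  Character sums up to \<open>Y\<close> of conductor \<open>f\<close> with \<open>f\<^sup>4 \<le> Y\<^sup>3\<close> are bounded by the period. If
  \<open>Y\<^sup>k\<^sup>-\<^sup>1 < f\<^sup>4 \<le> Y\<^sup>k\<close>, then the \<open>2k\<close>-th moment over all primitive characters in this range is bounded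
  by Bessel's inequality for almost orthogonal vectors, applied to the \<open>k\<close>-th power of the sum.
  Distinct primitive characters of conductor at most \<open>F\<close> have inner products at most
  \<open>F\<^sup>2\<close> and there are at most \<open>F\<^sup>2\<close> of them, so no additive characters are needed. The resulting mean
  square of \<open>k\<close>-fold divisor functions is \<open>Y\<^sup>k\<^sup>(\<^sup>1\<^sup>+\<^sup>\<epsilon>\<^sup>)\<close> as long as \<open>k\<close> is bounded by a multiple
  of \<open>ln Y\<close>, which is where the lower bound on \<open>y\<close> enters.
\<close>

section \<open>Dirichlet characters\<close>

text \<open>The obstacle is that \<open>y\<close> may be smaller than every power of
  \<open>x\<close>. A sum up to \<open>y\<close> of a character modulo \<open>n\<close> can then be
  far shorter than a period, and no useful pointwise bound is available. What makes the moments
  profitable is the factorization \<open>n = m f\<close>: a conductor with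
  \<open>f^4 > Y^(k-1)\<close> leaves at most \<open>X Y^(-(k-1)/4)\<close> cofactors
  \<open>m\<close>. This gain outweighs the divisor function losses once \<open>k >= 4\<close>, even
  against the threshold \<open>V = Y^0.97\<close>.

  The main term is never evaluated. The same truncated expansion is applied to the integers up to
  \<open>y\<close> and to a full residue system, and the two are compared term by term.

  The constants form a budget in exponents of \<open>L\<close>. Truncated inclusion-exclusion has at
  most \<open>exp (0.06 L)\<close> terms, each character sum saves \<open>Y^0.03\<close>, hence
  \<open>exp (0.126 L)\<close> because \<open>0.126 = 0.03 * 4.2\<close>, and polynomial factors
  cost \<open>exp (0.016 L)\<close>. The discarded tail is about \<open>exp (- 0.008 L)\<close>. It
  is the weaker of the two savings and dictates the final exponent 0.007.\<close>

definition dchar :: "nat \<Rightarrow> (nat \<Rightarrow> complex) \<Rightarrow> bool" where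
  "dchar n \<psi> \<longleftrightarrow> (\<forall>a b. \<psi> (a * b) = \<psi> a * \<psi> b) \<and> (\<forall>a b. [a = b] (mod n) \<longrightarrow> \<psi> a = \<psi> b)
     \<and> (\<forall>a. \<psi> a = 0 \<longleftrightarrow> \<not> coprime a n)"

lemma dchar_mult: "dchar n \<psi> \<Longrightarrow> \<psi> (a * b) = \<psi> a * \<psi> b"
  and dchar_cong: "dchar n \<psi> \<Longrightarrow> [a = b] (mod n) \<Longrightarrow> \<psi> a = \<psi> b"
  and dchar_eq_0_iff: "dchar n \<psi> \<Longrightarrow> \<psi> a = 0 \<longleftrightarrow> \<not> coprime a n"
  unfolding dchar_def by blast+

lemma dchar_1 [simp]: assumes "dchar n \<psi>" shows "\<psi> (Suc 0) = 1"
proof -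
  have "\<psi> 1 = \<psi> 1 * \<psi> 1" using dchar_mult[OF assms, of 1 1] by simp
  moreover have "\<psi> 1 \<noteq> 0" using dchar_eq_0_iff[OF assms] by simp
  ultimately show ?thesis by simp
qed

lemma dchar_power: "dchar n \<psi> \<Longrightarrow> \<psi> (a ^ k) = \<psi> a ^ k"
  by (induction k) (simp_all add: dchar_mult)

lemma dchar_mod: "dchar n \<psi> \<Longrightarrow> \<psi> (a mod n) = \<psi> a"
  by (rule dchar_cong) auto

lemma dchar_power_totient:
  assumes "dchar n \<psi>" "coprime a n"
  shows "\<psi> a ^ totient n = 1"
proof -
  have "\<psi> (a ^ totient n) = \<psi> 1"
    using euler_theorem[OF assms(2)] by (intro dchar_cong[OF assms(1)]) auto
  thus ?thesis using assms by (simp add: dchar_power)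
qed

lemma norm_dchar:
  assumes "dchar n \<psi>" "n > 0" "coprime a n"
  shows "norm (\<psi> a) = 1"
proof -
  have "norm (\<psi> a) ^ totient n = 1"
    using dchar_power_totient[OF assms(1,3)] by (metis norm_one norm_power)
  thus ?thesis using assms(2) by (metis norm_ge_zero power_eq_1_iff totient_gt_0_iff neq0_conv real_norm_def abs_of_nonneg)
qed

lemma norm_dchar_le:
  assumes "dchar n \<psi>" "n > 0"
  shows "norm (\<psi> a) \<le> 1"
  using norm_dchar[OF assms, of a] dchar_eq_0_iff[OF assms(1), of a] by (cases "coprime a n") auto

lemma dchar_cnj_mult:
  assumes "dchar n \<psi>" "n > 0" "coprime a n"
  shows "cnj (\<psi> a) * \<psi> a = 1"
  using norm_dchar[OF assms] by (metis complex_norm_square mult.commute of_real_1 one_power2)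

text \<open>A character is determined by its values on \<open>{..<n}\<close>, and each of them is 0
  or a root of unity of order dividing \<open>totient n\<close>.\<close>

lemma finite_dchars:
  assumes "n > 0"
  shows "finite {\<psi>. dchar n \<psi>}"
proof -
  let ?Z = "insert 0 {z :: complex. z ^ totient n = 1}"
  have fin: "finite ?Z" using finite_roots_unity[of "totient n"] assms by (simp add: Suc_leI)
  have "{\<psi>. dchar n \<psi>} \<subseteq> (\<lambda>f a. f (a mod n)) ` (PiE {..<n} (\<lambda>_. ?Z))"
  proof
    fix \<psi> assume "\<psi> \<in> {\<psi>. dchar n \<psi>}"
    hence d: "dchar n \<psi>" by simp
    let ?f = "restrict \<psi> {..<n}"
    have "?f \<in> PiE {..<n} (\<lambda>_. ?Z)"
      using dchar_power_totient[OF d] dchar_eq_0_iff[OF d] by auto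
    moreover have "\<psi> = (\<lambda>a. ?f (a mod n))"
      using assms dchar_mod[OF d] by (auto simp: fun_eq_iff)
    ultimately show "\<psi> \<in> (\<lambda>f a. f (a mod n)) ` (PiE {..<n} (\<lambda>_. ?Z))" by blast
  qed
  moreover have "finite (PiE {..<n} (\<lambda>_. ?Z))" using fin by (intro finite_PiE) auto
  ultimately show ?thesis using finite_surj by blast
qed

lemma dchar_times:
  assumes "dchar n \<psi>" "dchar m \<phi>"
  shows "dchar (n * m) (\<lambda>a. \<psi> a * \<phi> a)"
proof -
  have c: "[a = b] (mod n)" "[a = b] (mod m)" if "[a = b] (mod (n * m))" for a b
    using that by (metis cong_modulus_mult_nat, metis cong_modulus_mult_nat mult.commute)
  show ?thesis unfolding dchar_def
  proof (intro conjI allI impI)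
    fix a b show "\<psi> (a * b) * \<phi> (a * b) = \<psi> a * \<phi> a * (\<psi> b * \<phi> b)"
      by (simp add: dchar_mult[OF assms(1)] dchar_mult[OF assms(2)])
  next
    fix a b assume "[a = b] (mod n * m)"
    thus "\<psi> a * \<phi> a = \<psi> b * \<phi> b"
      using c[of a b] dchar_cong[OF assms(1), of a b] dchar_cong[OF assms(2), of a b] by simp
  next
    fix a show "(\<psi> a * \<phi> a = 0) = (\<not> coprime a (n * m))"
      by (simp add: dchar_eq_0_iff[OF assms(1)] dchar_eq_0_iff[OF assms(2)])
  qed
qed

lemma dchar_times_same:
  assumes "dchar n \<psi>" "dchar n \<phi>"
  shows "dchar n (\<lambda>a. \<psi> a * \<phi> a)"
  unfolding dchar_def using dchar_mult[OF assms(1)] dchar_mult[OF assms(2)] dchar_eq_0_iff[OF assms(1)] dchar_eq_0_iff[OF assms(2)]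
   dchar_cong[OF assms(1)] dchar_cong[OF assms(2)] by (metis mult.assoc mult.left_commute mult_eq_0_iff)

lemma dchar_cnj: "dchar n \<psi> \<Longrightarrow> dchar n (\<lambda>a. cnj (\<psi> a))"
  unfolding dchar_def by auto

definition princ_char :: "nat \<Rightarrow> nat \<Rightarrow> complex" where
  "princ_char n a = (if coprime a n then 1 else 0)"

lemma dchar_princ_char: "dchar n (princ_char n)"
  unfolding dchar_def princ_char_def
  by (auto simp: coprime_cong_transfer_left dest: coprime_cong_cong_left) 

lemma dchar_neq_princ_char:
  assumes "dchar n \<psi>" "\<psi> \<noteq> princ_char n"
  obtains u where "coprime u n" "\<psi> u \<noteq> 1"
  using assms dchar_eq_0_iff[OF assms(1)] unfolding princ_char_def fun_eq_iff by metis

lemma sum_mod_mult_unit: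
  fixes f :: "nat \<Rightarrow> 'a :: comm_monoid_add"
  assumes "coprime u n" "n > 0"
  shows "(\<Sum>a<n. f (u * a mod n)) = (\<Sum>a<n. f a)"
proof -
  have inj: "inj_on (\<lambda>a. u * a mod n) {..<n}"
  proof (rule inj_onI)
    fix a b assume ab: "a \<in> {..<n}" "b \<in> {..<n}" "u * a mod n = u * b mod n"
    hence "[u * a = u * b] (mod n)" by (simp add: unique_euclidean_semiring_class.cong_def)
    hence "[a = b] (mod n)" using assms(1) by (simp add: cong_mult_lcancel_nat)
    thus "a = b" using ab by (simp add: unique_euclidean_semiring_class.cong_def)
  qed
  have "(\<lambda>a. u * a mod n) ` {..<n} = {..<n}"
    by (rule endo_inj_surj) (use inj assms in auto)
  hence "bij_betw (\<lambda>a. u * a mod n) {..<n} {..<n}" using inj by (simp add: bij_betw_def)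
  thus ?thesis by (rule sum.reindex_bij_betw)
qed

lemma dchar_sum_period:
  assumes "dchar n \<psi>" "\<psi> \<noteq> princ_char n" "n > 0"
  shows "(\<Sum>a<n. \<psi> a) = 0"
proof -
  obtain u where u: "coprime u n" "\<psi> u \<noteq> 1" using dchar_neq_princ_char[OF assms(1,2)] .
  have "(\<Sum>a<n. \<psi> a) = (\<Sum>a<n. \<psi> (u * a mod n))" using sum_mod_mult_unit[OF u(1) assms(3)] by metis
  also have "\<dots> = \<psi> u * (\<Sum>a<n. \<psi> a)"
    by (simp add: dchar_mod[OF assms(1)] dchar_mult[OF assms(1)] sum_distrib_left)
  finally show ?thesis using u(2) by (simp add: mult_cancel_right1)
qed

lemma dchar_sum_shift:
  assumes "dchar n \<psi>" "\<psi> \<noteq> princ_char n" "n > 0"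
  shows "(\<Sum>a<n * q. \<psi> a) = 0"
proof (induction q)
  case (Suc q)
  have "(\<Sum>a<n * Suc q. \<psi> a) = (\<Sum>a<n * q. \<psi> a) + (\<Sum>a<n. \<psi> (a + n * q))"
    using sum.nat_group[of \<psi> n q]
    by (simp add: lessThan_atLeast0 algebra_simps sum.shift_bounds_nat_ivl[of \<psi> 0 "n * q" n, simplified]
          sum.atLeastLessThan_concat[of 0 "n*q" "n + n*q" \<psi>, symmetric, simplified])
  also have "(\<Sum>a<n. \<psi> (a + n * q)) = (\<Sum>a<n. \<psi> a)"
    by (intro sum.cong refl dchar_cong[OF assms(1)]) (simp add: unique_euclidean_semiring_class.cong_def)
  finally show ?case using Suc dchar_sum_period[OF assms] by simp
qed simp

text \<open>Complete periods cancel, so only the last incomplete one contributes. The bound serves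
  both for characters of small conductor and, applied to a product of two characters, for almost
  orthogonality.\<close>

lemma norm_dchar_sum_le:
  assumes "dchar n \<psi>" "\<psi> \<noteq> princ_char n" "n > 0"
  shows "norm (\<Sum>a=1..m. \<psi> a) \<le> n"
proof -
  \<comment> \<open>Periods are counted from 0, so the additional term at 0 has to vanish. Modulus 1
    is excluded because its only character is principal.\<close>
  have "\<psi> 0 = 0"
  proof -
    have "n \<noteq> 1"
      using assms(2) dchar_neq_princ_char[OF assms(1,2)] dchar_cong[OF assms(1), of _ 1] dchar_1[OF assms(1)]
      by (metis One_nat_def cong_1)
    thus ?thesis using dchar_eq_0_iff[OF assms(1)] by simp
  qed
  hence "(\<Sum>a=1..m. \<psi> a) = (\<Sum>a<Suc m. \<psi> a)"
    by (simp add: sum.atLeast_Suc_atMost lessThan_Suc_atMost sum.atLeast_Suc_atMost atMost_atLeast0)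
  define M where "M = Suc m"
  note \<open>(\<Sum>a=1..m. \<psi> a) = (\<Sum>a<Suc m. \<psi> a)\<close>
  also have "(\<Sum>a<Suc m. \<psi> a) = (\<Sum>a<M. \<psi> a)" by (simp add: M_def)
  also have "(\<Sum>a<M. \<psi> a) = (\<Sum>a<n * (M div n). \<psi> a) + (\<Sum>a\<in>{n * (M div n)..<M}. \<psi> a)"
    by (simp add: lessThan_atLeast0 sum.atLeastLessThan_concat)
  also have "\<dots> = (\<Sum>a\<in>{n * (M div n)..<M}. \<psi> a)" using dchar_sum_shift[OF assms] by simp
  also have "norm \<dots> \<le> (\<Sum>a\<in>{n * (M div n)..<M}. 1)"
    by (intro sum_norm_le norm_dchar_le[OF assms(1,3)])
  also have "\<dots> = real (M mod n)" by (simp add: minus_mult_div_eq_mod)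
  also have "\<dots> \<le> n" using assms(3) by (simp add: less_imp_le)
  finally show ?thesis unfolding M_def by simp
qed


section \<open>Subgroups of the unit group and extension of their characters\<close>

definition unit_subgroup :: "nat \<Rightarrow> nat set \<Rightarrow> bool" where
  "unit_subgroup n H \<longleftrightarrow> 1 \<in> H \<and> (\<forall>a\<in>H. coprime a n) \<and> (\<forall>a\<in>H. \<forall>b\<in>H. a * b \<in> H)
     \<and> (\<forall>a b. a \<in> H \<longrightarrow> [a = b] (mod n) \<longrightarrow> b \<in> H)"

lemma unit_subgroup_power: "unit_subgroup n H \<Longrightarrow> a \<in> H \<Longrightarrow> a ^ k \<in> H"
  by (induction k) (auto simp: unit_subgroup_def)

text \<open>Euler's theorem makes the inverse a power of \<open>a\<close>, so closure under products
  already yields inverses.\<close>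

lemma unit_subgroup_inverse:
  assumes "unit_subgroup n H" "a \<in> H" "n > 0"
  obtains b where "b \<in> H" "[a * b = 1] (mod n)"
proof
  have "coprime a n" using assms by (simp add: unit_subgroup_def)
  thus "[a * a ^ (totient n - 1) = 1] (mod n)"
    using euler_theorem[of a n] assms(3) by (metis power_eq_if totient_gt_0_iff neq0_conv)
qed (use assms in \<open>simp add: unit_subgroup_power\<close>)

lemma unit_subgroup_cancel:
  assumes "unit_subgroup n H" "n > 0" "a \<in> H" "a * b \<in> H"
  shows "b \<in> H"
proof -
  obtain c where c: "c \<in> H" "[a * c = 1] (mod n)" using unit_subgroup_inverse[OF assms(1,3,2)] .
  have "[c * (a * b) = b] (mod n)"
    using cong_scalar_right[OF c(2), of b] by (simp add: mult_ac)
  moreover have "c * (a * b) \<in> H" using assms(1,4) c(1) by (auto simp: unit_subgroup_def)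
  ultimately show ?thesis using assms(1) unfolding unit_subgroup_def by blast
qed

text \<open>A partial character: its values outside \<open>H\<close> carry no meaning. Nonvanishing
  suffices on a subgroup, since Euler's theorem then forces the values to be roots of unity.\<close>

definition char_on :: "nat \<Rightarrow> nat set \<Rightarrow> (nat \<Rightarrow> complex) \<Rightarrow> bool" where
  "char_on n H f \<longleftrightarrow> (\<forall>a\<in>H. \<forall>b\<in>H. f (a * b) = f a * f b) \<and> (\<forall>a\<in>H. \<forall>b. [a = b] (mod n) \<longrightarrow> f a = f b)
     \<and> (\<forall>a\<in>H. f a \<noteq> 0)"

lemma char_on_power: "unit_subgroup n H \<Longrightarrow> char_on n H f \<Longrightarrow> a \<in> H \<Longrightarrow> f (a ^ k) = f a ^ k"
proof (induction k)
  case 0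
  have "f (1 * 1) = f 1 * f 1" "f 1 \<noteq> 0" using 0 unfolding char_on_def unit_subgroup_def by blast+
  thus ?case by simp
next
  case (Suc k)
  thus ?case using unit_subgroup_power[of n H a k] by (auto simp: char_on_def)
qed

text \<open>\<open>m\<close> is the order of \<open>g\<close> in the quotient by \<open>H\<close>: a
  remainder of \<open>i\<close> modulo \<open>m\<close> would be a smaller exponent leading into
  \<open>H\<close>.\<close>

lemma least_power_in_subgroup:
  assumes "unit_subgroup n H" "n > 0" "coprime g n"
  defines "m \<equiv> (LEAST m. m > 0 \<and> g ^ m \<in> H)"
  shows "m > 0" "g ^ m \<in> H" "g ^ i \<in> H \<longleftrightarrow> m dvd i"
proof -
  have "g ^ totient n \<in> H"
    using euler_theorem[OF assms(3)] assms(1) unfolding unit_subgroup_def by (metis cong_sym)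
  hence ex: "totient n > 0 \<and> g ^ totient n \<in> H" using assms(2) by simp
  have m: "m > 0 \<and> g ^ m \<in> H" unfolding m_def using LeastI[where P = "\<lambda>m. m > 0 \<and> g ^ m \<in> H", OF ex] .
  thus "m > 0" "g ^ m \<in> H" by auto
  show "g ^ i \<in> H \<longleftrightarrow> m dvd i"
  proof
    assume "m dvd i"
    then obtain t where "i = m * t" by auto
    thus "g ^ i \<in> H" using unit_subgroup_power[OF assms(1), of "g ^ m" t] m by (simp add: power_mult)
  next
    assume gi: "g ^ i \<in> H"
    have "g ^ (m * (i div m)) * g ^ (i mod m) \<in> H" using gi by (simp flip: power_add)
    moreover have "g ^ (m * (i div m)) \<in> H"
      using unit_subgroup_power[OF assms(1), of "g ^ m" "i div m"] m by (simp add: power_mult)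
    ultimately have "g ^ (i mod m) \<in> H" using unit_subgroup_cancel[OF assms(1,2)] by blast
    moreover have "i mod m < m" using m by simp
    ultimately have "i mod m = 0"
      using not_less_Least[of "i mod m" "\<lambda>m. m > 0 \<and> g ^ m \<in> H"] by (auto simp flip: m_def)
    thus "m dvd i" by auto
  qed
qed

text \<open>When one generator \<open>g\<close> is adjoined, the only constraint on its value
  \<open>w\<close> is compatibility at \<open>g ^ m\<close>, with \<open>m\<close> the order of
  \<open>g\<close> modulo \<open>H\<close>. Leaving \<open>w\<close> free serves two purposes: any
  root extends a character, and a nontrivial root of 1 separates \<open>g\<close> from
  \<open>H\<close>.\<close>

lemma char_on_extend:
  assumes H: "unit_subgroup n H" "n > 0" and f: "char_on n H f" and g: "coprime g n"
    and w: "w ^ (LEAST m. m > 0 \<and> g ^ m \<in> H) = f (g ^ (LEAST m. m > 0 \<and> g ^ m \<in> H))"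
  obtains H' f' where "unit_subgroup n H'" "char_on n H' f'" "H \<subseteq> H'" "g \<in> H'"
    "\<And>a. a \<in> H \<Longrightarrow> f' a = f a" "f' g = w"
proof -
  define m where "m = (LEAST m. m > 0 \<and> g ^ m \<in> H)"
  note m = least_power_in_subgroup[OF H g, folded m_def]
  have wm: "w ^ m = f (g ^ m)" using w by (simp add: m_def)
  have w0: "w \<noteq> 0" using wm m f unfolding char_on_def by (metis power_eq_0_iff)
  define H' where "H' = {b. \<exists>h i. h \<in> H \<and> [b = h * g ^ i] (mod n)}"
  have coH: "coprime h n" if "h \<in> H" for h using H that by (simp add: unit_subgroup_def)
  have one: "f 1 = 1" using char_on_power[OF H(1) f, of 1 0] H by (simp add: unit_subgroup_def)
  \<comment> \<open>Cancelling \<open>g ^ i\<close> puts \<open>g ^ (i' - i)\<close> into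
    \<open>H\<close>, so the exponents differ by a multiple of \<open>m\<close>; here
    \<open>w ^ m = f (g ^ m)\<close> enters.\<close>
  have wd: "f h * w ^ i = f h' * w ^ i'"
    if "h \<in> H" "h' \<in> H" "[h * g ^ i = h' * g ^ i'] (mod n)" "i \<le> i'" for h h' i i'
  proof -
    have "[h * g ^ i = h' * g ^ (i' - i) * g ^ i] (mod n)"
      using that by (simp flip: power_add add: mult.assoc)
    hence c: "[h = h' * g ^ (i' - i)] (mod n)" using g by (subst (asm) cong_mult_rcancel_nat) auto
    hence "h' * g ^ (i' - i) \<in> H" using that(1) H(1) unfolding unit_subgroup_def by blast
    hence "g ^ (i' - i) \<in> H" using unit_subgroup_cancel[OF H that(2)] by blast
    hence "m dvd i' - i" using m by simp
    then obtain t where t: "i' - i = m * t" by auto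
    have "f h = f (h' * g ^ (i' - i))" using c f that(1) unfolding char_on_def by blast
    also have "\<dots> = f h' * f (g ^ (i' - i))"
      using f that(2) \<open>g ^ (i' - i) \<in> H\<close> unfolding char_on_def by blast
    also have "f (g ^ (i' - i)) = w ^ (i' - i)"
      using char_on_power[OF H(1) f m(2), of t] by (simp add: t power_mult wm)
    finally show ?thesis using that(4) by (simp flip: power_add add: mult.assoc)
  qed
  have wd': "f h * w ^ i = f h' * w ^ i'"
    if "h \<in> H" "h' \<in> H" "[h * g ^ i = h' * g ^ i'] (mod n)" for h h' i i'
    using wd[of h h' i i'] wd[of h' h i' i] that by (metis cong_sym nle_le)
  define f' where "f' b = (THE z. \<exists>h i. h \<in> H \<and> [b = h * g ^ i] (mod n) \<and> z = f h * w ^ i)" for b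
  have f': "f' b = f h * w ^ i" if "h \<in> H" "[b = h * g ^ i] (mod n)" for b h i
    unfolding f'_def
  proof (rule the_equality)
    fix z assume "\<exists>h i. h \<in> H \<and> [b = h * g ^ i] (mod n) \<and> z = f h * w ^ i"
    then obtain h' i' where *: "h' \<in> H" "[b = h' * g ^ i'] (mod n)" "z = f h' * w ^ i'" by blast
    have "[h' * g ^ i' = h * g ^ i] (mod n)" using * that by (metis cong_sym cong_trans)
    thus "z = f h * w ^ i" using wd'[of h' h i' i] * that by simp
  qed (use that in blast)
  show ?thesis
  proof
    show "H \<subseteq> H'"
    proof
      fix a assume "a \<in> H"
      moreover have "[a = a * g ^ 0] (mod n)" by simp
      ultimately show "a \<in> H'" unfolding H'_def by blast
    qed
    have "1 \<in> H" "[g = 1 * g ^ 1] (mod n)" using H(1) by (auto simp: unit_subgroup_def)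
    thus "g \<in> H'" unfolding H'_def by blast
    show "f' a = f a" if "a \<in> H" for a using f'[of a a 0] that by simp
    show "f' g = w" using f'[of 1 g 1] H(1) one unfolding unit_subgroup_def by simp
    have mul: "\<exists>h i h' i'. h \<in> H \<and> h' \<in> H \<and> [a = h * g ^ i] (mod n) \<and> [b = h' * g ^ i'] (mod n)
       \<and> [a * b = (h * h') * g ^ (i + i')] (mod n) \<and> h * h' \<in> H" if "a \<in> H'" "b \<in> H'" for a b
    proof -
      from that obtain h i h' i' where *: "h \<in> H" "h' \<in> H" "[a = h * g ^ i] (mod n)" "[b = h' * g ^ i'] (mod n)"
        unfolding H'_def by blast
      have "[a * b = (h * g ^ i) * (h' * g ^ i')] (mod n)" using * by (intro cong_mult)
      hence "[a * b = (h * h') * g ^ (i + i')] (mod n)" by (simp add: power_add mult_ac)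
      thus ?thesis using * H(1) unfolding unit_subgroup_def by blast
    qed
    show "unit_subgroup n H'" unfolding unit_subgroup_def
    proof (intro conjI ballI allI impI)
      show "1 \<in> H'" using \<open>H \<subseteq> H'\<close> H(1) by (auto simp: unit_subgroup_def)
      show "coprime a n" if "a \<in> H'" for a
      proof -
        from that obtain h i where "h \<in> H" "[a = h * g ^ i] (mod n)" unfolding H'_def by blast
        moreover have "coprime (h * g ^ i) n" using coH[OF \<open>h \<in> H\<close>] g by simp
        ultimately show ?thesis using cong_imp_coprime cong_sym by blast
      qed
      show "a * b \<in> H'" if "a \<in> H'" "b \<in> H'" for a b using mul[OF that] unfolding H'_def by blast
      show "b \<in> H'" if "a \<in> H'" "[a = b] (mod n)" for a b
      proof -
        from that(1) obtain h i where h: "h \<in> H" "[a = h * g ^ i] (mod n)" unfolding H'_def by blast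
        hence "[b = h * g ^ i] (mod n)" using cong_trans[OF cong_sym[OF that(2)]] by blast
        thus ?thesis using h(1) unfolding H'_def by blast
      qed
    qed
    show "char_on n H' f'" unfolding char_on_def
    proof (intro conjI ballI allI impI)
      fix a b assume ab: "a \<in> H'" "b \<in> H'"
      from mul[OF ab] obtain h i h' i' where *: "h \<in> H" "h' \<in> H" "[a = h * g ^ i] (mod n)" "[b = h' * g ^ i'] (mod n)"
        "[a * b = (h * h') * g ^ (i + i')] (mod n)" "h * h' \<in> H" by blast
      have "f (h * h') = f h * f h'" using * f unfolding char_on_def by blast
      thus "f' (a * b) = f' a * f' b"
        using f'[OF *(1,3)] f'[OF *(2,4)] f'[OF *(6,5)] by (simp add: power_add)
    next
      fix a b assume ab: "a \<in> H'" "[a = b] (mod n)"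
      then obtain h i where "h \<in> H" "[a = h * g ^ i] (mod n)" unfolding H'_def by blast
      thus "f' a = f' b" using f'[of h a i] f'[of h b i] ab by (metis cong_sym cong_trans)
    next
      fix a assume ab: "a \<in> H'"
      then obtain h i where "h \<in> H" "[a = h * g ^ i] (mod n)" unfolding H'_def by blast
      thus "f' a \<noteq> 0" using f'[of h a i] w0 f unfolding char_on_def by auto
    qed
  qed
qed

lemma complex_root_exists: "m > 0 \<Longrightarrow> \<exists>w::complex. w ^ m = z"
proof (cases "z = 0")
  case False
  assume "m > 0"
  have "exp (Ln z / of_nat m) ^ m = exp (of_nat m * (Ln z / of_nat m))"
    by (simp only: exp_of_nat_mult)
  also have "\<dots> = z" using \<open>m > 0\<close> False by simp
  finally show ?thesis by blast
qed (auto intro: exI[of _ 0])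

text \<open>Units are adjoined one at a time, and the number of residues still missing from
  \<open>H\<close> decreases. Once all units are reached, extension by zero gives a Dirichlet
  character.\<close>

lemma char_on_extends_to_dchar:
  assumes "unit_subgroup n H" "n > 0" "char_on n H f"
  shows "\<exists>\<psi>. dchar n \<psi> \<and> (\<forall>a\<in>H. \<psi> a = f a)"
  using assms(1,3)
proof (induction "n - card (H \<inter> {..<n})" arbitrary: H f rule: less_induct)
  case less
  show ?case
  proof (cases "\<forall>g. coprime g n \<longrightarrow> g \<in> H")
    case True
    hence eq: "g \<in> H \<longleftrightarrow> coprime g n" for g using less.prems unfolding unit_subgroup_def by blast
    define \<psi> where "\<psi> a = (if coprime a n then f a else 0)" for a
    have "dchar n \<psi>" unfolding dchar_def \<psi>_def
      using less.prems(2) eq unfolding char_on_def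
      by (auto dest: coprime_cong_cong_left)
    moreover have "\<forall>a\<in>H. \<psi> a = f a" using eq by (simp add: \<psi>_def)
    ultimately show ?thesis by blast
  next
    case False
    then obtain g where g: "coprime g n" "g \<notin> H" by blast
    define m where "m = (LEAST m. m > 0 \<and> g ^ m \<in> H)"
    have "m > 0" using least_power_in_subgroup(1)[OF less.prems(1) assms(2) g(1)] by (simp add: m_def)
    then obtain w where "w ^ m = f (g ^ m)" using complex_root_exists by blast
    then obtain H' f' where H': "unit_subgroup n H'" "char_on n H' f'" "H \<subseteq> H'" "g \<in> H'" "\<And>a. a \<in> H \<Longrightarrow> f' a = f a"
      using char_on_extend[OF less.prems(1) assms(2) less.prems(2) g(1), of w] unfolding m_def by metis
    have "g mod n \<in> H' \<inter> {..<n}"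
      using H'(1,4) assms(2) unfolding unit_subgroup_def by (auto simp: unique_euclidean_semiring_class.cong_def)
    moreover have "g mod n \<notin> H"
      using g(2) less.prems(1) unfolding unit_subgroup_def by (auto simp: unique_euclidean_semiring_class.cong_def)
    ultimately have "H \<inter> {..<n} \<subset> H' \<inter> {..<n}" using H'(3) by blast
    hence "card (H \<inter> {..<n}) < card (H' \<inter> {..<n})" by (intro psubset_card_mono) auto
    moreover have "card (H' \<inter> {..<n}) \<le> card {..<n}" by (intro card_mono) auto
    ultimately have "n - card (H' \<inter> {..<n}) < n - card (H \<inter> {..<n})" by simp
    from less.hyps[OF this H'(1,2)] show ?thesis using H'(3,5) by (metis subsetD)
  qed
qed

section \<open>Annihilators and orthogonality\<close>

lemma nontrivial_root_of_unity:
  assumes "m > 1"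
  shows "\<exists>w::complex. w ^ m = 1 \<and> w \<noteq> 1"
proof (rule ccontr)
  assume "\<nexists>w::complex. w ^ m = 1 \<and> w \<noteq> 1"
  hence "{w::complex. w ^ m = 1} \<subseteq> {1}" by blast
  hence "card {w::complex. w ^ m = 1} \<le> card {1::complex}" by (rule card_mono[rotated]) simp
  thus False using card_roots_unity_eq[of m] assms by simp
qed

text \<open>For a subgroup \<open>E\<close> this is the dual of the quotient of the unit group by
  \<open>E\<close>.\<close>

definition annihilator :: "nat \<Rightarrow> nat set \<Rightarrow> (nat \<Rightarrow> complex) set" where
  "annihilator n E = {\<psi>. dchar n \<psi> \<and> (\<forall>a\<in>E. \<psi> a = 1)}"

text \<open>The order \<open>m\<close> of \<open>a\<close> modulo \<open>E\<close> exceeds 1, so the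
  trivial character of \<open>E\<close> extends to \<open>a\<close> with a nontrivial
  \<open>m\<close>-th root of unity as value.\<close>

lemma annihilator_separates:
  assumes "unit_subgroup n E" "n > 0" "coprime a n" "a \<notin> E"
  obtains \<psi> where "\<psi> \<in> annihilator n E" "\<psi> a \<noteq> 1"
proof -
  have triv: "char_on n E (\<lambda>_. 1)" by (simp add: char_on_def)
  define m where "m = (LEAST m. m > 0 \<and> a ^ m \<in> E)"
  note m = least_power_in_subgroup[OF assms(1-3), folded m_def]
  have "\<not> m dvd 1" using m(3)[of 1] assms(4) by simp
  hence "m > 1" using m(1) by (cases m) auto
  then obtain w :: complex where w: "w ^ m = 1" "w \<noteq> 1" using nontrivial_root_of_unity by blast
  have wE: "w ^ (LEAST m. m > 0 \<and> a ^ m \<in> E) = 1" using w(1) by (simp add: m_def)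
  obtain H' f' where H': "unit_subgroup n H'" "char_on n H' f'" "E \<subseteq> H'" "a \<in> H'" "\<And>b. b \<in> E \<Longrightarrow> f' b = 1" "f' a = w"
    by (rule char_on_extend[OF assms(1,2) triv assms(3) wE]) (rule that)
  obtain \<psi> where "dchar n \<psi>" "\<forall>a\<in>H'. \<psi> a = f' a"
    using char_on_extends_to_dchar[OF H'(1) assms(2) H'(2)] by blast
  moreover from this have "\<forall>b\<in>E. \<psi> b = 1" using H'(3,5) by auto
  ultimately show ?thesis using that[of \<psi>] H'(4,6) w unfolding annihilator_def by auto
qed

lemma finite_annihilator: "n > 0 \<Longrightarrow> finite (annihilator n E)"
  using finite_dchars by (rule finite_subset[rotated]) (auto simp: annihilator_def)

lemma princ_char_in_annihilator: "unit_subgroup n E \<Longrightarrow> princ_char n \<in> annihilator n E"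
  using dchar_princ_char by (auto simp: annihilator_def unit_subgroup_def princ_char_def)

text \<open>If \<open>a\<close> is a unit outside \<open>E\<close>, multiplication by a character
  with value different from 1 at \<open>a\<close> permutes the annihilator and rescales the sum,
  which must therefore vanish.\<close>

lemma sum_annihilator:
  assumes "unit_subgroup n E" "n > 0"
  shows "(\<Sum>\<psi>\<in>annihilator n E. \<psi> a) = (if a \<in> E then of_nat (card (annihilator n E)) else 0)"
proof (cases "a \<in> E")
  case True
  thus ?thesis by (simp add: annihilator_def)
next
  case False
  show ?thesis
  proof (cases "coprime a n")
    case True
    obtain \<phi> where \<phi>: "\<phi> \<in> annihilator n E" "\<phi> a \<noteq> 1" using annihilator_separates[OF assms True False] .
    have \<phi>d: "dchar n \<phi>" using \<phi> by (simp add: annihilator_def)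
    let ?T = "\<lambda>\<psi> b. \<phi> b * \<psi> b :: complex"
    have maps: "?T \<psi> \<in> annihilator n E" if "\<psi> \<in> annihilator n E" for \<psi>
      using \<phi> that unfolding annihilator_def by (auto intro: dchar_times_same)
    have inj: "inj_on ?T (annihilator n E)"
    proof (rule inj_onI)
      fix \<psi> \<psi>' assume *: "\<psi> \<in> annihilator n E" "\<psi>' \<in> annihilator n E" "?T \<psi> = ?T \<psi>'"
      have "\<psi> b = \<psi>' b" for b
      proof (cases "coprime b n")
        case True
        hence "\<phi> b \<noteq> 0" using dchar_eq_0_iff[OF \<phi>d] by simp
        thus ?thesis using fun_cong[OF *(3), of b] by simp
      next
        case False
        thus ?thesis using * dchar_eq_0_iff[of n \<psi> b] dchar_eq_0_iff[of n \<psi>' b] by (simp add: annihilator_def)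
      qed
      thus "\<psi> = \<psi>'" by blast
    qed
    have "?T ` annihilator n E = annihilator n E"
      by (rule endo_inj_surj) (use maps inj finite_annihilator assms in auto)
    hence "bij_betw ?T (annihilator n E) (annihilator n E)" using inj by (simp add: bij_betw_def)
    hence "(\<Sum>\<psi>\<in>annihilator n E. \<psi> a) = (\<Sum>\<psi>\<in>annihilator n E. ?T \<psi> a)"
      by (rule sum.reindex_bij_betw[symmetric, where g = "\<lambda>\<psi>. \<psi> a"])
    also have "\<dots> = \<phi> a * (\<Sum>\<psi>\<in>annihilator n E. \<psi> a)" by (simp add: sum_distrib_left)
    finally show ?thesis using \<phi>(2) False by simp
  next
    case F2: False
    have "\<psi> a = 0" if "\<psi> \<in> annihilator n E" for \<psi>
      using that F2 dchar_eq_0_iff[of n \<psi> a] by (simp add: annihilator_def)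
    hence "(\<Sum>\<psi>\<in>annihilator n E. \<psi> a) = 0" by (rule sum.neutral[OF ballI])
    thus ?thesis using False by simp
  qed
qed

lemma card_coprime_below: "n > 0 \<Longrightarrow> card {a\<in>{..<n}. coprime a n} = totient n"
proof (cases "n = 1")
  case False
  assume "n > 0"
  hence "{a\<in>{..<n}. coprime a n} = totatives n" using False totatives_less[of _ n]
    by (auto simp: in_totatives_iff intro!: gr0I)
  thus ?thesis by (simp add: totient_def)
qed (simp add: lessThan_Suc)

text \<open>Double counting of the values \<open>\<psi> a\<close>: summation over characters detects
  \<open>E\<close>, while summation over a period leaves only the principal character.\<close>

lemma card_annihilator:
  assumes "unit_subgroup n E" "n > 0"
  shows "card (annihilator n E) * card (E \<inter> {..<n}) = totient n"
proof -
  have "of_nat (card (annihilator n E) * card (E \<inter> {..<n})) = (\<Sum>a<n. if a \<in> E then of_nat (card (annihilator n E)) else (0::complex))"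
    by (simp add: sum.If_cases Int_commute)
  also have "\<dots> = (\<Sum>a<n. \<Sum>\<psi>\<in>annihilator n E. \<psi> a)" by (simp add: sum_annihilator[OF assms])
  also have "\<dots> = (\<Sum>\<psi>\<in>annihilator n E. \<Sum>a<n. \<psi> a)" by (rule sum.swap)
  also have "\<dots> = (\<Sum>\<psi>\<in>annihilator n E. if \<psi> = princ_char n then (\<Sum>a<n. princ_char n a) else 0)"
    using dchar_sum_period assms(2) by (intro sum.cong) (auto simp: annihilator_def)
  also have "\<dots> = (\<Sum>a<n. princ_char n a)"
    using finite_annihilator[OF assms(2)] princ_char_in_annihilator[OF assms(1)] by simp
  also have "\<dots> = of_nat (totient n)"
    using card_coprime_below[OF assms(2)] by (simp add: princ_char_def sum.If_cases Int_def)
  finally show ?thesis using of_nat_eq_iff by blast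
qed

text \<open>All characters modulo \<open>n\<close> form the annihilator of the trivial subgroup, the
  residue class of 1.\<close>

lemma card_dchars_le:
  assumes "n > 0"
  shows "card {\<psi>. dchar n \<psi>} \<le> n"
proof -
  let ?E = "{a. [a = 1] (mod n)}"
  have E: "unit_subgroup n ?E" unfolding unit_subgroup_def
  proof (intro conjI ballI allI impI)
    show "coprime a n" if "a \<in> ?E" for a using that cong_imp_coprime[OF cong_sym, of a 1 n] by simp
    show "a * b \<in> ?E" if "a \<in> ?E" "b \<in> ?E" for a b using that cong_mult[of a 1 n b 1] by simp
    show "b \<in> ?E" if "a \<in> ?E" "[a = b] (mod n)" for a b using that cong_trans[OF cong_sym] by blast
  qed simp
  have "{\<psi>. dchar n \<psi>} = annihilator n ?E"
    unfolding annihilator_def using dchar_cong[of n _ _ 1] dchar_1[of n] by fastforce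
  moreover have "card (?E \<inter> {..<n}) > 0"
  proof -
    have "1 mod n \<in> ?E \<inter> {..<n}" using assms by (auto simp: unique_euclidean_semiring_class.cong_def)
    thus ?thesis by (subst card_gt_0_iff) auto
  qed
  ultimately have "card {\<psi>. dchar n \<psi>} \<le> totient n"
    using card_annihilator[OF E assms] by (metis One_nat_def Suc_leI mult.right_neutral mult_le_mono2)
  thus ?thesis using totient_le[of n] by simp
qed

section \<open>Primitive characters\<close>

definition primitive_char :: "nat \<Rightarrow> (nat \<Rightarrow> complex) \<Rightarrow> bool" where
  "primitive_char f \<psi> \<longleftrightarrow> f > 0 \<and> dchar f \<psi> \<and>
     (\<forall>g. g dvd f \<and> g < f \<longrightarrow> (\<exists>u. coprime u f \<and> [u = 1] (mod g) \<and> \<psi> u \<noteq> 1))"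

lemma lift_unit:
  fixes a g n :: nat
  assumes "g dvd n" "n > 0" "coprime a g"
  shows "\<exists>b. [b = a] (mod g) \<and> coprime b n"
proof -
  \<comment> \<open>With this \<open>t\<close> every prime divisor of \<open>n\<close> divides
    exactly one of \<open>a\<close> and \<open>g * t\<close>, hence not their sum. Primes dividing
    \<open>a\<close> are kept out of \<open>g\<close> by coprimality.\<close>
  define t where "t = \<Prod>{p \<in> prime_factors n. \<not> p dvd a}"
  have t: "p dvd t \<longleftrightarrow> p dvd n \<and> \<not> p dvd a" if pp: "prime p" for p
  proof
    assume "p dvd t"
    then obtain q where "q \<in> prime_factors n" "\<not> q dvd a" "p dvd q"
      unfolding t_def using prime_dvd_prod_iff[of "{p \<in> prime_factors n. \<not> p dvd a}" p "\<lambda>x. x"] \<open>prime p\<close> by auto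
    thus "p dvd n \<and> \<not> p dvd a"
      using primes_dvd_imp_eq[OF pp, of q] by (auto simp: in_prime_factors_iff)
  next
    assume "p dvd n \<and> \<not> p dvd a"
    thus "p dvd t" unfolding t_def using that assms(2)
      by (intro dvd_prodI[of _ _ "\<lambda>x. x"]) (auto simp: in_prime_factors_iff)
  qed
  have "coprime (a + g * t) n"
  proof (rule ccontr)
    assume "\<not> coprime (a + g * t) n"
    then obtain p where p: "prime p" "p dvd a + g * t" "p dvd n"
      using coprime_iff_gcd_eq_1 prime_factor_nat[of "gcd (a + g * t) n"] by (metis gcd_greatest_iff)
    show False
    proof (cases "p dvd a")
      case True
      hence "p dvd g * t" using p(2) dvd_add_right_iff by blast
      hence "p dvd g" using t[OF p(1)] True p(1) prime_dvd_mult_iff by blast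
      thus False using True assms(3) p(1) coprime_common_divisor not_prime_unit by blast
    next
      case False
      hence "p dvd g * t" using t[OF p(1)] p(3) by simp
      thus False using p(2) False dvd_add_left_iff by blast
    qed
  qed
  moreover have "[a + g * t = a] (mod g)" by (simp add: unique_euclidean_semiring_class.cong_def)
  ultimately show ?thesis by blast
qed

text \<open>The value at a unit modulo \<open>g\<close> is read off from any lift to a unit modulo
  \<open>n\<close>. Two lifts differ by a unit congruent to 1 modulo \<open>g\<close>, on which
  \<psi> is trivial.\<close>

lemma dchar_descend:
  assumes \<psi>: "dchar n \<psi>" and g: "g dvd n" "n > 0"
    and triv: "\<And>u. coprime u n \<Longrightarrow> [u = 1] (mod g) \<Longrightarrow> \<psi> u = 1"
  obtains \<phi> where "dchar g \<phi>" "\<And>a. coprime a n \<Longrightarrow> \<phi> a = \<psi> a"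
proof -
  have wd: "\<psi> b = \<psi> b'" if bb: "coprime b n" "coprime b' n" "[b = b'] (mod g)" for b b'
  proof -
    obtain c where c: "[b' * c = 1] (mod n)" using cong_solve_coprime_nat[of b' n] \<open>coprime b' n\<close> by auto
    hence cn: "coprime c n" by (metis cong_imp_coprime cong_sym coprime_1_left coprime_mult_left_iff)
    have "[b * c = b' * c] (mod g)" using bb(3) by (rule cong_scalar_right)
    moreover have "[b' * c = 1] (mod g)" using c g(1) by (rule cong_dvd_modulus_nat)
    ultimately have "[b * c = 1] (mod g)" by (rule cong_trans)
    hence "\<psi> (b * c) = 1" using triv bb(1) cn by simp
    moreover have "\<psi> (b' * c) = 1" using dchar_cong[OF \<psi> c] dchar_1[OF \<psi>] by simp
    ultimately have "\<psi> b * \<psi> c = \<psi> b' * \<psi> c" by (simp add: dchar_mult[OF \<psi>])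
    moreover have "\<psi> c \<noteq> 0" using cn dchar_eq_0_iff[OF \<psi>] by simp
    ultimately show ?thesis by simp
  qed
  define l where "l a = (SOME b. [b = a] (mod g) \<and> coprime b n)" for a
  have l: "[l a = a] (mod g)" "coprime (l a) n" if "coprime a g" for a
    using someI_ex[OF lift_unit[OF g that]] unfolding l_def by auto
  define \<phi> where "\<phi> a = (if coprime a g then \<psi> (l a) else 0)" for a
  show ?thesis
  proof
    show "dchar g \<phi>" unfolding dchar_def
    proof (intro conjI allI impI)
      fix a b
      show "\<phi> (a * b) = \<phi> a * \<phi> b"
      proof (cases "coprime a g \<and> coprime b g")
        case True
        hence "[l a * l b = a * b] (mod g)" using l by (intro cong_mult) auto
        hence "[l (a * b) = l a * l b] (mod g)" using l[of "a * b"] True by (metis cong_sym cong_trans coprime_mult_left_iff)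
        hence "\<psi> (l (a * b)) = \<psi> (l a * l b)" using l[of a] l[of b] l[of "a * b"] True by (intro wd) auto
        thus ?thesis using True by (simp add: \<phi>_def dchar_mult[OF \<psi>])
      qed (auto simp: \<phi>_def)
    next
      fix a b assume ab: "[a = b] (mod g)"
      have co: "coprime a g \<longleftrightarrow> coprime b g" using ab by (metis cong_imp_coprime cong_sym)
      show "\<phi> a = \<phi> b"
      proof (cases "coprime a g")
        case True
        hence "[l a = l b] (mod g)" using l[of a] l[of b] co ab by (metis cong_sym cong_trans)
        thus ?thesis using wd[of "l a" "l b"] l[of a] l[of b] co True by (simp add: \<phi>_def)
      qed (use co in \<open>simp add: \<phi>_def\<close>)
    next
      fix a show "(\<phi> a = 0) = (\<not> coprime a g)" using l[of a] dchar_eq_0_iff[OF \<psi>] by (simp add: \<phi>_def)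
    qed
    show "\<phi> a = \<psi> a" if "coprime a n" for a
    proof -
      have "coprime a g" using that g(1) by (meson coprime_divisors dvd_refl)
      thus ?thesis using l[of a] wd[of "l a" a] that by (simp add: \<phi>_def)
    qed
  qed
qed

text \<open>A character that is not primitive descends to a proper divisor of its modulus, so strong
  induction on the modulus ends at a primitive one.\<close>

lemma induced_by_primitive:
  assumes "dchar n \<psi>" "n > 0"
  shows "\<exists>f \<phi>. f dvd n \<and> primitive_char f \<phi> \<and> (\<forall>a. coprime a n \<longrightarrow> \<psi> a = \<phi> a)"
  using assms
proof (induction n arbitrary: \<psi> rule: less_induct)
  case (less n)
  show ?case
  proof (cases "primitive_char n \<psi>")
    case False
    then obtain g where g: "g dvd n" "g < n" and triv: "\<And>u. coprime u n \<Longrightarrow> [u = 1] (mod g) \<Longrightarrow> \<psi> u = 1"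
      using less.prems unfolding primitive_char_def by blast
    obtain \<phi> where \<phi>: "dchar g \<phi>" "\<And>a. coprime a n \<Longrightarrow> \<phi> a = \<psi> a"
      using dchar_descend[OF less.prems(1) g(1) less.prems(2) triv] by blast
    have "g > 0" using g less.prems(2) by (auto intro: gr0I)
    from less.IH[OF g(2) \<phi>(1) this] obtain f \<phi>' where f: "f dvd g" "primitive_char f \<phi>'" "\<forall>a. coprime a g \<longrightarrow> \<phi> a = \<phi>' a"
      by blast
    have "\<psi> a = \<phi>' a" if "coprime a n" for a
    proof -
      have "coprime a g" using that g(1) by (meson coprime_divisors dvd_refl)
      thus ?thesis using f(3) \<phi>(2)[OF that] by simp
    qed
    moreover have "f dvd n" using f(1) g(1) by (rule dvd_trans)
    ultimately show ?thesis using f(2) by blast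
  next
    case True
    thus ?thesis using dvd_refl by blast
  qed
qed

lemma cong_pair_solvable:
  fixes u f1 f2 :: nat
  assumes "[u = 1] (mod gcd f1 f2)" "f1 > 0" "f2 > 0"
  shows "\<exists>b. [b = u] (mod f1) \<and> [b = 1] (mod f2)"
proof -
  define g where "g = gcd f1 f2"
  have "[u + f1 = 1] (mod g)"
  proof -
    have "[f1 = 0] (mod g)" by (simp add: cong_0_iff g_def)
    from cong_add[OF assms(1)[folded g_def] this] show ?thesis by simp
  qed
  hence "[1 = u + f1] (mod g)" by (rule cong_sym)
  then obtain r where r: "u + f1 = 1 + g * r"
    using cong_le_nat[of 1 "u + f1" g] assms(2) by (auto simp: algebra_simps cong_sym_eq)
  obtain x where x: "[f1 * x = g] (mod f2)" using cong_solve_nat[of f1 f2] assms by (auto simp: g_def)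
  \<comment> \<open>The factor \<open>f2 - 1\<close> stands for -1 modulo \<open>f2\<close>, so
    \<open>b\<close> is congruent to \<open>u + f1 - g * r = 1\<close> without subtraction of
    naturals. The summand \<open>f1\<close> guarantees \<open>u + f1 >= 1\<close>, so that
    \<open>r\<close> is a natural number.\<close>
  define b where "b = u + f1 + f1 * x * (r * (f2 - 1))"
  have "[b = u] (mod f1)"
  proof -
    have "b = u + f1 * (1 + x * (r * (f2 - 1)))" unfolding b_def by (simp add: algebra_simps)
    thus ?thesis by (simp only: unique_euclidean_semiring_class.cong_def mod_mult_self2)
  qed
  moreover have "[b = u + f1 + g * (r * (f2 - 1))] (mod f2)"
    unfolding b_def using x by (intro cong_add cong_scalar_right cong_refl)
  moreover have "u + f1 + g * (r * (f2 - 1)) = 1 + g * r * f2"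
    using assms(3) unfolding r by (cases f2) (auto simp: algebra_simps)
  moreover have "[1 + g * r * f2 = 1] (mod f2)" by (simp only: unique_euclidean_semiring_class.cong_def mod_mult_self1)
  ultimately show ?thesis by (metis cong_trans)
qed

text \<open>Otherwise \<open>gcd f1 f2\<close> is a proper divisor of \<open>f1\<close>, and
  primitivity supplies \<open>u\<close> congruent to 1 modulo the gcd with value different from 1. A
  common solution of \<open>b = u\<close> modulo \<open>f1\<close> and \<open>b = 1\<close> modulo
  \<open>f2\<close> then tells the two characters apart.\<close>

lemma primitive_char_dvd:
  assumes "primitive_char f1 \<phi>1" "primitive_char f2 \<phi>2"
    and eq: "\<And>a. coprime a (f1 * f2) \<Longrightarrow> \<phi>1 a = \<phi>2 a"
  shows "f1 dvd f2"
proof (rule ccontr)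
  assume "\<not> f1 dvd f2"
  hence "gcd f1 f2 \<noteq> f1" by (metis gcd_dvd2)
  moreover have pos: "f1 > 0" "f2 > 0" using assms by (auto simp: primitive_char_def)
  ultimately have "gcd f1 f2 < f1" using gcd_le1_nat[of f1 f2] by linarith
  then obtain u where u: "coprime u f1" "[u = 1] (mod gcd f1 f2)" "\<phi>1 u \<noteq> 1"
    using assms(1) unfolding primitive_char_def by (meson gcd_dvd1)
  obtain b where b: "[b = u] (mod f1)" "[b = 1] (mod f2)" using cong_pair_solvable[OF u(2) pos] by blast
  have "coprime b f1" "coprime b f2"
    using cong_imp_coprime[OF cong_sym[OF b(1)] u(1)] cong_imp_coprime[OF cong_sym[OF b(2)]] by auto
  hence "\<phi>1 b = \<phi>2 b" by (intro eq) simp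
  moreover have "\<phi>1 b = \<phi>1 u" using assms(1) b(1) by (auto simp: primitive_char_def intro: dchar_cong)
  moreover have "\<phi>2 b = 1" using assms(2) dchar_cong[OF _ b(2)] dchar_1 by (auto simp: primitive_char_def)
  ultimately show False using u(3) by simp
qed

lemma primitive_char_unique:
  assumes "primitive_char f1 \<phi>1" "primitive_char f2 \<phi>2"
    and eq: "\<And>a. coprime a (f1 * f2) \<Longrightarrow> \<phi>1 a = \<phi>2 a"
  shows "f1 = f2" "\<phi>1 = \<phi>2"
proof -
  show f: "f1 = f2"
    using primitive_char_dvd[OF assms] primitive_char_dvd[OF assms(2,1)] eq
    by (metis dvd_antisym mult.commute)
  have "\<phi>1 a = \<phi>2 a" for a
    using eq[of a] assms(1,2) dchar_eq_0_iff[of f1 \<phi>1 a] dchar_eq_0_iff[of f2 \<phi>2 a] f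
    by (cases "coprime a f1") (auto simp: primitive_char_def)
  thus "\<phi>1 = \<phi>2" by blast
qed

text \<open>A principal product would make the two characters agree on all common units, and
  primitive characters agreeing there coincide together with their moduli. This is the orthogonality
  input of the large sieve, across different conductors.\<close>

lemma primitive_char_times_cnj:
  assumes "primitive_char f1 \<phi>1" "primitive_char f2 \<phi>2" "(f1, \<phi>1) \<noteq> (f2, \<phi>2)"
  shows "dchar (f1 * f2) (\<lambda>a. \<phi>1 a * cnj (\<phi>2 a))" "(\<lambda>a. \<phi>1 a * cnj (\<phi>2 a)) \<noteq> princ_char (f1 * f2)"
proof -
  have d: "dchar f1 \<phi>1" "dchar f2 \<phi>2" "f1 > 0" "f2 > 0" using assms by (auto simp: primitive_char_def)
  show "dchar (f1 * f2) (\<lambda>a. \<phi>1 a * cnj (\<phi>2 a))" using dchar_times[OF d(1) dchar_cnj[OF d(2)]] .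
  show "(\<lambda>a. \<phi>1 a * cnj (\<phi>2 a)) \<noteq> princ_char (f1 * f2)"
  proof
    assume *: "(\<lambda>a. \<phi>1 a * cnj (\<phi>2 a)) = princ_char (f1 * f2)"
    have "\<phi>1 a = \<phi>2 a" if "coprime a (f1 * f2)" for a
    proof -
      have "\<phi>1 a * cnj (\<phi>2 a) = 1" using fun_cong[OF *, of a] that by (simp add: princ_char_def)
      moreover have "cnj (\<phi>2 a) * \<phi>2 a = 1" using dchar_cnj_mult[OF d(2,4)] that by simp
      ultimately show ?thesis by (metis mult.assoc mult.left_neutral mult.right_neutral)
    qed
    from primitive_char_unique[OF assms(1,2) this] show False using assms(3) by simp
  qed
qed

section \<open>Bessel's inequality and mean squares of divisor functions\<close>

text \<open>Duality: the left side \<open>S\<close> equals the pairing of \<xi> with the combination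
  \<open>v\<close> of the vectors \<phi>, weighted by the conjugate coefficients. Cauchy-Schwarz
  reduces the claim to a bound \<open>D * S\<close> for the square norm of \<open>v\<close>.\<close>

lemma generalized_bessel:
  fixes \<phi> :: "'i \<Rightarrow> 'a \<Rightarrow> complex" and \<xi> :: "'a \<Rightarrow> complex"
  assumes D0: "D \<ge> 0" and D: "\<And>r. r \<in> I \<Longrightarrow> (\<Sum>s\<in>I. norm (\<Sum>m\<in>A. \<phi> r m * cnj (\<phi> s m))) \<le> D"
  shows "(\<Sum>r\<in>I. (norm (\<Sum>m\<in>A. \<xi> m * \<phi> r m))\<^sup>2) \<le> D * (\<Sum>m\<in>A. (norm (\<xi> m))\<^sup>2)"
proof -
  define u where "u r = (\<Sum>m\<in>A. \<xi> m * \<phi> r m)" for r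
  define v where "v m = (\<Sum>r\<in>I. cnj (u r) * \<phi> r m)" for m
  define S where "S = (\<Sum>r\<in>I. (norm (u r))\<^sup>2)"
  have S0: "S \<ge> 0" by (simp add: S_def sum_nonneg)
  define K where "K r s = norm (\<Sum>m\<in>A. \<phi> r m * cnj (\<phi> s m))" for r s
  have Ksym: "K r s = K s r" for r s
  proof -
    have "(\<Sum>m\<in>A. \<phi> r m * cnj (\<phi> s m)) = cnj (\<Sum>m\<in>A. \<phi> s m * cnj (\<phi> r m))"
      by (simp add: mult.commute)
    thus ?thesis unfolding K_def by (metis complex_mod_cnj)
  qed
  have "complex_of_real S = (\<Sum>r\<in>I. cnj (u r) * u r)"
    unfolding S_def of_real_sum by (intro sum.cong refl) (metis complex_norm_square mult.commute of_real_power)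
  also have "\<dots> = (\<Sum>r\<in>I. \<Sum>m\<in>A. \<xi> m * (cnj (u r) * \<phi> r m))"
    by (subst (2) u_def) (simp add: sum_distrib_left mult_ac)
  also have "\<dots> = (\<Sum>m\<in>A. \<xi> m * v m)" by (subst sum.swap) (simp add: v_def sum_distrib_left)
  finally have Sv: "complex_of_real S = (\<Sum>m\<in>A. \<xi> m * v m)" .
  have "S = norm (complex_of_real S)" using S0 by simp
  also have "\<dots> \<le> (\<Sum>m\<in>A. norm (\<xi> m) * norm (v m))" unfolding Sv
    by (rule order_trans[OF norm_sum]) (simp add: norm_mult)
  finally have "S\<^sup>2 \<le> (\<Sum>m\<in>A. norm (\<xi> m) * norm (v m))\<^sup>2" using S0 by (intro power_mono)
  also have "\<dots> \<le> (\<Sum>m\<in>A. (norm (\<xi> m))\<^sup>2) * (\<Sum>m\<in>A. (norm (v m))\<^sup>2)" by (rule Cauchy_Schwarz_ineq_sum)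
  \<comment> \<open>Schur's test: the arithmetic-geometric mean inequality decouples the two
    coefficients, and symmetry of the Gram matrix \<open>K\<close> makes both halves equal to a
    weighted row sum.\<close>
  also have "(\<Sum>m\<in>A. (norm (v m))\<^sup>2) \<le> D * S"
  proof -
    have "complex_of_real (\<Sum>m\<in>A. (norm (v m))\<^sup>2) = (\<Sum>m\<in>A. v m * cnj (v m))"
      unfolding of_real_sum by (intro sum.cong refl) (metis complex_norm_square of_real_power)
    also have "\<dots> = (\<Sum>m\<in>A. \<Sum>r\<in>I. \<Sum>s\<in>I. cnj (u r) * u s * (\<phi> r m * cnj (\<phi> s m)))"
      unfolding v_def cnj_sum sum_product by (simp add: mult_ac)
    also have "\<dots> = (\<Sum>r\<in>I. \<Sum>s\<in>I. \<Sum>m\<in>A. cnj (u r) * u s * (\<phi> r m * cnj (\<phi> s m)))"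
      by (subst sum.swap, intro sum.cong refl, subst sum.swap) simp
    also have "\<dots> = (\<Sum>r\<in>I. \<Sum>s\<in>I. cnj (u r) * u s * (\<Sum>m\<in>A. \<phi> r m * cnj (\<phi> s m)))"
      by (simp add: sum_distrib_left)
    finally have eq: "complex_of_real (\<Sum>m\<in>A. (norm (v m))\<^sup>2) = \<dots>" .
    have "(\<Sum>m\<in>A. (norm (v m))\<^sup>2) = norm (complex_of_real (\<Sum>m\<in>A. (norm (v m))\<^sup>2))"
      unfolding norm_of_real by (simp add: sum_nonneg)
    also have "\<dots> \<le> (\<Sum>r\<in>I. \<Sum>s\<in>I. norm (u r) * norm (u s) * K r s)"
      unfolding eq by (intro sum_norm_le) (simp add: norm_mult K_def)
    also have "\<dots> \<le> (\<Sum>r\<in>I. \<Sum>s\<in>I. ((norm (u r))\<^sup>2 * K r s + (norm (u s))\<^sup>2 * K r s) / 2)"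
    proof (intro sum_mono)
      fix r s
      have "norm (u r) * norm (u s) \<le> ((norm (u r))\<^sup>2 + (norm (u s))\<^sup>2) / 2"
        using sum_squares_bound[of "norm (u r)" "norm (u s)"] by simp
      hence "norm (u r) * norm (u s) * K r s \<le> ((norm (u r))\<^sup>2 + (norm (u s))\<^sup>2) / 2 * K r s"
        by (intro mult_right_mono) (auto simp: K_def)
      thus "norm (u r) * norm (u s) * K r s \<le> ((norm (u r))\<^sup>2 * K r s + (norm (u s))\<^sup>2 * K r s) / 2"
        by (simp add: algebra_simps)
    qed
    also have "\<dots> = ((\<Sum>r\<in>I. \<Sum>s\<in>I. (norm (u r))\<^sup>2 * K r s) + (\<Sum>r\<in>I. \<Sum>s\<in>I. (norm (u s))\<^sup>2 * K r s)) / 2"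
      by (simp add: sum.distrib flip: sum_divide_distrib)
    also have "(\<Sum>r\<in>I. \<Sum>s\<in>I. (norm (u s))\<^sup>2 * K r s) = (\<Sum>r\<in>I. \<Sum>s\<in>I. (norm (u r))\<^sup>2 * K r s)"
      by (subst sum.swap) (simp add: Ksym)
    also have "((\<Sum>r\<in>I. \<Sum>s\<in>I. (norm (u r))\<^sup>2 * K r s) + (\<Sum>r\<in>I. \<Sum>s\<in>I. (norm (u r))\<^sup>2 * K r s)) / 2
       = (\<Sum>r\<in>I. (norm (u r))\<^sup>2 * (\<Sum>s\<in>I. K r s))" by (simp only: add_divide_distrib field_sum_of_halves sum_distrib_left)
    also have "\<dots> \<le> (\<Sum>r\<in>I. (norm (u r))\<^sup>2 * D)"
      by (intro sum_mono mult_left_mono) (use D in \<open>auto simp: K_def\<close>)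
    also have "\<dots> = D * S" by (simp add: S_def sum_distrib_left mult.commute)
    finally show ?thesis .
  qed
  finally have "S\<^sup>2 \<le> (\<Sum>m\<in>A. (norm (\<xi> m))\<^sup>2) * (D * S)" by (simp add: mult_left_mono sum_nonneg)
  hence *: "S * S \<le> D * (\<Sum>m\<in>A. (norm (\<xi> m))\<^sup>2) * S" by (simp add: power2_eq_square mult_ac)
  have "S \<le> D * (\<Sum>m\<in>A. (norm (\<xi> m))\<^sup>2)"
  proof (cases "S = 0")
    case False
    thus ?thesis using * S0 by (simp add: mult_le_cancel_right)
  next
    case True
    thus ?thesis using D0 by (simp add: sum_nonneg)
  qed
  thus ?thesis by (simp add: S_def u_def)
qed

section \<open>The \<open>k\<close>-fold divisor functions, counting ordered factorizations of a
  positive \<open>n\<close> into \<open>k\<close> factors\<close>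

fun tau :: "nat \<Rightarrow> nat \<Rightarrow> nat" where
  "tau 0 n = (if n = 1 then 1 else 0)"
| "tau (Suc k) n = (\<Sum>d | d dvd n. tau k d)"

lemma tau_1 [simp]: "tau k (Suc 0) = 1"
  by (induction k) auto

text \<open>Every divisor of \<open>a * b\<close> is a product of a divisor of \<open>a\<close> and
  a divisor of \<open>b\<close>, possibly in several ways; hence an inequality, with no coprimality
  assumed.\<close>

lemma tau_mult_le:
  assumes "a > 0" "b > 0"
  shows "tau k (a * b) \<le> tau k a * tau k b"
  using assms
proof (induction k arbitrary: a b)
  case (Suc k)
  let ?D = "\<lambda>n::nat. {d. d dvd n}"
  have fin: "finite (?D a \<times> ?D b)" using Suc.prems by simp
  have "?D (a * b) = (\<lambda>(x, y). x * y) ` (?D a \<times> ?D b)"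
  proof (intro equalityI subsetI)
    fix d assume "d \<in> ?D (a * b)"
    then obtain b' c' where "d = b' * c'" "b' dvd a" "c' dvd b" using division_decomp[of d a b] by auto
    thus "d \<in> (\<lambda>(x, y). x * y) ` (?D a \<times> ?D b)" by auto
  qed (auto intro: mult_dvd_mono)
  hence "tau (Suc k) (a * b) \<le> (\<Sum>z\<in>?D a \<times> ?D b. tau k (case z of (x, y) \<Rightarrow> x * y))"
    using sum_image_le[OF fin, of "tau k" "\<lambda>(x, y). x * y"] by (simp add: o_def)
  also have "\<dots> \<le> (\<Sum>(x, y)\<in>?D a \<times> ?D b. tau k x * tau k y)"
    using Suc.prems by (intro sum_mono) (auto intro!: Suc.IH intro: dvd_pos_nat)
  also have "\<dots> = tau (Suc k) a * tau (Suc k) b" by (simp add: sum_product sum.cartesian_product)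
  finally show ?case .
qed auto

lemma bij_betw_divisor_chains:
  assumes "n > (0::nat)"
  shows "bij_betw (\<lambda>(e, d). (d, e div d)) (SIGMA e:{e. e dvd n}. {d. d dvd e}) (SIGMA d:{d. d dvd n}. {c. c dvd n div d})"
proof (rule bij_betwI[where g = "\<lambda>(d, c). (d * c, d)"])
  have pos: "d > 0" if "d dvd n" for d using that assms by (rule dvd_pos_nat[rotated])
  show "(\<lambda>(e, d). (d, e div d)) \<in> (SIGMA e:{e. e dvd n}. {d. d dvd e}) \<rightarrow> (SIGMA d:{d. d dvd n}. {c. c dvd n div d})"
    by (auto intro: dvd_trans div_dvd_div[THEN iffD2])
  show "(\<lambda>(d, c). (d * c, d)) \<in> (SIGMA d:{d. d dvd n}. {c. c dvd n div d}) \<rightarrow> (SIGMA e:{e. e dvd n}. {d. d dvd e})"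
    using pos by (auto simp: dvd_div_iff_mult mult.commute)
  show "(case case z of (e, d) \<Rightarrow> (d, e div d) of (d, c) \<Rightarrow> (d * c, d)) = z"
    if "z \<in> (SIGMA e:{e. e dvd n}. {d. d dvd e})" for z using that by auto
  show "(case case z of (d, c) \<Rightarrow> (d * c, d) of (e, d) \<Rightarrow> (d, e div d)) = z"
    if "z \<in> (SIGMA d:{d. d dvd n}. {c. c dvd n div d})" for z using that pos by auto
qed

text \<open>Associativity of Dirichlet convolution: chains \<open>d dvd e dvd n\<close> are
  re-indexed by \<open>d\<close> and the quotient of \<open>e\<close> by \<open>d\<close>.\<close>

lemma tau_add:
  assumes "n > 0"
  shows "tau (k + l) n = (\<Sum>d | d dvd n. tau k d * tau l (n div d))"
  using assms
proof (induction l arbitrary: n)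
  case 0
  have "(\<Sum>d | d dvd n. tau k d * tau 0 (n div d)) = (\<Sum>d | d dvd n. if d = n then tau k d else 0)"
    using 0 by (intro sum.cong) (auto elim!: dvdE)
  thus ?case using 0 by simp
next
  case (Suc l)
  have fin: "finite {d. d dvd e}" if "e dvd n" for e using that Suc.prems by (simp add: dvd_pos_nat)
  have "tau (k + Suc l) n = (\<Sum>e | e dvd n. \<Sum>d | d dvd e. tau k d * tau l (e div d))"
    using Suc by (auto intro!: sum.cong Suc.IH dvd_pos_nat[of n])
  also have "\<dots> = (\<Sum>(e, d)\<in>(SIGMA e:{e. e dvd n}. {d. d dvd e}). tau k d * tau l (e div d))"
    using fin Suc.prems by (subst sum.Sigma) auto
  also have "\<dots> = (\<Sum>(d, c)\<in>(SIGMA d:{d. d dvd n}. {c. c dvd n div d}). tau k d * tau l c)"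
    by (subst sum.reindex_bij_betw[OF bij_betw_divisor_chains[OF Suc.prems], symmetric]) (simp add: case_prod_unfold)
  also have "\<dots> = (\<Sum>d | d dvd n. \<Sum>c | c dvd n div d. tau k d * tau l c)"
    using Suc.prems by (subst sum.Sigma) (auto elim!: dvdE)
  also have "\<dots> = (\<Sum>d | d dvd n. tau k d * tau (Suc l) (n div d))" by (simp add: sum_distrib_left)
  finally show ?case .
qed

text \<open>In each term \<open>tau l n\<close> is split submultiplicatively along
  \<open>n = d * (n div d)\<close>, after which the convolution law recombines the parts. A square
  of \<open>tau k\<close> is thereby dominated by one convolution power, to which Dirichlet series
  bounds apply.\<close>

lemma tau_times_tau_le:
  assumes "n > 0"
  shows "tau k n * tau l n \<le> tau (k * l) n"
  using assms
proof (induction k arbitrary: n)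
  case (Suc k)
  have "tau (Suc k) n * tau l n = (\<Sum>d | d dvd n. tau k d * tau l n)" by (simp add: sum_distrib_right)
  also have "\<dots> \<le> (\<Sum>d | d dvd n. tau (k * l) d * tau l (n div d))"
  proof (intro sum_mono)
    fix d assume "d \<in> {d. d dvd n}"
    hence d: "d dvd n" "d > 0" "n div d > 0" "n = d * (n div d)" using Suc.prems by (auto elim!: dvdE)
    have "tau k d * tau l n \<le> tau k d * (tau l d * tau l (n div d))"
      using tau_mult_le[OF d(2,3), of l] d(4) by (intro mult_left_mono) auto
    also have "\<dots> \<le> tau (k * l) d * tau l (n div d)"
      using Suc.IH[OF d(2)] by (simp add: mult.assoc[symmetric] mult_right_mono)
    finally show "tau k d * tau l n \<le> tau (k * l) d * tau l (n div d)" .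
  qed
  also have "\<dots> = tau (Suc k * l) n" using tau_add[OF Suc.prems, of "k * l" l] by (simp add: add.commute)
  finally show ?case .
qed auto

text \<open>Expanding the \<open>k\<close>-th power on the right produces every factorization of
  \<open>m\<close> into \<open>k\<close> factors from \<open>A\<close>; as \<open>A\<close> is
  closed under divisors, no factorization of an element of \<open>A\<close> is missed.\<close>

lemma sum_tau_powr_le:
  assumes "finite A" "0 \<notin> A" "\<And>m d. m \<in> A \<Longrightarrow> d dvd m \<Longrightarrow> d \<in> A"
  shows "(\<Sum>m\<in>A. real (tau k m) * real m powr s) \<le> (\<Sum>m\<in>A. real m powr s) ^ k"
proof (induction k)
  case 0
  have "(\<Sum>m\<in>A. real (tau 0 m) * real m powr s) = (\<Sum>m\<in>A. if m = 1 then 1 else 0)"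
    by (intro sum.cong) auto
  also have "\<dots> \<le> 1" using assms(1) by simp
  finally show ?case by simp
next
  case (Suc k)
  have pos: "m > 0" if "m \<in> A" for m using that assms(2) by (auto intro: gr0I)
  let ?S = "SIGMA m:A. {d. d dvd m}"
  let ?h = "\<lambda>(d, e). (real (tau k d) * real d powr s) * real e powr s"
  have inj: "inj_on (\<lambda>(m, d). (d, m div d)) ?S"
    by (rule inj_onI) (auto simp: dvd_div_eq_iff pos)
  have "(\<Sum>m\<in>A. real (tau (Suc k) m) * real m powr s) = (\<Sum>m\<in>A. \<Sum>d | d dvd m. real (tau k d) * real m powr s)"
    by (simp add: sum_distrib_right)
  also have "\<dots> = (\<Sum>(m, d)\<in>?S. real (tau k d) * real m powr s)"
    using assms pos by (subst sum.Sigma) auto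
  also have "\<dots> = (\<Sum>z\<in>?S. ?h (case z of (m, d) \<Rightarrow> (d, m div d)))"
  proof (intro sum.cong refl)
    fix z assume "z \<in> ?S"
    then obtain m d where md: "z = (m, d)" "m \<in> A" "d dvd m" by blast
    hence "real m = real d * real (m div d)" by (metis dvd_mult_div_cancel of_nat_mult)
    hence "real m powr s = real d powr s * real (m div d) powr s" by (simp add: powr_mult)
    thus "(case z of (m, d) \<Rightarrow> real (tau k d) * real m powr s) = ?h (case z of (m, d) \<Rightarrow> (d, m div d))"
      by (simp add: md(1))
  qed
  also have "\<dots> = sum ?h ((\<lambda>(m, d). (d, m div d)) ` ?S)" using inj by (subst sum.reindex) (simp_all add: o_def)
  also have "\<dots> \<le> sum ?h (A \<times> A)"
  proof (intro sum_mono2)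
    show "(\<lambda>(m, d). (d, m div d)) ` ?S \<subseteq> A \<times> A"
      using assms(3) by (auto intro: div_dvd_iff_mult[THEN iffD2] simp: dvd_pos_nat[OF pos])
  qed (use assms in auto)
  also have "\<dots> = (\<Sum>m\<in>A. real (tau k m) * real m powr s) * (\<Sum>m\<in>A. real m powr s)"
    by (simp add: sum_product sum.cartesian_product)
  also have "\<dots> \<le> (\<Sum>m\<in>A. real m powr s) ^ k * (\<Sum>m\<in>A. real m powr s)"
    using Suc by (intro mult_right_mono sum_nonneg) auto
  finally show ?case by (simp add: mult.commute)
qed

section \<open>Smooth and rough numbers, and the mean square of the divisor functions\<close>

definition smooth :: "nat \<Rightarrow> nat \<Rightarrow> bool" where
  "smooth P m \<longleftrightarrow> (\<forall>p. prime p \<longrightarrow> p dvd m \<longrightarrow> p \<le> P)"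

definition rough :: "nat \<Rightarrow> nat \<Rightarrow> bool" where
  "rough P m \<longleftrightarrow> (\<forall>p. prime p \<longrightarrow> p dvd m \<longrightarrow> p > P)"

lemma smooth_rough_decomp:
  "m > 0 \<Longrightarrow> \<exists>s r. m = s * r \<and> smooth P s \<and> rough P r"
proof (induction m rule: less_induct)
  case (less m)
  show ?case
  proof (cases "m = 1")
    case True
    thus ?thesis by (intro exI[of _ 1]) (auto simp: smooth_def rough_def)
  next
    case False
    then obtain p where p: "prime p" "p dvd m" using prime_factor_nat by blast
    then obtain m' where m': "m = p * m'" by blast
    hence "m' < m" "m' > 0" using less.prems p prime_gt_1_nat[OF p(1)] by auto
    from less.IH[OF this] obtain s r where sr: "m' = s * r" "smooth P s" "rough P r" by blast
    show ?thesis
    proof (cases "p \<le> P")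
      case True
      hence "smooth P (p * s)" using sr(2) p(1) primes_dvd_imp_eq
        unfolding smooth_def by (auto simp: prime_dvd_mult_iff dest: primes_dvd_imp_eq)
      thus ?thesis using sr m' by (intro exI[of _ "p * s"] exI[of _ r]) auto
    next
      case False
      hence "rough P (p * r)" using sr(3) p(1)
        unfolding rough_def by (auto simp: prime_dvd_mult_iff dest: primes_dvd_imp_eq)
      thus ?thesis using sr m' by (intro exI[of _ s] exI[of _ "p * r"]) auto
    qed
  qed
qed

text \<open>A finite Euler product converges for every positive exponent: each new prime multiplies
  the bound by one geometric series.\<close>

lemma smooth_sum_bounded:
  assumes "s > (0::real)"
  shows "\<exists>C\<ge>1. \<forall>X. (\<Sum>m | m \<in> {1..X} \<and> smooth P m. real m powr -s) \<le> C"
proof (induction P)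
  case 0
  have "(\<Sum>m | m \<in> {1..X} \<and> smooth 0 m. real m powr -s) \<le> (\<Sum>m\<in>{1::nat}. real m powr -s)" for X
  proof (intro sum_mono2)
    show "{m \<in> {1..X}. smooth 0 m} \<subseteq> {1}"
      using prime_factor_nat prime_gt_0_nat unfolding smooth_def by fastforce
  qed auto
  thus ?case by (intro exI[of _ 1]) auto
next
  case (Suc P)
  then obtain C where C: "C \<ge> 1" "\<And>X. (\<Sum>m | m \<in> {1..X} \<and> smooth P m. real m powr -s) \<le> C" by blast
  show ?case
  proof (cases "prime (Suc P)")
    case False
    hence "smooth (Suc P) m = smooth P m" for m unfolding smooth_def by (metis le_Suc_eq)
    thus ?thesis using C by auto
  next
    case True
    define p where "p = Suc P"
    have p: "prime p" using True by (simp add: p_def)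
    define z where "z = real p powr -s"
    have z: "0 < z" "z < 1" using prime_gt_1_nat[OF p] assms unfolding z_def
      by (auto simp: powr_less_one)
    have "(\<Sum>m | m \<in> {1..X} \<and> smooth p m. real m powr -s) \<le> C * (1 / (1 - z))" for X
    proof -
      let ?T = "{m \<in> {1..X}. smooth P m}"
      let ?f = "\<lambda>(i, t). p ^ i * t"
      have "(\<Sum>m | m \<in> {1..X} \<and> smooth p m. real m powr -s) \<le> sum (\<lambda>m. real m powr -s) (?f ` ({..<X} \<times> ?T))"
      proof (intro sum_mono2)
        show "{m \<in> {1..X}. smooth p m} \<subseteq> ?f ` ({..<X} \<times> ?T)"
        proof
          fix m assume m: "m \<in> {m \<in> {1..X}. smooth p m}"
          obtain t where t: "m = p ^ multiplicity p m * t" "\<not> p dvd t"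
            using multiplicity_decompose'[of m p] m prime_gt_1_nat[OF p] by auto
          define i where "i = multiplicity p m"
          have mi: "m = p ^ i * t" using t by (simp add: i_def)
          have "t > 0" using t m by (auto intro: gr0I)
          have "t dvd m" using mi by simp
          hence "t \<le> X" using m dvd_imp_le[of t m] by auto
          have "smooth P t" unfolding smooth_def
          proof (intro allI impI)
            fix q assume q: "prime q" "q dvd t"
            hence "q \<le> p" using m \<open>t dvd m\<close> unfolding smooth_def by (auto dest: dvd_trans)
            moreover have "q \<noteq> p" using q t by auto
            ultimately show "q \<le> P" by (simp add: p_def)
          qed
          moreover have "i < X"
          proof -
            have "i < 2 ^ i" by (rule less_exp)
            also have "\<dots> \<le> p ^ i" using prime_ge_2_nat[OF p] by (intro power_mono) auto
            also have "\<dots> \<le> m" using mi \<open>t > 0\<close> by simp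
            finally show ?thesis using m by simp
          qed
          ultimately show "m \<in> ?f ` ({..<X} \<times> ?T)" using mi \<open>t > 0\<close> \<open>t \<le> X\<close>
            by (intro image_eqI[of _ _ "(i, t)"]) auto
        qed
      qed auto
      also have "\<dots> \<le> (\<Sum>x\<in>{..<X} \<times> ?T. real (?f x) powr -s)"
        using sum_image_le[of "{..<X} \<times> ?T" "\<lambda>m. real m powr -s" ?f] by (simp add: o_def)
      also have "\<dots> = (\<Sum>(i, t)\<in>{..<X} \<times> ?T. z ^ i * real t powr -s)"
      proof (intro sum.cong refl, clarify)
        fix i t
        have "(real p ^ i) powr -s = z ^ i"
          using prime_gt_0_nat[OF p] by (simp add: z_def powr_power powr_powr mult.commute flip: powr_realpow)
        thus "real (p ^ i * t) powr -s = z ^ i * real t powr -s" by (simp add: powr_mult)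
      qed
      also have "\<dots> = (\<Sum>i<X. z ^ i) * (\<Sum>t\<in>?T. real t powr -s)" by (simp add: sum_product sum.cartesian_product)
      also have "\<dots> \<le> (1 / (1 - z)) * C"
      proof (intro mult_mono C(2)[of X])
        show "(\<Sum>i<X. z ^ i) \<le> 1 / (1 - z)" using z by (simp add: sum_gp_strict divide_right_mono)
      qed (use z in \<open>auto intro: sum_nonneg\<close>)
      finally show ?thesis by (simp add: mult.commute)
    qed
    moreover have "C * (1 / (1 - z)) \<ge> 1" using C(1) z by (simp add: field_simps)
    ultimately show ?thesis unfolding p_def by blast
  qed
qed

text \<open>Apart from 1, every rough number exceeds \<open>P\<close>, so the sum is 1 plus part of
  the tail of a convergent series.\<close>

lemma rough_sum_bounded:
  assumes "s > (1::real)" "\<epsilon> > 0"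
  shows "\<exists>P. \<forall>X. (\<Sum>m | m \<in> {1..X} \<and> rough P m. real m powr -s) \<le> 1 + \<epsilon>"
proof -
  have summ: "summable (\<lambda>n. real n powr -s)" using assms by (simp add: summable_real_powr_iff)
  obtain P0 where P0: "\<And>m. m \<ge> P0 \<Longrightarrow> (\<forall>n. norm (sum (\<lambda>n. real n powr -s) {m..<n}) < \<epsilon>)"
    using summ[unfolded summable_Cauchy] assms(2) by blast
  have "(\<Sum>m | m \<in> {1..X} \<and> rough P0 m. real m powr -s) \<le> 1 + \<epsilon>" for X
  proof -
    have "(\<Sum>m | m \<in> {1..X} \<and> rough P0 m. real m powr -s) \<le> (\<Sum>m\<in>insert 1 {Suc P0..<Suc X}. real m powr -s)"
    proof (intro sum_mono2)
      show "{m \<in> {1..X}. rough P0 m} \<subseteq> insert 1 {Suc P0..<Suc X}"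
      proof
        fix m assume m: "m \<in> {m \<in> {1..X}. rough P0 m}"
        show "m \<in> insert 1 {Suc P0..<Suc X}"
        proof (cases "m = 1")
          case False
          then obtain p where "prime p" "p dvd m" using prime_factor_nat by blast
          hence "p > P0" "p \<le> m" using m by (auto simp: rough_def intro: dvd_imp_le)
          thus ?thesis using m by auto
        qed simp
      qed
    qed auto
    also have "\<dots> \<le> 1 + (\<Sum>m\<in>{Suc P0..<Suc X}. real m powr -s)" by (simp add: sum.insert_if)
    also have "\<dots> \<le> 1 + \<epsilon>" using spec[OF P0[of "Suc P0"], of "Suc X"] by simp
    finally show ?thesis .
  qed
  thus ?thesis by blast
qed

lemma smooth_dvd: "smooth P m \<Longrightarrow> d dvd m \<Longrightarrow> smooth P d"
  unfolding smooth_def using dvd_trans by blast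
lemma rough_dvd: "rough P m \<Longrightarrow> d dvd m \<Longrightarrow> rough P d"
  unfolding rough_def using dvd_trans by blast

lemma sum_square_le_square_sum:
  fixes f :: "'a \<Rightarrow> real"
  assumes "finite A" "\<And>a. a \<in> A \<Longrightarrow> f a \<ge> 0"
  shows "(\<Sum>a\<in>A. (f a)\<^sup>2) \<le> (\<Sum>a\<in>A. f a)\<^sup>2"
proof -
  have "(\<Sum>a\<in>A. (f a)\<^sup>2) \<le> (\<Sum>a\<in>A. f a * (\<Sum>b\<in>A. f b))"
    unfolding power2_eq_square using assms by (intro sum_mono mult_left_mono member_le_sum) auto
  thus ?thesis by (simp add: power2_eq_square sum_distrib_right)
qed

text \<open>For \<open>P\<close>-rough \<open>m\<close> the bound \<open>tau k m * tau k m \<le> tau (k * k) m\<close> costs only a factor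
  \<open>exp (\<epsilon> k\<^sup>2)\<close> when \<open>P\<close> is large; the \<open>P\<close>-smooth part contributes \<open>exp (C k)\<close>.\<close>

lemma sum_tau_squared_le:
  assumes "s > 1 / 2" "\<epsilon> > 0"
  shows "\<exists>C\<ge>0. \<forall>k X. (\<Sum>m\<in>{1..X}. (real (tau k m))\<^sup>2) \<le> real X powr (2 * s) * exp (\<epsilon> * real k ^ 2 + C * real k)"
proof -
  define e where "e = exp \<epsilon> - 1"
  have e: "e > 0" using assms by (simp add: e_def)
  obtain P where P: "\<And>X. (\<Sum>m | m \<in> {1..X} \<and> rough P m. real m powr - (2 * s)) \<le> 1 + e"
    using rough_sum_bounded[of "2 * s" e] assms(1) e by auto
  have "s > 0" using assms by simp
  obtain B where B: "B \<ge> 1" "\<And>X. (\<Sum>m | m \<in> {1..X} \<and> smooth P m. real m powr -s) \<le> B"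
    using smooth_sum_bounded[OF \<open>s > 0\<close>, of P] by blast
  have main: "(\<Sum>m\<in>{1..X}. (real (tau k m))\<^sup>2) \<le> real X powr (2 * s) * exp (\<epsilon> * real k ^ 2 + 2 * ln B * real k)" for k X
  proof -
    let ?g = "\<lambda>m. (real (tau k m))\<^sup>2 * real m powr -(2 * s)"
    let ?S = "{m \<in> {1..X}. smooth P m}" and ?R = "{m \<in> {1..X}. rough P m}"
    \<comment> \<open>Each term is weighted by \<open>(X / m) powr (2 * s) >= 1\<close>, which turns
      the finite sum into a Dirichlet series. The exponent \<open>2 * s > 1\<close> is what the
      rough part needs.\<close>
    have "(\<Sum>m\<in>{1..X}. (real (tau k m))\<^sup>2) \<le> (\<Sum>m\<in>{1..X}. real X powr (2 * s) * ?g m)"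
    proof (intro sum_mono)
      fix m assume m: "m \<in> {1..X}"
      have "real m powr (2 * s) \<le> real X powr (2 * s)" using m assms(1) by (intro powr_mono2) auto
      hence "1 \<le> real X powr (2 * s) * real m powr -(2 * s)"
        using m by (simp add: powr_minus field_simps)
      hence "(real (tau k m))\<^sup>2 * 1 \<le> (real (tau k m))\<^sup>2 * (real X powr (2 * s) * real m powr -(2 * s))"
        by (intro mult_left_mono) auto
      thus "(real (tau k m))\<^sup>2 \<le> real X powr (2 * s) * ?g m" by (simp add: mult_ac)
    qed
    also have "\<dots> = real X powr (2 * s) * (\<Sum>m\<in>{1..X}. ?g m)" by (simp add: sum_distrib_left)
    also have "(\<Sum>m\<in>{1..X}. ?g m) \<le> (\<Sum>m\<in>(\<lambda>(a, b). a * b) ` (?S \<times> ?R). ?g m)"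
    proof (intro sum_mono2)
      show "{1..X} \<subseteq> (\<lambda>(a, b). a * b) ` (?S \<times> ?R)"
      proof
        fix m assume m: "m \<in> {1..X}"
        then obtain a b where ab: "m = a * b" "smooth P a" "rough P b" using smooth_rough_decomp[of m P] by auto
        have "a \<ge> 1" "b \<ge> 1" using m ab(1) by (auto simp: Suc_leI)
        moreover from this have "a \<le> m" "b \<le> m" using ab(1) by auto
        ultimately have "a \<ge> 1" "b \<ge> 1" "a \<le> X" "b \<le> X" using m by auto
        thus "m \<in> (\<lambda>(a, b). a * b) ` (?S \<times> ?R)" using m ab by (intro image_eqI[of _ _ "(a, b)"]) auto
      qed
    qed auto
    also have "\<dots> \<le> (\<Sum>z\<in>?S \<times> ?R. ?g (case z of (a, b) \<Rightarrow> a * b))"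
      using sum_image_le[of "?S \<times> ?R" ?g "\<lambda>(a, b). a * b"] by (simp add: o_def)
    also have "\<dots> \<le> (\<Sum>(a, b)\<in>?S \<times> ?R. ?g a * ?g b)"
    proof (intro sum_mono, clarify)
      fix a b assume ab: "a \<in> {1..X}" "b \<in> {1..X}"
      have "real (tau k (a * b)) \<le> real (tau k a) * real (tau k b)"
        using tau_mult_le[of a b k] ab by (metis (mono_tags, lifting) One_nat_def Suc_le_lessD atLeastAtMost_iff of_nat_mono of_nat_mult)
      hence "(real (tau k (a * b)))\<^sup>2 \<le> (real (tau k a) * real (tau k b))\<^sup>2" by (intro power_mono) auto
      hence "(real (tau k (a * b)))\<^sup>2 * (real (a * b) powr -(2 * s)) \<le> (real (tau k a) * real (tau k b))\<^sup>2 * (real (a * b) powr -(2 * s))"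
        by (intro mult_right_mono) auto
      thus "?g (a * b) \<le> ?g a * ?g b" by (simp add: power_mult_distrib powr_mult mult_ac)
    qed
    also have "\<dots> = (\<Sum>a\<in>?S. ?g a) * (\<Sum>b\<in>?R. ?g b)" by (simp add: sum_product sum.cartesian_product)
    also have "\<dots> \<le> (B ^ k)\<^sup>2 * (1 + e) ^ (k * k)"
    proof (intro mult_mono)
      \<comment> \<open>A sum of squares is at most the square of the sum, so that only the first
        power of \<open>tau k\<close> remains. This halves the exponent to \<open>s\<close>, still
        harmless for smooth numbers, and keeps the loss exponential in \<open>k\<close> rather than
        in \<open>k * k\<close>.\<close>
      have "(\<Sum>a\<in>?S. ?g a) = (\<Sum>a\<in>?S. (real (tau k a) * real a powr -s)\<^sup>2)"
        by (intro sum.cong refl) (simp add: power_mult_distrib powr_power)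
      also have "\<dots> \<le> (\<Sum>a\<in>?S. real (tau k a) * real a powr -s)\<^sup>2" by (intro sum_square_le_square_sum) auto
      also have "\<dots> \<le> ((\<Sum>a\<in>?S. real a powr -s) ^ k)\<^sup>2"
        by (intro power_mono sum_tau_powr_le sum_nonneg)
           (auto intro: smooth_dvd dest: dvd_imp_le simp: Suc_le_eq dvd_pos_nat)
      also have "\<dots> \<le> (B ^ k)\<^sup>2" using B(2)[of X] by (intro power_mono) (auto intro!: sum_nonneg zero_le_power)
      finally show "(\<Sum>a\<in>?S. ?g a) \<le> (B ^ k)\<^sup>2" .
      have "(\<Sum>b\<in>?R. ?g b) \<le> (\<Sum>b\<in>?R. real (tau (k * k) b) * real b powr -(2 * s))"
      proof (intro sum_mono mult_right_mono)
        fix b assume "b \<in> ?R"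
        hence "tau k b * tau k b \<le> tau (k * k) b" by (intro tau_times_tau_le) auto
        thus "(real (tau k b))\<^sup>2 \<le> real (tau (k * k) b)" unfolding power2_eq_square
          by (metis of_nat_mono of_nat_mult)
      qed auto
      also have "\<dots> \<le> (\<Sum>b\<in>?R. real b powr -(2 * s)) ^ (k * k)"
        by (intro sum_tau_powr_le) (auto intro: rough_dvd dest: dvd_imp_le simp: Suc_le_eq dvd_pos_nat)
      also have "\<dots> \<le> (1 + e) ^ (k * k)" using P[of X] by (intro power_mono) (auto intro: sum_nonneg)
      finally show "(\<Sum>b\<in>?R. ?g b) \<le> (1 + e) ^ (k * k)" .
    qed (use B in \<open>auto intro: sum_nonneg\<close>)
    also have "(B ^ k)\<^sup>2 * (1 + e) ^ (k * k) = exp (\<epsilon> * real k ^ 2 + 2 * ln B * real k)"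
    proof -
      have "(1 + e) ^ (k * k) = exp (\<epsilon> * real k ^ 2)"
        by (simp add: e_def power2_eq_square mult_ac flip: exp_of_nat_mult)
      moreover have "(B ^ k)\<^sup>2 = exp (2 * ln B * real k)"
      proof -
        have "exp (2 * ln B * real k) = exp (real (2 * k) * ln B)" by (simp add: mult_ac)
        also have "\<dots> = exp (ln B) ^ (2 * k)" by (rule exp_of_nat_mult)
        also have "\<dots> = (B ^ k)\<^sup>2" using B(1) by (simp add: power_mult mult.commute[of 2 k])
        finally show ?thesis by simp
      qed
      ultimately show ?thesis by (simp add: exp_add)
    qed
    finally show ?thesis by (simp add: mult_left_mono)
  qed
  show ?thesis using main B(1) by (intro exI[of _ "2 * ln B"]) auto
qed

section \<open>A large sieve for primitive characters\<close>

text \<open>The coefficients of the \<open>k\<close>-th power of the Dirichlet polynomial with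
  coefficients \<open>b\<close>.\<close>

fun conv_pow :: "(nat \<Rightarrow> real) \<Rightarrow> nat \<Rightarrow> nat \<Rightarrow> real" where
  "conv_pow b 0 n = (if n = 1 then 1 else 0)"
| "conv_pow b (Suc k) n = (\<Sum>d | d dvd n. conv_pow b k d * b (n div d))"

lemma conv_pow_bounds:
  assumes "\<And>a. 0 \<le> b a" "\<And>a. b a \<le> 1"
  shows "0 \<le> conv_pow b k n" "conv_pow b k n \<le> real (tau k n)"
proof -
  have "0 \<le> conv_pow b k n \<and> conv_pow b k n \<le> real (tau k n)"
  proof (induction k arbitrary: n)
    case (Suc k)
    have "conv_pow b k d * b (n div d) \<le> real (tau k d) * 1" for d
      using Suc[of d] assms by (intro mult_mono) auto
    thus ?case using Suc assms by (auto intro!: sum_nonneg sum_mono)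
  qed auto
  thus "0 \<le> conv_pow b k n" "conv_pow b k n \<le> real (tau k n)" by auto
qed

lemma conv_pow_eq_0:
  assumes "\<And>a. a > Y \<Longrightarrow> b a = 0" "n > Y ^ k"
  shows "conv_pow b k n = 0"
  using assms(2)
proof (induction k arbitrary: n)
  case (Suc k)
  have "conv_pow b k d * b (n div d) = 0" if "d dvd n" for d
  proof (cases "d > Y ^ k")
    case True
    thus ?thesis using Suc.IH by simp
  next
    case False
    have "n div d > Y"
    proof (rule ccontr)
      assume "\<not> n div d > Y"
      hence "d * (n div d) \<le> Y ^ k * Y" using False by (intro mult_mono) auto
      thus False using Suc.prems that by (simp add: mult.commute)
    qed
    thus ?thesis using assms(1) by simp
  qed
  thus ?case by (auto intro: sum.neutral)
qed auto

text \<open>Complete multiplicativity of \<psi> turns a power of a sum into a single sum of length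
  \<open>Y ^ k\<close>. The coefficients are independent of \<psi>, as Bessel's inequality
  requires.\<close>

lemma conv_pow_sum:
  fixes \<psi> :: "nat \<Rightarrow> complex"
  assumes \<psi>: "\<And>a b. \<psi> (a * b) = \<psi> a * \<psi> b" "\<psi> 1 = 1"
    and b: "\<And>a. a > Y \<Longrightarrow> b a = 0" and "Y \<ge> 1"
  shows "(\<Sum>a=1..Y. of_real (b a) * \<psi> a) ^ k = (\<Sum>l=1..Y ^ k. of_real (conv_pow b k l) * \<psi> l)"
proof (induction k)
  case 0
  show ?case using \<psi>(2) by simp
next
  case (Suc k)
  define M where "M = Y ^ Suc k"
  define h where "h = (\<lambda>(d, e). (of_real (conv_pow b k d) * \<psi> d) * (of_real (b e) * \<psi> e))"
  let ?S = "SIGMA l:{1..M}. {d. d dvd l}" and ?T = "{(d, e). d \<ge> 1 \<and> e \<ge> 1 \<and> d * e \<le> M}"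
  have "(\<Sum>l=1..M. of_real (conv_pow b (Suc k) l) * \<psi> l)
     = (\<Sum>l=1..M. \<Sum>d | d dvd l. h (d, l div d))"
  proof (intro sum.cong refl)
    fix l assume "l \<in> {1..M}"
    have "of_real (conv_pow b k d * b (l div d)) * \<psi> l = h (d, l div d)" if "d dvd l" for d
    proof -
      have "\<psi> l = \<psi> d * \<psi> (l div d)" using \<psi>(1)[of d "l div d"] that by simp
      thus ?thesis by (simp add: h_def)
    qed
    thus "of_real (conv_pow b (Suc k) l) * \<psi> l = (\<Sum>d | d dvd l. h (d, l div d))"
      by (simp add: sum_distrib_right)
  qed
  also have "\<dots> = (\<Sum>(l, d)\<in>?S. h (d, l div d))" by (subst sum.Sigma) auto
  also have "\<dots> = sum h ?T"
  proof (rule sum.reindex_bij_witness[where i = "\<lambda>(d, e). (d * e, d)" and j = "\<lambda>(l, d). (d, l div d)"])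
    fix z assume "z \<in> ?S"
    then obtain l d where z: "z = (l, d)" "l \<ge> 1" "l \<le> M" "d dvd l" by auto
    thus "(case case z of (l, d) \<Rightarrow> (d, l div d) of (d, e) \<Rightarrow> (d * e, d)) = z" by simp
    have "d > 0" "l div d > 0" using z by (auto elim!: dvdE)
    thus "(case z of (l, d) \<Rightarrow> (d, l div d)) \<in> ?T" using z by simp
    show "h (case z of (l, d) \<Rightarrow> (d, l div d)) = (case z of (l, d) \<Rightarrow> h (d, l div d))" using z by simp
  qed auto
  \<comment> \<open>The hyperbolic region \<open>d * e <= M\<close> contains the box, and outside
    the box one of the two coefficients vanishes.\<close>
  also have "\<dots> = sum h ({1..Y ^ k} \<times> {1..Y})"
  proof (rule sum.mono_neutral_right)
    have "?T \<subseteq> {1..M} \<times> {1..M}"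
    proof
      fix z assume "z \<in> ?T"
      then obtain d e where z: "z = (d, e)" and de: "d \<ge> 1" "e \<ge> 1" "d * e \<le> M" by blast
      have "d \<le> d * e" "e \<le> d * e" using de by simp_all
      hence "d \<le> M" "e \<le> M" using le_trans de(3) by blast+
      thus "z \<in> {1..M} \<times> {1..M}" using de by (simp add: z)
    qed
    thus "finite ?T" by (rule finite_subset) auto
    have "d * e \<le> M" if "d \<le> Y ^ k" "e \<le> Y" for d e
      using mult_mono[OF that] by (simp add: M_def mult.commute)
    thus "{1..Y ^ k} \<times> {1..Y} \<subseteq> ?T" by auto
    show "\<forall>i\<in>?T - {1..Y ^ k} \<times> {1..Y}. h i = 0"
    proof
      fix i assume i: "i \<in> ?T - {1..Y ^ k} \<times> {1..Y}"
      obtain d e where de: "i = (d, e)" by (cases i)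
      hence "d > Y ^ k \<or> e > Y" using i by auto
      hence "conv_pow b k d = 0 \<or> b e = 0" using b[of e] conv_pow_eq_0[where Y = Y and b = b, OF b] by blast
      thus "h i = 0" by (auto simp: h_def de)
    qed
  qed
  also have "\<dots> = (\<Sum>l=1..Y ^ k. of_real (conv_pow b k l) * \<psi> l) * (\<Sum>a=1..Y. of_real (b a) * \<psi> a)"
    unfolding h_def sum_product sum.cartesian_product by (rule refl)
  also have "\<dots> = (\<Sum>a=1..Y. of_real (b a) * \<psi> a) ^ Suc k" using Suc by (simp add: mult.commute)
  finally show ?case by (simp add: M_def)
qed

text \<open>Fourth powers are chosen so that diagonal and off-diagonal balance. At most
  \<open>F * F\<close> characters have inner products at most \<open>F * F\<close> with a given one,
  and \<open>F ^ 4 <= Y ^ k\<close> is also the size of the diagonal; this explains the factor 2.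
  The number \<open>q\<close> will be the cofactor of the conductor in the modulus.\<close>

lemma primitive_large_sieve:
  fixes Y k q :: nat
  assumes "Y \<ge> 1"
  defines "I \<equiv> {(f, \<phi>). primitive_char f \<phi> \<and> f ^ 4 \<le> Y ^ k}"
  shows "finite I"
    and "(\<Sum>(f, \<phi>)\<in>I. norm (\<Sum>a | a \<in> {1..Y} \<and> coprime a q. \<phi> a) ^ (2 * k))
           \<le> 2 * real Y ^ k * (\<Sum>l=1..Y ^ k. (real (tau k l))\<^sup>2)"
proof -
  let ?F = "{f::nat. f ^ 4 \<le> Y ^ k}"
  have "f \<le> Y ^ k" if "f ^ 4 \<le> Y ^ k" for f :: nat
    using that by (cases "f = 0") (auto intro: order_trans[OF self_le_power[of f 4]])
  hence finF: "finite ?F" by (intro finite_subset[of ?F "{..Y ^ k}"]) auto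
  define F where "F = Max ?F"
  have FI: "F ^ 4 \<le> Y ^ k" 
  proof -
    have "0 \<in> ?F" by simp
    hence "F \<in> ?F" unfolding F_def by (intro Max_in[OF finF]) blast
    thus ?thesis by simp
  qed
  have leF: "f \<le> F" if "f ^ 4 \<le> Y ^ k" for f using that finF by (simp add: F_def)
  have sub: "I \<subseteq> (SIGMA f:{1..F}. {\<phi>. dchar f \<phi>})"
    using leF by (auto simp: I_def primitive_char_def)
  have fin: "finite (SIGMA f:{1..F}. {\<phi>. dchar f \<phi>})" using finite_dchars by (intro finite_SigmaI) auto
  show finI: "finite I" using finite_subset[OF sub fin] .
  have cardI: "card I \<le> F * F"
  proof -
    have "card I \<le> card (SIGMA f:{1..F}. {\<phi>. dchar f \<phi>})" using card_mono[OF fin sub] .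
    also have "\<dots> = (\<Sum>f=1..F. card {\<phi>. dchar f \<phi>})" using finite_dchars by (intro card_SigmaI) auto
    also have "\<dots> \<le> (\<Sum>f=1..F. F)" by (intro sum_mono order_trans[OF card_dchars_le]) auto
    finally show ?thesis by simp
  qed
  \<comment> \<open>Coprimality to \<open>q\<close> is absorbed into the coefficients, so the
    characters themselves stay primitive and the bound is uniform in \<open>q\<close>.\<close>
  define b where "b a = (if a \<in> {1..Y} \<and> coprime a q then 1 else 0 :: real)" for a
  have b: "0 \<le> b a" "b a \<le> 1" "a > Y \<Longrightarrow> b a = 0" for a by (auto simp: b_def)
  have pw: "norm (\<Sum>a | a \<in> {1..Y} \<and> coprime a q. \<phi> a) ^ (2 * k) = (norm (\<Sum>l=1..Y ^ k. of_real (conv_pow b k l) * \<phi> l))\<^sup>2"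
    if "(f, \<phi>) \<in> I" for f \<phi>
  proof -
    have d: "dchar f \<phi>" using that by (auto simp: I_def primitive_char_def)
    have "(\<Sum>a | a \<in> {1..Y} \<and> coprime a q. \<phi> a) = (\<Sum>a=1..Y. of_real (b a) * \<phi> a)"
      by (intro sum.mono_neutral_cong_left) (auto simp: b_def)
    hence "(\<Sum>a | a \<in> {1..Y} \<and> coprime a q. \<phi> a) ^ k = (\<Sum>l=1..Y ^ k. of_real (conv_pow b k l) * \<phi> l)"
      using conv_pow_sum[OF dchar_mult[OF d] _ b(3) assms(1)] dchar_1[OF d] by simp
    hence "norm (\<Sum>a | a \<in> {1..Y} \<and> coprime a q. \<phi> a) ^ k = norm (\<Sum>l=1..Y ^ k. of_real (conv_pow b k l) * \<phi> l)"
      by (simp flip: norm_power)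
    thus ?thesis by (simp add: power_mult mult.commute[of 2 k])
  qed
  have bound: "(\<Sum>s\<in>I. norm (\<Sum>m=1..Y ^ k. snd r m * cnj (snd s m))) \<le> 2 * real Y ^ k" if r: "r \<in> I" for r
  proof -
    obtain f \<phi> where rf: "r = (f, \<phi>)" by (cases r)
    have prim: "primitive_char f \<phi>" "f \<le> F" using r leF by (auto simp: I_def rf)
    hence d: "dchar f \<phi>" "f > 0" by (auto simp: primitive_char_def)
    have "norm (\<Sum>m=1..Y ^ k. snd r m * cnj (snd r m)) \<le> (\<Sum>m=1..Y ^ k. 1)"
    proof (intro sum_norm_le)
      fix m show "norm (snd r m * cnj (snd r m)) \<le> 1"
        using norm_dchar_le[OF d, of m] by (simp add: rf norm_mult mult_le_one)
    qed
    hence diag: "norm (\<Sum>m=1..Y ^ k. snd r m * cnj (snd r m)) \<le> real Y ^ k" by simp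
    have off: "norm (\<Sum>m=1..Y ^ k. snd r m * cnj (snd s m)) \<le> real F * real F" if s: "s \<in> I - {r}" for s
    proof -
      obtain g \<theta> where sg: "s = (g, \<theta>)" by (cases s)
      have p2: "primitive_char g \<theta>" "g \<le> F" using s leF by (auto simp: I_def sg)
      have ne: "(f, \<phi>) \<noteq> (g, \<theta>)" using s rf sg by auto
      have "norm (\<Sum>m=1..Y ^ k. \<phi> m * cnj (\<theta> m)) \<le> real (f * g)"
        using norm_dchar_sum_le[OF primitive_char_times_cnj[OF prim(1) p2(1) ne]] prim(1) p2(1)
        by (auto simp: primitive_char_def)
      also have "\<dots> \<le> real F * real F" using prim(2) p2(2) by (simp add: mult_mono)
      finally show ?thesis by (simp add: rf sg)
    qed
    have "(\<Sum>s\<in>I. norm (\<Sum>m=1..Y ^ k. snd r m * cnj (snd s m)))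
       = norm (\<Sum>m=1..Y ^ k. snd r m * cnj (snd r m)) + (\<Sum>s\<in>I - {r}. norm (\<Sum>m=1..Y ^ k. snd r m * cnj (snd s m)))"
      using finI r by (simp add: sum.remove)
    also have "\<dots> \<le> real Y ^ k + (\<Sum>s\<in>I - {r}. real F * real F)"
      by (intro add_mono diag sum_mono off)
    also have "(\<Sum>s\<in>I - {r}. real F * real F) \<le> real (card I) * (real F * real F)"
      using card_mono[OF finI, of "I - {r}"] by (simp add: mult_right_mono)
    also have "\<dots> \<le> real (F * F) * (real F * real F)"
      using cardI by (intro mult_right_mono of_nat_mono) auto
    also have "\<dots> = real (F ^ 4)" by (simp add: power4_eq_xxxx)
    also have "\<dots> \<le> real Y ^ k" using of_nat_mono[OF FI, where 'a = real] by simp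
    finally show ?thesis by simp
  qed
  have "(\<Sum>(f, \<phi>)\<in>I. norm (\<Sum>a | a \<in> {1..Y} \<and> coprime a q. \<phi> a) ^ (2 * k))
     = (\<Sum>r\<in>I. (norm (\<Sum>l=1..Y ^ k. of_real (conv_pow b k l) * snd r l))\<^sup>2)"
  proof (intro sum.cong refl)
    fix r assume "r \<in> I"
    thus "(case r of (f, \<phi>) \<Rightarrow> norm (\<Sum>a | a \<in> {1..Y} \<and> coprime a q. \<phi> a) ^ (2 * k))
       = (norm (\<Sum>l=1..Y ^ k. of_real (conv_pow b k l) * snd r l))\<^sup>2"
      using pw[of "fst r" "snd r"] by (simp only: case_prod_unfold prod.collapse)
  qed
  also have "\<dots> \<le> 2 * real Y ^ k * (\<Sum>l=1..Y ^ k. (norm (complex_of_real (conv_pow b k l)))\<^sup>2)"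
    using bound by (intro generalized_bessel) auto
  also have "\<dots> \<le> 2 * real Y ^ k * (\<Sum>l=1..Y ^ k. (real (tau k l))\<^sup>2)"
    using conv_pow_bounds[OF b(1,2)] by (intro mult_left_mono sum_mono power_mono) auto
  finally show "(\<Sum>(f, \<phi>)\<in>I. norm (\<Sum>a | a \<in> {1..Y} \<and> coprime a q. \<phi> a) ^ (2 * k))
           \<le> 2 * real Y ^ k * (\<Sum>l=1..Y ^ k. (real (tau k l))\<^sup>2)" .
qed

section \<open>Counting integers coprime to the modulus\<close>

text \<open>Coprimality relative to an arbitrary set of primes, so that induction can add one prime
  at a time.\<close>

definition free_of :: "nat set \<Rightarrow> nat \<Rightarrow> bool" where
  "free_of Ps a \<longleftrightarrow> (\<forall>p\<in>Ps. \<not> p dvd a)"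

lemma coprime_iff_free_of:
  assumes "n > (0::nat)"
  shows "coprime a n \<longleftrightarrow> free_of (prime_factors n) a"
proof
  assume "coprime a n"
  thus "free_of (prime_factors n) a" unfolding free_of_def
    by (metis coprime_common_divisor in_prime_factors_iff not_prime_unit)
next
  assume *: "free_of (prime_factors n) a"
  show "coprime a n"
  proof (rule ccontr)
    assume "\<not> coprime a n"
    then obtain p where p: "prime p" "p dvd a" "p dvd n"
      using coprime_iff_gcd_eq_1 prime_factor_nat[of "gcd a n"] by (metis gcd_greatest_iff)
    thus False using * assms by (auto simp: free_of_def in_prime_factors_iff)
  qed
qed

text \<open>One step of Legendre's sieve: the terms divisible by \<open>p\<close> are
  \<open>p * b\<close>, and multiplication by \<open>p\<close> does not affect divisibility by the
  other primes.\<close>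

lemma sum_free_of_insert:
  fixes h :: "nat \<Rightarrow> 'a :: ab_group_add"
  assumes p: "prime p" "p \<notin> Ps" "\<And>q. q \<in> Ps \<Longrightarrow> prime q"
  shows "(\<Sum>a | a \<in> {1..Z} \<and> free_of (insert p Ps) a. h a) =
         (\<Sum>a | a \<in> {1..Z} \<and> free_of Ps a. h a) - (\<Sum>b | b \<in> {1..Z div p} \<and> free_of Ps b. h (p * b))"
proof -
  have p0: "p > 0" using p(1) prime_gt_0_nat by blast
  let ?A = "{a. a \<in> {1..Z} \<and> free_of Ps a}" and ?B = "{b. b \<in> {1..Z div p} \<and> free_of Ps b}"
  have fr: "free_of Ps (p * b) \<longleftrightarrow> free_of Ps b" for b
    unfolding free_of_def using p primes_dvd_imp_eq[OF _ p(1)] by (metis dvd_mult prime_dvd_mult_iff)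
  have "?A \<inter> {a. p dvd a} = (\<lambda>b. p * b) ` ?B"
  proof (intro equalityI subsetI)
    fix a assume a: "a \<in> ?A \<inter> {a. p dvd a}"
    then obtain b where b: "a = p * b" by auto
    hence "b \<in> ?B" using a fr p0 by (auto simp: less_eq_div_iff_mult_less_eq mult.commute Suc_le_eq)
    thus "a \<in> (\<lambda>b. p * b) ` ?B" using b by blast
  next
    fix a assume "a \<in> (\<lambda>b. p * b) ` ?B"
    thus "a \<in> ?A \<inter> {a. p dvd a}" using fr p0
      by (auto simp: less_eq_div_iff_mult_less_eq mult.commute Suc_le_eq)
  qed
  hence "sum h (?A \<inter> {a. p dvd a}) = (\<Sum>b\<in>?B. h (p * b))"
    using p0 by (simp add: sum.reindex inj_on_def)
  moreover have "sum h ?A = sum h (?A \<inter> {a. p dvd a}) + sum h (?A - {a. p dvd a})"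
    by (intro sum.Int_Diff) auto
  moreover have "?A - {a. p dvd a} = {a. a \<in> {1..Z} \<and> free_of (insert p Ps) a}"
    by (auto simp: free_of_def)
  ultimately show ?thesis by simp
qed

text \<open>Each sieving prime splits the sum into two sums of the same kind, since the bounded
  factor \<open>g p\<close> can be pulled out; the bound doubles each time.\<close>

lemma free_of_twisted_sum_bound:
  fixes g :: "nat \<Rightarrow> complex"
  assumes "finite Ps" "\<And>q. q \<in> Ps \<Longrightarrow> prime q" "\<And>a b. g (a * b) = g a * g b" "\<And>a. norm (g a) \<le> 1"
    and "\<And>Z. norm (\<Sum>a=1..Z. g a) \<le> B"
  shows "norm (\<Sum>a | a \<in> {1..Z} \<and> free_of Ps a. g a) \<le> 2 ^ card Ps * B"
  using assms(1,2)
proof (induction Ps arbitrary: Z rule: finite_induct)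
  case empty
  have "{a. a \<in> {1..Z} \<and> free_of {} a} = {1..Z}" by (auto simp: free_of_def)
  thus ?case using assms(5)[of Z] by simp
next
  case (insert p Ps)
  have B0: "B \<ge> 0" using assms(5)[of 0] by simp
  have "norm (\<Sum>b | b \<in> {1..Z div p} \<and> free_of Ps b. g (p * b))
       = norm (g p) * norm (\<Sum>b | b \<in> {1..Z div p} \<and> free_of Ps b. g b)"
    by (simp add: assms(3) flip: sum_distrib_left norm_mult)
  also have "\<dots> \<le> 1 * (2 ^ card Ps * B)" using insert B0 assms(4) by (intro mult_mono) auto
  finally have 1: "norm (\<Sum>b | b \<in> {1..Z div p} \<and> free_of Ps b. g (p * b)) \<le> 2 ^ card Ps * B" by simp
  have 2: "norm (\<Sum>a | a \<in> {1..Z} \<and> free_of Ps a. g a) \<le> 2 ^ card Ps * B" using insert by auto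
  have "norm (\<Sum>a | a \<in> {1..Z} \<and> free_of (insert p Ps) a. g a) \<le> 2 ^ card Ps * B + 2 ^ card Ps * B"
  proof -
    have "(\<Sum>a | a \<in> {1..Z} \<and> free_of (insert p Ps) a. g a) =
         (\<Sum>a | a \<in> {1..Z} \<and> free_of Ps a. g a) - (\<Sum>b | b \<in> {1..Z div p} \<and> free_of Ps b. g (p * b))"
      by (rule sum_free_of_insert) (use insert in auto)
    thus ?thesis using order_trans[OF norm_triangle_ineq4 add_mono[OF 2 1]] by (simp only:)
  qed
  moreover have "2 ^ card (insert p Ps) * B = 2 ^ card Ps * B + 2 ^ card Ps * B" using insert by simp
  ultimately show ?case by (simp only:)
qed

lemma free_of_count:
  assumes "finite Ps" "\<And>q. q \<in> Ps \<Longrightarrow> prime q" "y \<ge> 0"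
  shows "\<bar>real (card {a. a \<in> {1..nat \<lfloor>y\<rfloor>} \<and> free_of Ps a}) - y * (\<Prod>p\<in>Ps. 1 - 1 / real p)\<bar> \<le> 2 ^ card Ps"
  using assms
proof (induction Ps arbitrary: y rule: finite_induct)
  case empty
  have "{a. a \<in> {1..nat \<lfloor>y\<rfloor>} \<and> free_of {} a} = {1..nat \<lfloor>y\<rfloor>}" by (auto simp: free_of_def)
  hence "card {a. a \<in> {1..nat \<lfloor>y\<rfloor>} \<and> free_of {} a} = nat \<lfloor>y\<rfloor>" by simp
  thus ?case using empty by simp linarith
next
  case (insert p Ps)
  have p: "prime p" "p > 0" using insert prime_gt_0_nat by blast+
  \<comment> \<open>Nested floors agree, so the recursion can run over real \<open>y\<close> and the
    main terms combine exactly.\<close>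
  have fl: "nat \<lfloor>y\<rfloor> div p = nat \<lfloor>y / real p\<rfloor>"
    using floor_divide_real_eq_div[of "int p" y] insert(5) by (simp add: nat_div_distrib)
  let ?c = "\<lambda>Ps y. real (card {a. a \<in> {1..nat \<lfloor>y\<rfloor>} \<and> free_of Ps a})"
  have "?c (insert p Ps) y = ?c Ps y - ?c Ps (y / real p)"
    using sum_free_of_insert[of p Ps "\<lambda>_. 1 :: real" "nat \<lfloor>y\<rfloor>"] insert p by (simp add: fl)
  moreover have "\<bar>?c Ps y - y * (\<Prod>p\<in>Ps. 1 - 1 / real p)\<bar> \<le> 2 ^ card Ps" using insert by auto
  moreover have "\<bar>?c Ps (y / real p) - y / real p * (\<Prod>p\<in>Ps. 1 - 1 / real p)\<bar> \<le> 2 ^ card Ps"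
    using insert(3)[OF insert(4)[OF insertI2], of "y / real p"] insert(5) by simp
  moreover have "y * (\<Prod>p\<in>insert p Ps. 1 - 1 / real p) = y * (\<Prod>p\<in>Ps. 1 - 1 / real p) - y / real p * (\<Prod>p\<in>Ps. 1 - 1 / real p)"
    using insert by (simp add: algebra_simps)
  moreover have "(2::real) ^ card (insert p Ps) = 2 ^ card Ps + 2 ^ card Ps" using insert by simp
  moreover have "\<bar>c - (z - w)\<bar> \<le> t + t" if "c = c1 - c2" "\<bar>c1 - z\<bar> \<le> t" "\<bar>c2 - w\<bar> \<le> t" for c c1 c2 z w t :: real
    using that by linarith
  ultimately show ?case by (simp only:)
qed

lemma coprime_count:
  assumes "n > 0" "y \<ge> 0"
  shows "\<bar>real (card {a. a \<in> {1..nat \<lfloor>y\<rfloor>} \<and> coprime a n}) - y * (real (totient n) / real n)\<bar> \<le> 2 ^ card (prime_factors n)"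
  using free_of_count[of "prime_factors n" y] assms
  by (simp add: coprime_iff_free_of totient_formula2 in_prime_factors_iff)

text \<open>Sieving out the primes of \<open>n\<close> lets the period bound act with the conductor
  \<open>f\<close> in place of the modulus.\<close>

lemma induced_char_sum_bound:
  assumes \<phi>: "dchar f \<phi>" "\<phi> \<noteq> princ_char f" "f > 0" and n: "n > 0"
  shows "norm (\<Sum>a | a \<in> {1..Z} \<and> coprime a n. \<phi> a) \<le> 2 ^ card (prime_factors n) * real f"
  unfolding coprime_iff_free_of[OF n]
  using norm_dchar_sum_le[OF \<phi>] dchar_mult[OF \<phi>(1)] norm_dchar_le[OF \<phi>(1,3)]
  by (intro free_of_twisted_sum_bound) (auto simp: in_prime_factors_iff)

section \<open>The average of two to the number of prime factors\<close>

lemma prime_dvd_prod_primes_iff: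
  fixes p :: nat
  assumes "finite B" "\<And>q. q \<in> B \<Longrightarrow> prime q" "prime p"
  shows "p dvd \<Prod>B \<longleftrightarrow> p \<in> B"
  using prime_dvd_prod_iff[of B p "\<lambda>x. x"] assms primes_dvd_imp_eq[OF assms(3)] by auto

lemma prod_primes_dvd:
  fixes m :: nat
  assumes "finite B" "\<And>q. q \<in> B \<Longrightarrow> prime q" "\<And>q. q \<in> B \<Longrightarrow> q dvd m"
  shows "\<Prod>B dvd m"
  using assms
proof (induction B rule: finite_induct)
  case (insert q B)
  have "coprime q (\<Prod>B)"
    using insert prime_imp_coprime[of q "\<Prod>B"] prime_dvd_prod_primes_iff[of B q] by auto
  thus ?case using insert by (simp add: divides_mult)
qed simp

text \<open>Distinct sets of prime factors have distinct products, the squarefree divisors of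
  \<open>n\<close>.\<close>

lemma two_power_omega_le_divisors:
  fixes n :: nat
  assumes "n > 0"
  shows "2 ^ card (prime_factors n) \<le> card {d. d dvd n}"
proof -
  have pr: "finite B" "\<And>q. q \<in> B \<Longrightarrow> prime q" "\<And>q. q \<in> B \<Longrightarrow> q dvd n" if "B \<subseteq> prime_factors n" for B :: "nat set"
    using that finite_subset[OF that] by (auto simp: in_prime_factors_iff)
  have "inj_on (\<lambda>B. \<Prod>B) (Pow (prime_factors n))"
  proof (rule inj_onI)
    fix B C assume *: "B \<in> Pow (prime_factors n)" "C \<in> Pow (prime_factors n)" "\<Prod>B = \<Prod>C"
    have "p \<in> B \<longleftrightarrow> p \<in> C" if "prime p" for p
      using prime_dvd_prod_primes_iff[of B p] prime_dvd_prod_primes_iff[of C p] pr[of B] pr[of C] * that by auto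
    moreover have "prime p" if "p \<in> B \<or> p \<in> C" for p using that * pr[of B] pr[of C] by auto
    ultimately show "B = C" by blast
  qed
  moreover have "(\<lambda>B. \<Prod>B) ` Pow (prime_factors n) \<subseteq> {d. d dvd n}"
    using prod_primes_dvd[OF pr] by auto
  ultimately have "card (Pow (prime_factors n)) \<le> card {d. d dvd n}" using assms by (intro card_inj_on_le) auto
  thus ?thesis by (simp add: card_Pow)
qed

lemma sum_inverse_le: "X > 0 \<Longrightarrow> (\<Sum>d=1..X. 1 / real d) \<le> 1 + ln (real X)"
proof (induction X rule: nat_induct_non_zero)
  case (Suc n)
  have "ln (real n / real (Suc n)) \<le> real n / real (Suc n) - 1" using Suc by (intro ln_le_minus_one) auto
  also have "\<dots> = - 1 / real (Suc n)" by (simp add: field_simps)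
  finally have "1 / real (Suc n) \<le> ln (real (Suc n)) - ln (real n)" using Suc by (simp add: ln_div)
  thus ?case using Suc by simp
qed simp

lemma sum_two_power_omega_le:
  assumes "X > 0"
  shows "(\<Sum>n=1..X. 2 ^ card (prime_factors n)) \<le> real X * (1 + ln (real X))"
proof -
  have "(\<Sum>n=1..X. 2 ^ card (prime_factors n)) \<le> (\<Sum>n=1..X. real (card {d. d dvd n}))"
  proof (intro sum_mono)
    fix n assume "n \<in> {1..X}"
    thus "2 ^ card (prime_factors n) \<le> real (card {d. d dvd n})"
      using of_nat_mono[OF two_power_omega_le_divisors[of n], where 'a = real] by simp
  qed
  also have "\<dots> = (\<Sum>n=1..X. \<Sum>d | d \<in> {1..X} \<and> d dvd n. 1)"
  proof (intro sum.cong refl)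
    fix n assume n: "n \<in> {1..X}"
    have "d \<in> {1..X}" if "d dvd n" for d
    proof -
      have "d \<le> n" using that n by (intro dvd_imp_le) auto
      moreover have "d > 0" using that n by (auto intro!: gr0I)
      ultimately show ?thesis using n by simp
    qed
    hence "{d. d dvd n} = {d. d \<in> {1..X} \<and> d dvd n}" by blast
    thus "real (card {d. d dvd n}) = (\<Sum>d | d \<in> {1..X} \<and> d dvd n. 1)" by simp
  qed
  also have "\<dots> = (\<Sum>d=1..X. \<Sum>n | n \<in> {1..X} \<and> d dvd n. 1)"
    by (rule sum.swap_restrict) auto
  also have "\<dots> \<le> (\<Sum>d=1..X. real X * (1 / real d))"
  proof (intro sum_mono)
    fix d assume d: "d \<in> {1..X}"
    have "{n. n \<in> {1..X} \<and> d dvd n} \<subseteq> (\<lambda>j. d * j) ` {1..X div d}"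
    proof
      fix n assume n: "n \<in> {n. n \<in> {1..X} \<and> d dvd n}"
      then obtain j where "n = d * j" by auto
      moreover have "j \<in> {1..X div d}" using n d calculation
        by (auto simp: less_eq_div_iff_mult_less_eq mult.commute Suc_le_eq)
      ultimately show "n \<in> (\<lambda>j. d * j) ` {1..X div d}" by blast
    qed
    hence "card {n. n \<in> {1..X} \<and> d dvd n} \<le> card {1..X div d}" by (rule surj_card_le[rotated]) simp
    hence "card {n. n \<in> {1..X} \<and> d dvd n} \<le> X div d" by simp
    hence "real (card {n. n \<in> {1..X} \<and> d dvd n}) \<le> real (X div d)" by simp
    also have "\<dots> \<le> real X / real d" by (rule of_nat_div_le_of_nat)
    finally show "(\<Sum>n | n \<in> {1..X} \<and> d dvd n. 1) \<le> real X * (1 / real d)" by simp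
  qed
  also have "\<dots> = real X * (\<Sum>d=1..X. 1 / real d)" by (simp add: sum_distrib_left)
  also have "\<dots> \<le> real X * (1 + ln (real X))" using sum_inverse_le[OF assms] by (intro mult_left_mono) auto
  finally show ?thesis .
qed

section \<open>Inclusion-exclusion for primitive roots\<close>

text \<open>Minimality holds because some unit has order exactly \<open>Carmichael n\<close>, so any
  universal exponent is a multiple of it.\<close>

lemma carmichael_eq_Carmichael:
  assumes "n > 0"
  shows "carmichael n = Carmichael n"
  unfolding carmichael_def
proof (rule Least_equality)
  show "Carmichael n > 0 \<and> (\<forall>a. coprime a n \<longrightarrow> [a ^ Carmichael n = 1] (mod n))"
    using Carmichael_divides[of n "Carmichael n"] by (auto simp: coprime_commute)
  fix k assume k: "k > 0 \<and> (\<forall>a. coprime a n \<longrightarrow> [a ^ k = 1] (mod n))"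
  obtain g where g: "g \<in> totatives n" "ord n g = Carmichael n" using Carmichael_root_exists[OF assms] .
  hence "[g ^ k = 1] (mod n)" using k by (auto simp: in_totatives_iff)
  hence "Carmichael n dvd k" using g(2) ord_divides by metis
  thus "Carmichael n \<le> k" using k by (auto intro: dvd_imp_le)
qed

lemma carmichael_pos: "n > 0 \<Longrightarrow> carmichael n > 0"
  by (simp add: carmichael_eq_Carmichael)

lemma carmichael_le: "n > 0 \<Longrightarrow> carmichael n \<le> n"
  using dvd_imp_le[OF Carmichael_dvd_totient[of n]] totient_le[of n] by (simp add: carmichael_eq_Carmichael)

lemma ord_dvd_carmichael: "n > 0 \<Longrightarrow> coprime a n \<Longrightarrow> ord n a dvd carmichael n"
  using Carmichael_divides[of n "Carmichael n" a] ord_divides[of a "Carmichael n" n]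
  by (auto simp: carmichael_eq_Carmichael coprime_commute)

definition lam_primes :: "nat \<Rightarrow> nat set" where
  "lam_primes n = prime_factors (carmichael n)"

definition exp_subgroup :: "nat \<Rightarrow> nat set \<Rightarrow> nat set" where
  "exp_subgroup n B = {a. coprime a n \<and> (\<forall>q\<in>B. [a ^ (carmichael n div q) = 1] (mod n))}"

lemma unit_subgroup_exp_subgroup: "unit_subgroup n (exp_subgroup n B)"
  unfolding unit_subgroup_def
proof (intro conjI ballI allI impI)
  fix a b assume "a \<in> exp_subgroup n B" "b \<in> exp_subgroup n B"
  thus "a * b \<in> exp_subgroup n B"
    using cong_mult[of _ 1 n _ 1] by (auto simp: exp_subgroup_def power_mult_distrib)
next
  fix a b assume ab: "a \<in> exp_subgroup n B" "[a = b] (mod n)"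
  have "coprime b n" using ab cong_imp_coprime[OF ab(2)] by (simp add: exp_subgroup_def)
  moreover have "[b ^ (carmichael n div q) = 1] (mod n)" if "q \<in> B" for q
    using that ab cong_trans[OF cong_sym[OF cong_pow[OF ab(2)]]] by (auto simp: exp_subgroup_def)
  ultimately show "b \<in> exp_subgroup n B" by (simp add: exp_subgroup_def)
qed (auto simp: exp_subgroup_def)

text \<open>For \<open>g\<close> of order \<lambda>(n), the translates of the subgroup by
  \<open>g ^ i\<close> with \<open>i < \<Prod>B\<close> are disjoint. Raising a coincidence to the
  power \<lambda>(n)/q kills the subgroup elements and shows that \<open>i\<close> is determined
  modulo every \<open>q\<close> in \<open>B\<close>, hence modulo \<open>\<Prod>B\<close>.\<close>

lemma card_exp_subgroup:
  assumes "n > 0" "B \<subseteq> lam_primes n"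
  shows "card (exp_subgroup n B \<inter> {..<n}) * \<Prod>B \<le> n"
proof -
  let ?E = "exp_subgroup n B" and ?l = "carmichael n"
  have B: "finite B" "\<And>q. q \<in> B \<Longrightarrow> prime q" "\<And>q. q \<in> B \<Longrightarrow> q dvd ?l"
    using assms(2) finite_subset[OF assms(2)] by (auto simp: lam_primes_def in_prime_factors_iff)
  obtain g where g: "coprime g n" "ord n g = ?l"
    using Carmichael_root_exists[OF assms(1)] carmichael_eq_Carmichael[OF assms(1)] by (metis in_totatives_iff)
  have "inj_on (\<lambda>(e, i). e * g ^ i mod n) ((?E \<inter> {..<n}) \<times> {..<\<Prod>B})"
  proof (rule inj_onI)
    fix s t assume s: "s \<in> (?E \<inter> {..<n}) \<times> {..<\<Prod>B}" and t: "t \<in> (?E \<inter> {..<n}) \<times> {..<\<Prod>B}"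
      and eq: "(case s of (e, i) \<Rightarrow> e * g ^ i mod n) = (case t of (e, i) \<Rightarrow> e * g ^ i mod n)"
    obtain e i where si: "s = (e, i)" by (cases s)
    obtain e' i' where ti: "t = (e', i')" by (cases t)
    have c: "[e * g ^ i = e' * g ^ i'] (mod n)"
      using eq by (simp add: si ti unique_euclidean_semiring_class.cong_def)
    have q: "[i = i'] (mod q)" if "q \<in> B" for q
    proof -
      define d where "d = ?l div q"
      have l: "?l = q * d" using B(3)[OF that] by (simp add: d_def)
      have d0: "d > 0" using l carmichael_pos[OF assms(1)] by (auto intro: gr0I)
      have e1: "[e ^ d = 1] (mod n)" "[e' ^ d = 1] (mod n)"
        using s t that by (auto simp: si ti exp_subgroup_def d_def)
      have "[(e * g ^ i) ^ d = (e' * g ^ i') ^ d] (mod n)" using c by (rule cong_pow)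
      hence c2: "[e ^ d * g ^ (i * d) = e' ^ d * g ^ (i' * d)] (mod n)" by (simp add: power_mult_distrib power_mult)
      have "[1 * g ^ (i * d) = e ^ d * g ^ (i * d)] (mod n)" using cong_scalar_right[OF cong_sym[OF e1(1)]] .
      also note c2
      also have "[e' ^ d * g ^ (i' * d) = 1 * g ^ (i' * d)] (mod n)" using cong_scalar_right[OF e1(2)] .
      finally have "[g ^ (i * d) = g ^ (i' * d)] (mod n)" by simp
      hence "[i * d = i' * d] (mod ?l)"
        using order_divides_expdiff[of n g "i * d" "i' * d"] g by (simp add: coprime_commute)
      hence "(i mod q) * d = (i' mod q) * d"
        by (simp add: unique_euclidean_semiring_class.cong_def l mod_mult_mult2)
      thus ?thesis using d0 by (simp add: unique_euclidean_semiring_class.cong_def)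
    qed
    have "[i = i'] (mod \<Prod>B)"
      using q B(2) by (intro coprime_cong_prod_nat[where m = "\<lambda>x. x"]) (auto intro: primes_coprime)
    hence "i = i'" using s t by (simp add: si ti unique_euclidean_semiring_class.cong_def)
    hence "[e = e'] (mod n)" using c g(1) by (simp add: cong_mult_rcancel_nat)
    hence "e = e'" using s t by (simp add: si ti unique_euclidean_semiring_class.cong_def)
    thus "s = t" using \<open>i = i'\<close> by (simp add: si ti)
  qed
  hence "card ((?E \<inter> {..<n}) \<times> {..<\<Prod>B}) \<le> card {..<n}"
    by (rule card_inj_on_le) (use assms(1) in auto)
  thus ?thesis by (simp add: card_cartesian_product)
qed

text \<open>If the order of \<open>a\<close> is a proper divisor of \<lambda>(n), any prime
  \<open>q\<close> of the complementary factor can be removed from the exponent \<lambda>(n) and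
  still leaves a multiple of the order.\<close>

lemma lambda_prim_root_iff:
  assumes "n > 0" "coprime a n"
  shows "lambda_prim_root a n \<longleftrightarrow> {q \<in> lam_primes n. [a ^ (carmichael n div q) = 1] (mod n)} = {}"
proof
  let ?l = "carmichael n"
  assume "lambda_prim_root a n"
  hence o: "ord n a = ?l" by (simp add: lambda_prim_root_def)
  have "\<not> [a ^ (?l div q) = 1] (mod n)" if "q \<in> lam_primes n" for q
  proof
    assume "[a ^ (?l div q) = 1] (mod n)"
    hence dv: "?l dvd ?l div q" using o ord_divides by metis
    have q: "prime q" "q dvd ?l" using that by (auto simp: lam_primes_def in_prime_factors_iff)
    have "?l div q < ?l" using carmichael_pos[OF assms(1)] prime_gt_1_nat[OF q(1)] by simp
    moreover have "?l div q > 0" using q carmichael_pos[OF assms(1)] by (auto elim!: dvdE)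
    ultimately show False using dv nat_dvd_not_less by blast
  qed
  thus "{q \<in> lam_primes n. [a ^ (?l div q) = 1] (mod n)} = {}" by blast
next
  let ?l = "carmichael n"
  assume *: "{q \<in> lam_primes n. [a ^ (?l div q) = 1] (mod n)} = {}"
  obtain t where t: "?l = ord n a * t" using ord_dvd_carmichael[OF assms] by auto
  have "t = 1"
  proof (rule ccontr)
    assume "t \<noteq> 1"
    then obtain q where q: "prime q" "q dvd t" using prime_factor_nat by blast
    then obtain u where u: "t = q * u" by auto
    have "?l div q = ord n a * u" using t u prime_gt_0_nat[OF q(1)] by simp
    hence "[a ^ (?l div q) = 1] (mod n)" using ord_divides[of a "?l div q" n] by simp
    moreover have "q \<in> lam_primes n" using q t carmichael_pos[OF assms(1)]
      by (auto simp: lam_primes_def in_prime_factors_iff)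
    ultimately show False using * by blast
  qed
  thus "lambda_prim_root a n" using t assms by (simp add: lambda_prim_root_def)
qed

text \<open>For positive \<open>m\<close> the alternating sum has absolute value
  \<open>(m - 1) choose (j - 1)\<close>, which Pascal's rule bounds by \<open>m choose j\<close>;
  for \<open>m = 0\<close> it equals 1.\<close>

lemma alternating_choose_bound:
  assumes "j > 0"
  shows "\<bar>(if m = 0 then 1 else 0) - (\<Sum>i<j. (-1) ^ i * real (m choose i))\<bar> \<le> real (m choose j)"
proof -
  obtain j' where j: "j = Suc j'" using assms by (cases j) auto
  have "(\<Sum>i<j. (-1) ^ i * real (m choose i)) = (\<Sum>i\<le>j'. (real m gchoose i) * (-1) ^ i)"
    by (simp add: j lessThan_Suc_atMost binomial_gbinomial mult.commute)
  also have "\<dots> = (-1) ^ j' * (real m - 1 gchoose j')" by (rule gbinomial_sum_lower_neg)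
  finally have eq: "(\<Sum>i<j. (-1) ^ i * real (m choose i)) = (-1) ^ j' * (real m - 1 gchoose j')" .
  show ?thesis
  proof (cases m)
    case 0
    have "(real m - 1 gchoose j') = (-1) ^ j'"
      using gbinomial_minus[of "1::real" j'] 0 by (simp add: binomial_gbinomial[symmetric] flip: of_nat_diff)
    hence "(\<Sum>i<j. (-1) ^ i * real (m choose i)) = 1" unfolding eq by (simp flip: power_add add: mult_2[symmetric] power_mult)
    thus ?thesis using 0 by simp
  next
    case (Suc m')
    hence "(real m - 1 gchoose j') = real (m' choose j')" by (simp add: binomial_gbinomial)
    thus ?thesis unfolding eq using Suc j by (simp add: abs_mult)
  qed
qed

lemma sum_subsets_card_less:
  fixes f :: "nat \<Rightarrow> real"
  assumes "finite M"
  shows "(\<Sum>B | B \<subseteq> M \<and> card B < j. f (card B)) = (\<Sum>i<j. f i * real (card M choose i))"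
proof (induction j)
  case (Suc j)
  have fin: "finite {B. B \<subseteq> M \<and> card B < i}" "finite {B. B \<subseteq> M \<and> card B = i}" for i
    using assms by (auto intro: finite_subset[of _ "Pow M"])
  have "{B. B \<subseteq> M \<and> card B < Suc j} = {B. B \<subseteq> M \<and> card B < j} \<union> {B. B \<subseteq> M \<and> card B = j}" by auto
  hence "(\<Sum>B | B \<subseteq> M \<and> card B < Suc j. f (card B)) =
     (\<Sum>B | B \<subseteq> M \<and> card B < j. f (card B)) + (\<Sum>B | B \<subseteq> M \<and> card B = j. f (card B))"
    using fin by (simp add: sum.union_disjoint disjoint_iff)
  also have "(\<Sum>B | B \<subseteq> M \<and> card B = j. f (card B)) = f j * real (card M choose j)"
    using n_subsets[OF assms, of j] by simp
  finally show ?case using Suc by simp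
qed simp

text \<open>Only subsets of the set \<open>M\<close> of primes satisfying \<open>P\<close>
  contribute, so both sides become sums of binomial coefficients of \<open>card M\<close>. The
  absolute value covers both parities of \<open>j\<close>.\<close>

lemma bonferroni:
  assumes "finite A" "j > 0"
  shows "\<bar>(if {q\<in>A. P q} = {} then 1 else 0) - (\<Sum>B | B \<subseteq> A \<and> card B < j. (-1) ^ card B * (if \<forall>q\<in>B. P q then 1 else 0))\<bar>
     \<le> (\<Sum>B | B \<subseteq> A \<and> card B = j. if \<forall>q\<in>B. P q then 1 else (0::real))"
proof -
  define M where "M = {q\<in>A. P q}"
  have fM: "finite M" using assms by (simp add: M_def)
  have fin: "finite {B. B \<subseteq> A \<and> Q B}" for Q using assms(1) by (auto intro: finite_subset[of _ "Pow A"])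
  have "(\<Sum>B | B \<subseteq> A \<and> card B < j. (-1) ^ card B * (if \<forall>q\<in>B. P q then 1 else (0::real)))
     = (\<Sum>B | B \<subseteq> M \<and> card B < j. (-1) ^ card B)"
    by (rule sum.mono_neutral_cong_right) (use fin in \<open>auto simp: M_def\<close>)
  also have "\<dots> = (\<Sum>i<j. (-1) ^ i * real (card M choose i))" by (rule sum_subsets_card_less[OF fM])
  finally have 1: "(\<Sum>B | B \<subseteq> A \<and> card B < j. (-1) ^ card B * (if \<forall>q\<in>B. P q then 1 else (0::real))) = \<dots>" .
  have "(\<Sum>B | B \<subseteq> A \<and> card B = j. if \<forall>q\<in>B. P q then 1 else (0::real)) = (\<Sum>B | B \<subseteq> M \<and> card B = j. 1)"
    by (rule sum.mono_neutral_cong_right) (use fin in \<open>auto simp: M_def\<close>)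
  also have "\<dots> = real (card M choose j)" using n_subsets[OF fM, of j] by simp
  finally have 2: "(\<Sum>B | B \<subseteq> A \<and> card B = j. if \<forall>q\<in>B. P q then 1 else (0::real)) = real (card M choose j)" .
  have 3: "(if {q\<in>A. P q} = {} then 1 else 0) = (if card M = 0 then 1 else (0::real))"
    using fM by (simp add: M_def)
  show ?thesis unfolding 1 2 3 by (rule alternating_choose_bound[OF assms(2)])
qed

lemma bonferroni_prim_roots:
  assumes "n > 0" "j > 0" "finite S"
  shows "\<bar>real (card {a\<in>S. lambda_prim_root a n})
       - (\<Sum>B | B \<subseteq> lam_primes n \<and> card B < j. (-1) ^ card B * real (card {a\<in>S. a \<in> exp_subgroup n B}))\<bar>
     \<le> (\<Sum>B | B \<subseteq> lam_primes n \<and> card B = j. real (card {a\<in>S. a \<in> exp_subgroup n B}))"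
proof -
  let ?A = "lam_primes n" and ?P = "\<lambda>a q. [a ^ (carmichael n div q) = 1] (mod n)"
  define S' where "S' = {a\<in>S. coprime a n}"
  have fS: "finite S'" using assms by (simp add: S'_def)
  have fA: "finite ?A" by (simp add: lam_primes_def)
  define t where "t a = (if {q\<in>?A. ?P a q} = {} then 1 else 0::real)" for a
  define w where "w a B = (if \<forall>q\<in>B. ?P a q then 1 else 0::real)" for a B
  have "{a\<in>S. lambda_prim_root a n} = {a\<in>S'. {q\<in>?A. ?P a q} = {}}"
    using lambda_prim_root_iff[OF assms(1)] by (auto simp: S'_def lambda_prim_root_def)
  hence c1: "real (card {a\<in>S. lambda_prim_root a n}) = (\<Sum>a\<in>S'. t a)"
    using fS by (simp add: t_def sum.If_cases Int_def)
  have "{a\<in>S. a \<in> exp_subgroup n B} = {a\<in>S'. \<forall>q\<in>B. ?P a q}" for B by (auto simp: S'_def exp_subgroup_def)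
  hence c2: "real (card {a\<in>S. a \<in> exp_subgroup n B}) = (\<Sum>a\<in>S'. w a B)" for B
    using fS by (simp add: w_def sum.If_cases Int_def)
  have "(\<Sum>a\<in>S'. t a) - (\<Sum>B | B \<subseteq> ?A \<and> card B < j. (-1) ^ card B * (\<Sum>a\<in>S'. w a B))
     = (\<Sum>a\<in>S'. t a - (\<Sum>B | B \<subseteq> ?A \<and> card B < j. (-1) ^ card B * w a B))"
    by (simp add: sum_subtractf sum_distrib_left sum.swap[of _ S'])
  also have "\<bar>\<dots>\<bar> \<le> (\<Sum>a\<in>S'. (\<Sum>B | B \<subseteq> ?A \<and> card B = j. w a B))"
    by (rule order_trans[OF sum_abs], intro sum_mono) (simp only: t_def w_def bonferroni[OF fA assms(2)])
  also have "\<dots> = (\<Sum>B | B \<subseteq> ?A \<and> card B = j. \<Sum>a\<in>S'. w a B)" by (rule sum.swap)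
  finally show ?thesis unfolding c1 c2 .
qed

section \<open>Character sums on average over the modulus\<close>

text \<open>The error is split into a uniform part \<open>V\<close> and an exceptional part
  \<open>e\<close>. The \<open>K\<close> characters detecting \<open>E\<close> each cost
  \<open>V\<close>, but division by \<open>K\<close> removes that multiplicity. The exceptional part
  is summed over all characters modulo \<open>n\<close>, so its bound does not depend on
  \<open>E\<close> and can be averaged over \<open>n\<close>.\<close>

lemma count_subgroup:
  assumes E: "unit_subgroup n E" and n: "n > 0" and y: "y \<ge> 0"
    and T: "\<And>\<psi>. dchar n \<psi> \<Longrightarrow> \<psi> \<noteq> princ_char n \<Longrightarrow> norm (\<Sum>a=1..nat \<lfloor>y\<rfloor>. \<psi> a) \<le> V + e \<psi>"
    and V: "V \<ge> 0" and e: "\<And>\<psi>. e \<psi> \<ge> 0"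
  shows "\<bar>real (card {a\<in>{1..nat \<lfloor>y\<rfloor>}. a \<in> E}) - y * real (card (E \<inter> {..<n})) / real n\<bar>
     \<le> 2 ^ card (prime_factors n) + V + (\<Sum>\<psi> | dchar n \<psi> \<and> \<psi> \<noteq> princ_char n. e \<psi>)"
proof -
  define Y where "Y = nat \<lfloor>y\<rfloor>"
  define K where "K = card (annihilator n E)"
  let ?Ann = "annihilator n E" and ?D = "{\<psi>. dchar n \<psi> \<and> \<psi> \<noteq> princ_char n}"
  have finA: "finite ?Ann" using finite_annihilator[OF n] .
  have finD: "finite ?D" using finite_dchars[OF n] by simp
  have pin: "princ_char n \<in> ?Ann" using princ_char_in_annihilator[OF E] .
  have K1: "K \<ge> 1" unfolding K_def using finA pin by (metis One_nat_def Suc_leI card_gt_0_iff empty_iff)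
  have sub: "?Ann - {princ_char n} \<subseteq> ?D" by (auto simp: annihilator_def)
  let ?c = "card {a\<in>{1..Y}. a \<in> E}" and ?g = "card {a. a \<in> {1..Y} \<and> coprime a n}"
  let ?oth = "\<Sum>\<psi>\<in>?Ann - {princ_char n}. \<Sum>a=1..Y. \<psi> a"
  have "of_nat (K * ?c) = (\<Sum>a=1..Y. if a \<in> E then of_nat K else (0::complex))"
    by (simp add: sum.If_cases Int_def)
  also have "\<dots> = (\<Sum>a=1..Y. \<Sum>\<psi>\<in>?Ann. \<psi> a)" by (simp only: sum_annihilator[OF E n] K_def)
  also have "\<dots> = (\<Sum>\<psi>\<in>?Ann. \<Sum>a=1..Y. \<psi> a)" by (rule sum.swap)
  also have "\<dots> = (\<Sum>a=1..Y. princ_char n a) + ?oth" using finA pin by (rule sum.remove)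
  also have "(\<Sum>a=1..Y. princ_char n a) = of_nat ?g"
    by (simp add: princ_char_def sum.If_cases Int_def)
  finally have main: "of_nat (K * ?c) = of_nat ?g + ?oth" .
  have "norm ?oth \<le> (\<Sum>\<psi>\<in>?Ann - {princ_char n}. V + e \<psi>)"
    by (intro sum_norm_le) (use T in \<open>auto simp: annihilator_def Y_def\<close>)
  also have "\<dots> = real (card (?Ann - {princ_char n})) * V + (\<Sum>\<psi>\<in>?Ann - {princ_char n}. e \<psi>)"
    by (simp add: sum.distrib)
  also have "\<dots> \<le> real K * V + (\<Sum>\<psi>\<in>?D. e \<psi>)"
    using V e finD sub card_mono[OF finA, of "?Ann - {princ_char n}"]
    by (intro add_mono mult_right_mono sum_mono2) (auto simp: K_def)
  \<comment> \<open>A factor \<open>K >= 1\<close> is given away so that all error terms can be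
    divided by \<open>K\<close> together.\<close>
  also have "(\<Sum>\<psi>\<in>?D. e \<psi>) \<le> real K * (\<Sum>\<psi>\<in>?D. e \<psi>)"
    using K1 e by (intro mult_left_mono[of 1 "real K", simplified mult_1_left] mult_right_mono[of 1 "real K" "sum e ?D", simplified mult_1_left] sum_nonneg) auto
  finally have oth: "norm ?oth \<le> real K * (V + (\<Sum>\<psi>\<in>?D. e \<psi>))" by (simp add: algebra_simps)
  have eq: "?oth = complex_of_real (real K * real ?c - real ?g)" using main by simp
  have 1: "\<bar>real K * real ?c - real ?g\<bar> \<le> real K * (V + (\<Sum>\<psi>\<in>?D. e \<psi>))"
    using oth unfolding eq norm_of_real .
  have 2: "\<bar>real ?g - y * (real (totient n) / real n)\<bar> \<le> 2 ^ card (prime_factors n)"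
    using coprime_count[OF n y] unfolding Y_def .
  also have "\<dots> \<le> real K * 2 ^ card (prime_factors n)" using K1 by simp
  finally have 2: "\<bar>real ?g - y * (real (totient n) / real n)\<bar> \<le> real K * 2 ^ card (prime_factors n)" .
  have "real (totient n) = real K * real (card (E \<inter> {..<n}))"
    using card_annihilator[OF E n] unfolding K_def by (metis of_nat_mult)
  hence 3: "y * (real (totient n) / real n) = real K * (y * real (card (E \<inter> {..<n})) / real n)" by simp
  have "\<bar>real K * (real ?c - y * real (card (E \<inter> {..<n})) / real n)\<bar>
     \<le> real K * (V + (\<Sum>\<psi>\<in>?D. e \<psi>)) + real K * 2 ^ card (prime_factors n)"
    using 1 2 unfolding 3 right_diff_distrib by linarith
  also have "\<dots> = real K * (2 ^ card (prime_factors n) + V + (\<Sum>\<psi>\<in>?D. e \<psi>))" by (simp add: algebra_simps)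
  finally have "real K * \<bar>real ?c - y * real (card (E \<inter> {..<n})) / real n\<bar> \<le> \<dots>"
    by (simp only: abs_mult abs_of_nat)
  thus ?thesis using K1 unfolding Y_def by simp
qed

definition cond_of :: "nat \<Rightarrow> (nat \<Rightarrow> complex) \<Rightarrow> nat \<times> (nat \<Rightarrow> complex)" where
  "cond_of n \<psi> = (SOME (f, \<phi>). f dvd n \<and> primitive_char f \<phi> \<and> (\<forall>a. coprime a n \<longrightarrow> \<psi> a = \<phi> a))"

text \<open>Since \<phi> already vanishes off the units modulo \<open>f\<close>, only coprimality to
  the cofactor \<open>n div f\<close> has to be imposed. Cofactor and primitive character thus vary
  independently in the large sieve, and the last fact recovers \<psi> from them.\<close>

lemma cond_of:
  assumes "dchar n \<psi>" "n > 0" "cond_of n \<psi> = (f, \<phi>)"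
  shows "f dvd n" "primitive_char f \<phi>" "\<And>a. coprime a n \<Longrightarrow> \<psi> a = \<phi> a" "f > 0" "dchar f \<phi>"
    "\<psi> \<noteq> princ_char n \<Longrightarrow> \<phi> \<noteq> princ_char f"
    "(\<Sum>a=1..Y. \<psi> a) = (\<Sum>a | a \<in> {1..Y} \<and> coprime a n. \<phi> a)"
    "(\<Sum>a=1..Y. \<psi> a) = (\<Sum>a | a \<in> {1..Y} \<and> coprime a (n div f). \<phi> a)"
    "\<psi> = (\<lambda>a. if coprime a n then \<phi> a else 0)"
proof -
  have "\<exists>x. case x of (f, \<phi>) \<Rightarrow> f dvd n \<and> primitive_char f \<phi> \<and> (\<forall>a. coprime a n \<longrightarrow> \<psi> a = \<phi> a)"
    using induced_by_primitive[OF assms(1,2)] by simp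
  from someI_ex[OF this] have *: "f dvd n \<and> primitive_char f \<phi> \<and> (\<forall>a. coprime a n \<longrightarrow> \<psi> a = \<phi> a)"
    using assms(3) unfolding cond_of_def by simp
  thus f: "f dvd n" "primitive_char f \<phi>" "\<And>a. coprime a n \<Longrightarrow> \<psi> a = \<phi> a" by auto
  thus d: "f > 0" "dchar f \<phi>" by (auto simp: primitive_char_def)
  show eq: "\<psi> = (\<lambda>a. if coprime a n then \<phi> a else 0)"
    using f(3) dchar_eq_0_iff[OF assms(1)] by auto
  show "\<phi> \<noteq> princ_char f" if "\<psi> \<noteq> princ_char n"
  proof
    assume "\<phi> = princ_char f"
    moreover have "coprime a f" if "coprime a n" for a using that f(1) by (meson coprime_divisors dvd_refl)
    ultimately have "\<psi> = princ_char n" unfolding eq by (auto simp: princ_char_def)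
    thus False using that by simp
  qed
  show s: "(\<Sum>a=1..Y. \<psi> a) = (\<Sum>a | a \<in> {1..Y} \<and> coprime a n. \<phi> a)"
    by (rule sum.mono_neutral_cong_right) (auto simp: eq)
  have "coprime a n \<longleftrightarrow> coprime a f \<and> coprime a (n div f)" for a
    using f(1) by (metis coprime_mult_right_iff dvd_mult_div_cancel)
  hence "(\<Sum>a | a \<in> {1..Y} \<and> coprime a n. \<phi> a) = (\<Sum>a | a \<in> {1..Y} \<and> coprime a (n div f). \<phi> a)"
    by (intro sum.mono_neutral_left) (auto simp: dchar_eq_0_iff[OF d(2)])
  thus "(\<Sum>a=1..Y. \<psi> a) = (\<Sum>a | a \<in> {1..Y} \<and> coprime a (n div f). \<phi> a)" using s by simp
qed

text \<open>\<open>level Y f = k\<close> means \<open>Y\<^sup>k\<^sup>-\<^sup>1 < f\<^sup>4 \<le> Y\<^sup>k\<close> for \<open>k > 0\<close>.\<close>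

definition level :: "nat \<Rightarrow> nat \<Rightarrow> nat" where
  "level Y f = (LEAST k. f ^ 4 \<le> Y ^ k)"

lemma level_props:
  assumes "f ^ 4 \<le> Y ^ K"
  shows "f ^ 4 \<le> Y ^ level Y f" "level Y f \<le> K" "k < level Y f \<Longrightarrow> Y ^ k < f ^ 4"
  unfolding level_def
  using LeastI[of "\<lambda>k. f ^ 4 \<le> Y ^ k" K] Least_le[of "\<lambda>k. f ^ 4 \<le> Y ^ k" K] not_less_Least[of k "\<lambda>k. f ^ 4 \<le> Y ^ k"] assms
  by (auto simp: not_le)

text \<open>The part of a character sum above the threshold \<open>V\<close>; conductors of level below 4 are
  short enough for the bound by the period.\<close>

definition excess :: "real \<Rightarrow> nat \<Rightarrow> nat \<Rightarrow> (nat \<Rightarrow> complex) \<Rightarrow> real" where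
  "excess V Y n \<psi> = (let k = level Y (fst (cond_of n \<psi>)) in
     if k \<ge> 4 then norm (\<Sum>a=1..Y. \<psi> a) ^ (2 * k) / V ^ (2 * k - 1) else 0)"

text \<open>Markov's inequality in additive form: above the threshold each factor
  \<open>s / V\<close> is at least 1, so a high moment dominates \<open>s\<close>.\<close>

lemma le_threshold_plus_power:
  fixes s V :: real
  assumes "V > 0" "s \<ge> 0" "k \<ge> 1"
  shows "s \<le> V + s ^ (2 * k) / V ^ (2 * k - 1)"
proof (cases "s \<le> V")
  case True
  have "s ^ (2 * k) / V ^ (2 * k - 1) \<ge> 0" using assms by simp
  thus ?thesis using True by linarith
next
  case False
  have "s ^ (2 * k) = s * s ^ (2 * k - 1)" using assms(3) by (metis Suc_diff_1 add_gr_0 mult_2 less_le_trans zero_less_one power_Suc)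
  moreover have "V ^ (2 * k - 1) \<le> s ^ (2 * k - 1)" using False assms by (intro power_mono) auto
  hence "s * V ^ (2 * k - 1) \<le> s * s ^ (2 * k - 1)" using assms by (intro mult_left_mono)
  ultimately have "s \<le> s ^ (2 * k) / V ^ (2 * k - 1)" using assms by (simp add: field_simps)
  thus ?thesis using assms by linarith
qed

text \<open>The hypothesis \<open>X ^ 4 <= Y ^ K\<close> ensures that the minimum defining
  \<open>level\<close> is attained for every conductor up to \<open>X\<close>. Level at most 3 means
  \<open>f <= Y powr (3/4)\<close>, where the period bound is good enough.\<close>

lemma char_sum_le_excess:
  assumes "dchar n \<psi>" "\<psi> \<noteq> princ_char n" "n \<in> {1..X}" "X ^ 4 \<le> Y ^ K" "V > 0" "Y \<ge> 1"
  shows "norm (\<Sum>a=1..Y. \<psi> a) \<le> V + 2 ^ card (prime_factors n) * real Y powr (3/4) + excess V Y n \<psi>"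
proof -
  obtain f \<phi> where c: "cond_of n \<psi> = (f, \<phi>)" by (cases "cond_of n \<psi>")
  have n: "n > 0" using assms by auto
  note co = cond_of[OF assms(1) n c]
  have "f \<le> n" using co(1) n by (intro dvd_imp_le)
  hence "f \<le> X" using assms(3) by simp
  hence "f ^ 4 \<le> X ^ 4" by (intro power_mono) auto
  hence lv: "f ^ 4 \<le> Y ^ K" using assms(4) by (rule le_trans)
  show ?thesis
  proof (cases "level Y f \<ge> 4")
    case True
    have "norm (\<Sum>a=1..Y. \<psi> a) \<le> V + excess V Y n \<psi>"
      using le_threshold_plus_power[OF assms(5), of "norm (\<Sum>a=1..Y. \<psi> a)" "level Y f"] True
      by (simp add: excess_def c Let_def)
    moreover have "(0::real) \<le> 2 ^ card (prime_factors n) * real Y powr (3/4)" by simp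
    ultimately show ?thesis by linarith
  next
    case False
    have "f ^ 4 \<le> Y ^ level Y f" using level_props[OF lv] by blast
    also have "\<dots> \<le> Y ^ 3" using False assms(6) by (intro power_increasing) auto
    finally have "real (f ^ 4) \<le> real (Y ^ 3)" by (rule of_nat_mono)
    hence "real (f ^ 4) powr (1/4) \<le> real (Y ^ 3) powr (1/4)" by (intro powr_mono2) auto
    moreover have "real (f ^ 4) powr (1/4) = (real f powr real 4) powr (1/4)"
      using co(4) by (subst powr_realpow) auto
    moreover have "(real f powr real 4) powr (1/4) = real f" unfolding powr_powr using co(4) by simp
    moreover have "real (Y ^ 3) powr (1/4) = (real Y powr real 3) powr (1/4)"
      using assms(6) by (subst powr_realpow) auto
    moreover have "(real Y powr real 3) powr (1/4) = real Y powr (3/4)" unfolding powr_powr by simp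
    ultimately have fY: "real f \<le> real Y powr (3/4)" by simp
    have "norm (\<Sum>a=1..Y. \<psi> a) \<le> 2 ^ card (prime_factors n) * real f"
      using induced_char_sum_bound[OF co(5) co(6)[OF assms(2)] co(4) n] co(7) by simp
    also have "\<dots> \<le> 2 ^ card (prime_factors n) * real Y powr (3/4)" using fY by (intro mult_left_mono) auto
    finally show ?thesis using False assms(5) by (simp add: excess_def c Let_def)
  qed
qed

text \<open>At level \<open>k\<close> a pair of modulus and character corresponds to a cofactor
  \<open>m\<close> and a primitive character. The large sieve is applied once for each
  \<open>m\<close>, and the lower bound on the conductor limits the number of \<open>m\<close>,
  which gives the gain \<open>Y powr (- (k - 1) / 4)\<close>.\<close>

lemma sum_excess_bound:
  fixes X Y K :: nat
  assumes "X ^ 4 \<le> Y ^ K" "V > 0" "Y \<ge> 1"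
  shows "(\<Sum>n=1..X. \<Sum>\<psi> | dchar n \<psi> \<and> \<psi> \<noteq> princ_char n. excess V Y n \<psi>)
     \<le> (\<Sum>k=4..K. real X * real Y powr (- (real k - 1) / 4) *
            (2 * real Y ^ k * (\<Sum>l=1..Y ^ k. (real (tau k l))\<^sup>2)) / V ^ (2 * k - 1))"
proof -
  let ?D = "\<lambda>n. {\<psi>. dchar n \<psi> \<and> \<psi> \<noteq> princ_char n}"
  define W where "W = (SIGMA n:{1..X}. ?D n)"
  define lv where "lv = (\<lambda>(n, \<psi>). level Y (fst (cond_of n \<psi>)))"
  define s' where "s' w = norm (\<Sum>a=1..Y. snd w a :: complex)" for w :: "nat \<times> (nat \<Rightarrow> complex)"
  have finD: "finite (?D n)" if "n \<in> {1..X}" for n using that finite_dchars[of n] by simp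
  have finW: "finite W" unfolding W_def using finD by (intro finite_SigmaI) auto
  have lvK: "lv w \<le> K" "fst (cond_of (fst w) (snd w)) ^ 4 \<le> Y ^ K" if "w \<in> W" for w
  proof -
    obtain n \<psi> where w: "w = (n, \<psi>)" by (cases w)
    obtain f \<phi> where c: "cond_of n \<psi> = (f, \<phi>)" by (cases "cond_of n \<psi>")
    have n: "dchar n \<psi>" "n > 0" "n \<le> X" using that by (auto simp: W_def w)
    have "f \<le> X" using dvd_imp_le[OF cond_of(1)[OF n(1,2) c] n(2)] n(3) by simp
    hence "f ^ 4 \<le> X ^ 4" by (intro power_mono) auto
    hence "f ^ 4 \<le> Y ^ K" using assms(1) by (rule le_trans)
    thus "fst (cond_of (fst w) (snd w)) ^ 4 \<le> Y ^ K" "lv w \<le> K"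
      using level_props(2) by (auto simp: w c lv_def)
  qed
  have "(\<Sum>n=1..X. \<Sum>\<psi>\<in>?D n. excess V Y n \<psi>) = (\<Sum>w\<in>W. excess V Y (fst w) (snd w))"
    unfolding W_def using finD by (subst sum.Sigma) (auto simp: case_prod_unfold)
  also have "\<dots> = (\<Sum>w\<in>{w\<in>W. lv w \<in> {4..K}}. s' w ^ (2 * lv w) / V ^ (2 * lv w - 1))"
    using finW lvK by (intro sum.mono_neutral_cong_right) (auto simp: excess_def lv_def Let_def s'_def case_prod_unfold)
  also have "\<dots> = (\<Sum>k\<in>{4..K}. \<Sum>w\<in>{w\<in>{w\<in>W. lv w \<in> {4..K}}. lv w = k}. s' w ^ (2 * lv w) / V ^ (2 * lv w - 1))"
    by (rule sum.group[symmetric]) (use finW in auto)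
  also have "\<dots> \<le> (\<Sum>k=4..K. real X * real Y powr (- (real k - 1) / 4) *
            (2 * real Y ^ k * (\<Sum>l=1..Y ^ k. (real (tau k l))\<^sup>2)) / V ^ (2 * k - 1))"
  proof (rule sum_mono)
    fix k assume k: "k \<in> {4..K}"
    define T where "T = 2 * real Y ^ k * (\<Sum>l=1..Y ^ k. (real (tau k l))\<^sup>2)"
    define I where "I = {(f, \<phi>). primitive_char f \<phi> \<and> f ^ 4 \<le> Y ^ k}"
    \<comment> \<open>This is \<open>m <= X Y^(-(k-1)/4)\<close> in naturals, obtained from
      \<open>m f <= X\<close> and \<open>f ^ 4 > Y ^ (k - 1)\<close>.\<close>
    define M where "M = {m::nat. m \<ge> 1 \<and> m ^ 4 * Y ^ (k - 1) \<le> X ^ 4}"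
    define Wk where "Wk = {w\<in>W. lv w = k}"
    define S where "S m z = norm (\<Sum>a | a \<in> {1..Y} \<and> coprime a m. snd z a :: complex)" for m :: nat and z :: "nat \<times> (nat \<Rightarrow> complex)"
    define h where "h w = (fst w div fst (cond_of (fst w) (snd w)), cond_of (fst w) (snd w))" for w
    have finI: "finite I" using primitive_large_sieve(1)[OF assms(3), of k] by (simp add: I_def)
    have cardM: "finite M \<and> real (card M) \<le> real X * real Y powr (- (real k - 1) / 4)"
    proof -
      define b where "b = real X * real Y powr (- (real k - 1) / 4)"
      have "m \<le> b" if "m \<in> M" for m
      proof -
        have "real (m ^ 4 * Y ^ (k - 1)) \<le> real (X ^ 4)" using that unfolding M_def by (intro of_nat_mono) auto
        hence "real m ^ 4 * real Y ^ (k - 1) \<le> real X ^ 4" by simp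
        moreover have "real Y ^ (k - 1) = real Y powr (real k - 1)"
          using assms(3) k by (subst powr_realpow[symmetric]) (auto simp: of_nat_diff)
        ultimately have "real m ^ 4 * real Y powr (real k - 1) * real Y powr (- (real k - 1)) \<le> real X ^ 4 * real Y powr (- (real k - 1))"
          by (intro mult_right_mono) auto
        also have "real m ^ 4 * real Y powr (real k - 1) * real Y powr (- (real k - 1)) = real m ^ 4"
          using assms(3) by (simp only: mult.assoc powr_add[symmetric]) simp
        also have "real X ^ 4 * real Y powr (- (real k - 1)) = b ^ 4"
        proof -
          have "real Y powr (- (real k - 1) / 4 * 4) = (real Y powr (- (real k - 1) / 4)) ^ 4"
            by (subst powr_powr[symmetric]) (use assms(3) in simp)
          moreover have "- (real k - 1) / 4 * 4 = - (real k - 1)" by simp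
          ultimately show ?thesis by (simp only: b_def power_mult_distrib)
        qed
        finally show "real m \<le> b" using power_mono_iff[of "real m" b 4] by (simp add: b_def)
      qed
      hence "M \<subseteq> {1..nat \<lfloor>b\<rfloor>}" unfolding M_def by (auto simp: le_nat_floor)
      moreover from this have "card M \<le> card {1..nat \<lfloor>b\<rfloor>}" by (intro card_mono) auto
      hence "real (card M) \<le> real (nat \<lfloor>b\<rfloor>)" by simp
      moreover have "real (nat \<lfloor>b\<rfloor>) \<le> b" by (simp add: b_def)
      ultimately show ?thesis unfolding b_def by (auto intro: finite_subset order_trans)
    qed
    have hW: "h w \<in> M \<times> I" "s' w = S (fst (h w)) (snd (h w))"
      "w = (fst (h w) * fst (snd (h w)), \<lambda>a. if coprime a (fst (h w) * fst (snd (h w))) then snd (snd (h w)) a else 0)" if "w \<in> Wk" for w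
    proof -
      obtain n \<psi> where w: "w = (n, \<psi>)" by (cases w)
      obtain f \<phi> where c: "cond_of n \<psi> = (f, \<phi>)" by (cases "cond_of n \<psi>")
      have wW: "w \<in> W" "level Y f = k" using that by (auto simp: Wk_def lv_def w c)
      have n: "dchar n \<psi>" "n > 0" "n \<le> X" using wW(1) by (auto simp: W_def w)
      note co = cond_of[OF n(1,2) c]
      have fK: "f ^ 4 \<le> Y ^ K" using lvK(2)[OF wW(1)] by (simp add: w c)
      have f4: "f ^ 4 \<le> Y ^ k" "Y ^ (k - 1) < f ^ 4"
        using level_props[OF fK] level_props(3)[OF fK, of "k - 1"] wW(2) k by auto
      define m where "m = n div f"
      have nm: "n = m * f" using co(1) by (simp add: m_def)
      have "m \<ge> 1" using nm n(2) by (cases m) auto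
      have "m ^ 4 * Y ^ (k - 1) \<le> m ^ 4 * f ^ 4" using f4 by (intro mult_left_mono) auto
      also have "\<dots> = n ^ 4" by (simp add: nm power_mult_distrib)
      also have "\<dots> \<le> X ^ 4" using n(3) by (intro power_mono) auto
      finally have "m \<in> M" using \<open>m \<ge> 1\<close> by (simp add: M_def)
      have hw: "h w = (m, (f, \<phi>))" by (simp add: h_def w c m_def)
      show "h w \<in> M \<times> I" using \<open>m \<in> M\<close> co(2) f4(1) by (simp add: hw I_def)
      show "s' w = S (fst (h w)) (snd (h w))" unfolding hw unfolding s'_def S_def m_def w fst_conv snd_conv co(8)[of Y] ..
      show "w = (fst (h w) * fst (snd (h w)), \<lambda>a. if coprime a (fst (h w) * fst (snd (h w))) then snd (snd (h w)) a else 0)"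
        unfolding hw by (simp only: w fst_conv snd_conv nm[symmetric] co(9)[symmetric])
    qed
    have inj: "inj_on h Wk" by (rule inj_onI) (metis hW(3))
    have "(\<Sum>w\<in>Wk. s' w ^ (2 * k)) = (\<Sum>w\<in>Wk. S (fst (h w)) (snd (h w)) ^ (2 * k))"
      using hW(2) by (intro sum.cong) auto
    also have "\<dots> = (\<Sum>z\<in>h ` Wk. S (fst z) (snd z) ^ (2 * k))" using inj by (simp add: sum.reindex)
    also have "\<dots> \<le> (\<Sum>z\<in>M \<times> I. S (fst z) (snd z) ^ (2 * k))"
    proof (rule sum_mono2)
      show "h ` Wk \<subseteq> M \<times> I" by (rule image_subsetI) (rule hW(1))
    qed (use finI cardM in \<open>auto simp: S_def\<close>)
    also have "\<dots> = (\<Sum>m\<in>M. \<Sum>z\<in>I. S m z ^ (2 * k))" by (simp add: sum.cartesian_product case_prod_unfold)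
    also have "\<dots> \<le> (\<Sum>m\<in>M. T)"
      using primitive_large_sieve(2)[OF assms(3), where k = k] by (intro sum_mono) (simp only: S_def T_def I_def case_prod_unfold)
    also have "\<dots> = real (card M) * T" by simp
    also have "\<dots> \<le> real X * real Y powr (- (real k - 1) / 4) * T"
      using cardM by (intro mult_right_mono) (auto simp: T_def intro!: mult_nonneg_nonneg sum_nonneg)
    finally have "(\<Sum>w\<in>Wk. s' w ^ (2 * k)) / V ^ (2 * k - 1) \<le> real X * real Y powr (- (real k - 1) / 4) * T / V ^ (2 * k - 1)"
      using assms(2) by (intro divide_right_mono) auto
    moreover have "(\<Sum>w\<in>{w\<in>{w\<in>W. lv w \<in> {4..K}}. lv w = k}. s' w ^ (2 * lv w) / V ^ (2 * lv w - 1)) = (\<Sum>w\<in>Wk. s' w ^ (2 * k)) / V ^ (2 * k - 1)"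
      unfolding sum_divide_distrib using k by (intro sum.cong) (auto simp: Wk_def)
    ultimately show "(\<Sum>w\<in>{w\<in>{w\<in>W. lv w \<in> {4..K}}. lv w = k}. s' w ^ (2 * lv w) / V ^ (2 * lv w - 1))
       \<le> real X * real Y powr (- (real k - 1) / 4) *
            (2 * real Y ^ k * (\<Sum>l=1..Y ^ k. (real (tau k l))\<^sup>2)) / V ^ (2 * k - 1)"
      by (simp only: T_def)
  qed
  finally show ?thesis .
qed

section \<open>Prime divisors of \<lambda>(n), the truncation error, and the bound summed over
  moduli\<close>

lemma finite_lam_primes [simp]: "finite (lam_primes n)"
  by (simp add: lam_primes_def)

lemma finite_subsets_lam_primes [simp]: "finite {B. B \<subseteq> lam_primes n \<and> Q B}"
  by (rule finite_subset[of _ "Pow (lam_primes n)"]) auto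

lemma two_power_omega_le: "m > (0::nat) \<Longrightarrow> 2 ^ card (prime_factors m) \<le> m"
proof -
  assume m: "m > 0"
  have "card {d. d dvd m} \<le> card {1..m}"
  proof (rule card_mono)
    show "{d. d dvd m} \<subseteq> {1..m}"
    proof
      fix d assume "d \<in> {d. d dvd m}"
      hence "d \<le> m" "d > 0" using m dvd_imp_le[of d m] by (auto intro!: gr0I)
      thus "d \<in> {1..m}" by simp
    qed
  qed auto
  thus ?thesis using two_power_omega_le_divisors[OF m] by simp
qed

text \<open>The product of the distinct primes is at most \<lambda>(n), hence at most
  \<open>X\<close>; the factor 2 comes from \<open>ln 2 >= 1/2\<close>.\<close>

lemma card_lam_primes_le:
  assumes "n \<in> {1..X}"
  shows "real (card (lam_primes n)) \<le> 2 * ln (real X)"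
proof -
  have n: "n > 0" "n \<le> X" using assms by auto
  have "2 ^ card (lam_primes n) \<le> carmichael n"
    unfolding lam_primes_def using carmichael_pos[OF n(1)] by (rule two_power_omega_le)
  also have "\<dots> \<le> X" using carmichael_le[OF n(1)] n(2) by simp
  finally have "real (2 ^ card (lam_primes n)) \<le> real X" by (rule of_nat_mono)
  hence "ln (real (2 ^ card (lam_primes n))) \<le> ln (real X)" using n by (subst ln_le_cancel_iff) auto
  hence "real (card (lam_primes n)) * ln 2 \<le> ln (real X)" by (simp add: ln_realpow)
  moreover have "real (card (lam_primes n)) * (1/2) \<le> real (card (lam_primes n)) * ln 2"
    using ln2_ge_two_thirds by (intro mult_left_mono) auto
  ultimately show ?thesis by linarith
qed

text \<open>The weights \<open>j choose i >= 1\<close> are inserted only to complete the sum of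
  powers of \<open>card A\<close> to a binomial expansion.\<close>

lemma card_small_subsets:
  assumes "finite A"
  shows "real (card {B. B \<subseteq> A \<and> card B \<le> j}) \<le> (1 + real (card A)) ^ j"
proof -
  have "{B. B \<subseteq> A \<and> card B \<le> j} = {B. B \<subseteq> A \<and> card B < Suc j}" by auto
  hence "real (card {B. B \<subseteq> A \<and> card B \<le> j}) = (\<Sum>B | B \<subseteq> A \<and> card B < Suc j. 1)" by simp
  also have "\<dots> = (\<Sum>i\<le>j. real (card A choose i))"
    using sum_subsets_card_less[OF assms, of "\<lambda>_. 1" "Suc j"] by (simp only: lessThan_Suc_atMost mult_1_left)
  also have "\<dots> \<le> (\<Sum>i\<le>j. real (j choose i) * real (card A) ^ i * 1 ^ (j - i))"
  proof (intro sum_mono)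
    fix i assume i: "i \<in> {..j}"
    have "card A choose i \<le> card A ^ i" using binomial_le_pow[of i "card A"] by (cases "i \<le> card A") (auto simp: binomial_eq_0)
    hence "real (card A choose i) \<le> real (card A) ^ i" by (metis of_nat_mono of_nat_power)
    also have "\<dots> \<le> real (j choose i) * real (card A) ^ i"
    proof -
      have "j choose i \<ge> 1" using i by (simp add: Suc_le_eq zero_less_binomial)
      hence "1 * real (card A) ^ i \<le> real (j choose i) * real (card A) ^ i" by (intro mult_right_mono) auto
      thus ?thesis by simp
    qed
    finally show "real (card A choose i) \<le> real (j choose i) * real (card A) ^ i * 1 ^ (j - i)" by simp
  qed
  also have "\<dots> = (real (card A) + 1) ^ j" by (rule binomial_ring[symmetric])
  finally show ?thesis by (simp add: add.commute)
qed

text \<open>Elements up to \<open>w\<close> contribute at most a harmonic sum, and the remaining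
  ones, at most \<open>w\<close> in number, less than \<open>1 / w\<close> each. With at most
  \<open>2 ln X\<close> primes this makes the reciprocal sum doubly logarithmic in
  \<open>X\<close>.\<close>

lemma sum_inverse_set_le:
  assumes "finite A" "0 \<notin> A" "real (card A) \<le> W" "W \<ge> 1"
  shows "(\<Sum>q\<in>A. 1 / real q) \<le> 2 + ln W"
proof -
  define w where "w = nat \<lfloor>W\<rfloor>"
  have w: "w \<ge> 1" "real w \<le> W" "card A \<le> w" using assms(3,4) by (auto simp: w_def le_nat_floor)
  have "(\<Sum>q\<in>A. 1 / real q) \<le> (\<Sum>q\<in>A. (if q \<in> {1..w} then 1 / real q else 0) + 1 / real w)"
  proof (rule sum_mono)
    fix q assume q: "q \<in> A"
    show "1 / real q \<le> (if q \<in> {1..w} then 1 / real q else 0) + 1 / real w"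
    proof (cases "q \<in> {1..w}")
      case False
      have "q \<noteq> 0" using q assms(2) by metis
      hence "q > w" using False by auto
      thus ?thesis using False w(1) by (auto simp: field_simps)
    qed auto
  qed
  also have "\<dots> = (\<Sum>q\<in>A. if q \<in> {1..w} then 1 / real q else 0) + real (card A) * (1 / real w)"
    by (simp add: sum.distrib)
  also have "real (card A) * (1 / real w) \<le> 1" using w by simp
  also have "(\<Sum>q\<in>A. if q \<in> {1..w} then 1 / real q else 0) = (\<Sum>q\<in>A \<inter> {1..w}. 1 / real q)"
    using assms(1) by (subst sum.inter_restrict) auto
  also have "\<dots> \<le> (\<Sum>q\<in>{1..w}. 1 / real q)" by (intro sum_mono2) auto
  also have "\<dots> \<le> 1 + ln (real w)" using w by (intro sum_inverse_le) auto
  also have "ln (real w) \<le> ln W" using w by (subst ln_le_cancel_iff) auto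
  finally show ?thesis by simp
qed

text \<open>Rankin's trick with the parameter \<open>z\<close>.\<close>

lemma sum_inverse_prod_subsets_le:
  fixes A :: "nat set"
  assumes "finite A" "z > 0"
  shows "(\<Sum>B | B \<subseteq> A \<and> card B = j. 1 / real (\<Prod>B)) \<le> exp (z * (\<Sum>q\<in>A. 1 / real q)) / z ^ j"
proof -
  have "z ^ j * (\<Sum>B | B \<subseteq> A \<and> card B = j. 1 / real (\<Prod>B)) = (\<Sum>B | B \<subseteq> A \<and> card B = j. z ^ j * (1 / real (\<Prod>B)))"
    by (rule sum_distrib_left)
  also have "\<dots> = (\<Sum>B | B \<subseteq> A \<and> card B = j. \<Prod>q\<in>B. z / real q)"
  proof (intro sum.cong refl)
    fix B assume B: "B \<in> {B. B \<subseteq> A \<and> card B = j}"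
    have "(\<Prod>q\<in>B. z / real q) = (\<Prod>q\<in>B. z) / (\<Prod>q\<in>B. real q)" by (rule prod_dividef)
    thus "z ^ j * (1 / real (\<Prod>B)) = (\<Prod>q\<in>B. z / real q)" using B by simp
  qed
  also have "\<dots> \<le> (\<Sum>B\<in>Pow A. \<Prod>q\<in>B. z / real q)"
    using assms by (intro sum_mono2) (auto intro!: prod_nonneg)
  also have "\<dots> = (\<Prod>q\<in>A. z / real q + 1)" by (simp add: prod_add[OF assms(1)])
  also have "\<dots> \<le> (\<Prod>q\<in>A. exp (z / real q))"
    using assms(2) by (intro prod_mono) (auto simp: add.commute intro!: exp_ge_add_one_self)
  also have "\<dots> = exp (z * (\<Sum>q\<in>A. 1 / real q))" by (simp add: exp_sum[OF assms(1)] sum_distrib_left)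
  finally show ?thesis using assms(2) by (simp only: pos_le_divide_eq zero_less_power mult.commute)
qed

text \<open>Bonferroni is applied with the same \<open>j\<close> to \<open>{1..Y}\<close> and to a
  full residue system. The truncated sums match up to \<open>D\<close> per subset, and each of the
  two tails contributes the index bound \<open>1 / \<Prod>B\<close>, whence the factor 2.\<close>

lemma prim_root_count_bound:
  assumes n: "n \<in> {1..X}" and j: "j > 0" and V: "V > 0" and y: "y \<ge> 1" and K: "X ^ 4 \<le> nat \<lfloor>y\<rfloor> ^ K"
  defines "Y \<equiv> nat \<lfloor>y\<rfloor>"
  defines "D \<equiv> 2 ^ card (prime_factors n) + (V + 2 ^ card (prime_factors n) * real Y powr (3/4))
      + (\<Sum>\<psi> | dchar n \<psi> \<and> \<psi> \<noteq> princ_char n. excess V Y n \<psi>)"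
  shows "\<bar>real (card {a\<in>{1..Y}. lambda_prim_root a n}) - y * (real (R n) / real n)\<bar>
     \<le> real (card {B. B \<subseteq> lam_primes n \<and> card B \<le> j}) * D
        + 2 * y * (\<Sum>B | B \<subseteq> lam_primes n \<and> card B = j. 1 / real (\<Prod>B))"
proof -
  have n0: "n > 0" using n by auto
  have Y1: "Y \<ge> 1" using y by (simp add: Y_def le_nat_floor)
  have ex0: "excess V Y n \<psi> \<ge> 0" for \<psi> using V by (simp add: excess_def Let_def)
  define c where "c B = real (card {a\<in>{1..Y}. a \<in> exp_subgroup n B})" for B
  define e where "e B = real (card (exp_subgroup n B \<inter> {..<n}))" for B
  define L where "L = {B. B \<subseteq> lam_primes n \<and> card B < j}"
  define Q where "Q = {B. B \<subseteq> lam_primes n \<and> card B = j}"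
  have fin: "finite L" "finite Q" by (simp_all add: L_def Q_def)
  have delta: "\<bar>c B - y * e B / real n\<bar> \<le> D" for B
    unfolding c_def e_def D_def Y_def
  proof (rule order_trans[OF count_subgroup[OF unit_subgroup_exp_subgroup n0, where V = "V + 2 ^ card (prime_factors n) * real Y powr (3/4)" and e = "excess V Y n"]])
    show "norm (\<Sum>a=1..nat \<lfloor>y\<rfloor>. \<psi> a) \<le> V + 2 ^ card (prime_factors n) * real Y powr (3/4) + excess V Y n \<psi>"
      if "dchar n \<psi>" "\<psi> \<noteq> princ_char n" for \<psi>
      using char_sum_le_excess[OF that n K[folded Y_def] V Y1] by (simp add: Y_def)
  qed (use y V ex0 in \<open>auto simp: Y_def\<close>)
  have "{a \<in> {0..<n}. a \<in> exp_subgroup n B} = exp_subgroup n B \<inter> {..<n}" for B by auto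
  hence e2: "real (card {a \<in> {0..<n}. a \<in> exp_subgroup n B}) = e B" for B by (simp add: e_def)
  define cc where "cc = real (card {a\<in>{1..Y}. lambda_prim_root a n})"
  have b1: "\<bar>cc - (\<Sum>B\<in>L. (-1) ^ card B * c B)\<bar> \<le> (\<Sum>B\<in>Q. c B)"
    unfolding cc_def c_def L_def Q_def by (rule bonferroni_prim_roots[OF n0 j]) simp
  have b2: "\<bar>real (R n) - (\<Sum>B\<in>L. (-1) ^ card B * e B)\<bar> \<le> (\<Sum>B\<in>Q. e B)"
    using bonferroni_prim_roots[OF n0 j, of "{0..<n}"] unfolding R_def L_def Q_def e2 by simp
  define t where "t = y / real n"
  have t0: "t \<ge> 0" using y by (simp add: t_def)
  have delta': "\<bar>c B - t * e B\<bar> \<le> D" for B using delta[of B] by (simp add: t_def)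
  have "\<bar>t * (real (R n) - (\<Sum>B\<in>L. (-1) ^ card B * e B))\<bar> \<le> t * (\<Sum>B\<in>Q. e B)"
    unfolding abs_mult using b2 t0 by (intro mult_mono) auto
  hence b3: "\<bar>t * real (R n) - (\<Sum>B\<in>L. (-1) ^ card B * (t * e B))\<bar> \<le> t * (\<Sum>B\<in>Q. e B)"
    by (simp add: right_diff_distrib sum_distrib_left mult.left_commute)
  have "\<bar>(\<Sum>B\<in>L. (-1) ^ card B * c B) - (\<Sum>B\<in>L. (-1) ^ card B * (t * e B))\<bar> = \<bar>\<Sum>B\<in>L. (-1) ^ card B * (c B - t * e B)\<bar>"
    by (simp add: sum_subtractf right_diff_distrib)
  also have "\<dots> \<le> (\<Sum>B\<in>L. D)"
    by (rule order_trans[OF sum_abs], intro sum_mono) (simp add: abs_mult delta')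
  finally have b4: "\<bar>(\<Sum>B\<in>L. (-1) ^ card B * c B) - (\<Sum>B\<in>L. (-1) ^ card B * (t * e B))\<bar> \<le> real (card L) * D" by simp
  have "(\<Sum>B\<in>Q. c B) \<le> (\<Sum>B\<in>Q. D + t * e B)"
  proof (rule sum_mono)
    fix B show "c B \<le> D + t * e B" using delta'[of B] by linarith
  qed
  hence b5: "(\<Sum>B\<in>Q. c B) \<le> real (card Q) * D + t * (\<Sum>B\<in>Q. e B)" by (simp add: sum.distrib sum_distrib_left)
  have "t * (\<Sum>B\<in>Q. e B) \<le> y * (\<Sum>B\<in>Q. 1 / real (\<Prod>B))"
  proof -
    have "e B / real n \<le> 1 / real (\<Prod>B)" if "B \<in> Q" for B
    proof -
      have B: "B \<subseteq> lam_primes n" using that by (simp add: Q_def)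
      have "\<Prod>B > 0" using B by (intro prod_pos) (auto simp: lam_primes_def in_prime_factors_iff prime_gt_0_nat)
      moreover have "e B * real (\<Prod>B) \<le> real n"
        unfolding e_def using card_exp_subgroup[OF n0 B] by (metis of_nat_mono of_nat_mult)
      ultimately show ?thesis using n0 by (simp add: field_simps del: of_nat_prod)
    qed
    hence "(\<Sum>B\<in>Q. e B / real n) \<le> (\<Sum>B\<in>Q. 1 / real (\<Prod>B))" by (rule sum_mono)
    hence "y * (\<Sum>B\<in>Q. e B / real n) \<le> y * (\<Sum>B\<in>Q. 1 / real (\<Prod>B))" using y by (intro mult_left_mono) auto
    thus ?thesis by (simp add: t_def flip: sum_divide_distrib)
  qed
  moreover have "card {B. B \<subseteq> lam_primes n \<and> card B \<le> j} = card L + card Q"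
  proof -
    have "{B. B \<subseteq> lam_primes n \<and> card B \<le> j} = L \<union> Q" by (auto simp: L_def Q_def)
    thus ?thesis using fin by (simp add: card_Un_disjoint L_def Q_def disjoint_iff)
  qed
  moreover have "y * (real (R n) / real n) = t * real (R n)" by (simp add: t_def)
  ultimately show ?thesis using b1 b3 b4 b5 unfolding cc_def[symmetric] Q_def[symmetric]
    by (simp only: of_nat_add distrib_right)
qed

lemma swap_prim_root_count:
  "(\<Sum>a\<in>{1..Y}. real (N a x)) = (\<Sum>n=1..nat \<lfloor>x\<rfloor>. real (card {a\<in>{1..Y}. lambda_prim_root a n}))"
proof -
  have "(\<Sum>a\<in>{1..Y}. real (N a x)) = (\<Sum>a\<in>{1..Y}. \<Sum>n | n \<in> {1..nat \<lfloor>x\<rfloor>} \<and> lambda_prim_root a n. 1)"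
    by (simp add: N_def)
  also have "\<dots> = (\<Sum>n\<in>{1..nat \<lfloor>x\<rfloor>}. \<Sum>a | a \<in> {1..Y} \<and> lambda_prim_root a n. 1)"
    by (rule sum.swap_restrict) auto
  finally show ?thesis by simp
qed

text \<open>The number of subsets \<open>B\<close> is bounded by one power for all \<open>n\<close>,
  so it multiplies the average of the \<open>D n\<close> over moduli. The parameters
  \<open>V\<close>, \<open>K\<close>, \<open>j\<close>, \<open>z\<close> remain free for a joint
  choice.\<close>

lemma total_bound:
  fixes x y V z :: real and j K :: nat
  assumes j: "j > 0" and V: "V > 0" and y: "y \<ge> 1" and x: "x \<ge> 1" and z: "z > 0"
  defines "X \<equiv> nat \<lfloor>x\<rfloor>" and "Y \<equiv> nat \<lfloor>y\<rfloor>"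
  assumes K: "X ^ 4 \<le> Y ^ K"
  shows "\<bar>(\<Sum>a\<in>{1..Y}. real (N a x)) - y * (\<Sum>n\<in>{1..X}. real (R n) / real n)\<bar>
     \<le> (1 + 2 * ln (real X)) ^ j * ((1 + real Y powr (3/4)) * (real X * (1 + ln (real X))) + real X * V
          + (\<Sum>k=4..K. real X * real Y powr (- (real k - 1) / 4) *
            (2 * real Y ^ k * (\<Sum>l=1..Y ^ k. (real (tau k l))\<^sup>2)) / V ^ (2 * k - 1)))
        + 2 * y * real X * (exp (z * (2 + ln (1 + 2 * ln (real X)))) / z ^ j)"
proof -
  have X1: "X \<ge> 1" using x by (simp add: X_def le_nat_floor)
  have Y1: "Y \<ge> 1" using y by (simp add: Y_def le_nat_floor)
  define W where "W = 1 + 2 * ln (real X)"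
  have W1: "W \<ge> 1" using X1 by (simp add: W_def)
  define Zs where "Zs n = (\<Sum>\<psi> | dchar n \<psi> \<and> \<psi> \<noteq> princ_char n. excess V Y n \<psi>)" for n
  define w where "w n = (2::real) ^ card (prime_factors n)" for n :: nat
  define D where "D n = w n + (V + w n * real Y powr (3/4)) + Zs n" for n
  have ex0: "excess V Y n \<psi> \<ge> 0" for n \<psi> using V by (simp add: excess_def Let_def)
  have D0: "D n \<ge> 0" for n unfolding D_def Zs_def w_def using V ex0
    by (intro add_nonneg_nonneg mult_nonneg_nonneg sum_nonneg) auto
  have each: "\<bar>real (card {a\<in>{1..Y}. lambda_prim_root a n}) - y * (real (R n) / real n)\<bar>
     \<le> W ^ j * D n + 2 * y * (exp (z * (2 + ln W)) / z ^ j)" if n: "n \<in> {1..X}" for n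
  proof -
    have cl: "real (card (lam_primes n)) \<le> 2 * ln (real X)" using card_lam_primes_le[OF n] .
    have "real (card {B. B \<subseteq> lam_primes n \<and> card B \<le> j}) \<le> (1 + real (card (lam_primes n))) ^ j"
      by (rule card_small_subsets) simp
    also have "\<dots> \<le> W ^ j" using cl by (intro power_mono) (auto simp: W_def)
    finally have 1: "real (card {B. B \<subseteq> lam_primes n \<and> card B \<le> j}) * D n \<le> W ^ j * D n"
      using D0 by (intro mult_right_mono)
    have "(\<Sum>q\<in>lam_primes n. 1 / real q) \<le> 2 + ln W"
    proof (rule sum_inverse_set_le)
      show "0 \<notin> lam_primes n" by (auto simp: lam_primes_def in_prime_factors_iff)
    qed (use cl W1 in \<open>auto simp: W_def\<close>)
    hence "exp (z * (\<Sum>q\<in>lam_primes n. 1 / real q)) / z ^ j \<le> exp (z * (2 + ln W)) / z ^ j"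
      using z by (intro divide_right_mono) auto
    with sum_inverse_prod_subsets_le[OF finite_lam_primes z]
    have "(\<Sum>B | B \<subseteq> lam_primes n \<and> card B = j. 1 / real (\<Prod>B)) \<le> exp (z * (2 + ln W)) / z ^ j"
      by (rule order_trans)
    hence 2: "2 * y * (\<Sum>B | B \<subseteq> lam_primes n \<and> card B = j. 1 / real (\<Prod>B)) \<le> 2 * y * (exp (z * (2 + ln W)) / z ^ j)"
      using y by (intro mult_left_mono) auto
    have "\<bar>real (card {a\<in>{1..Y}. lambda_prim_root a n}) - y * (real (R n) / real n)\<bar>
      \<le> real (card {B. B \<subseteq> lam_primes n \<and> card B \<le> j}) * D n
        + 2 * y * (\<Sum>B | B \<subseteq> lam_primes n \<and> card B = j. 1 / real (\<Prod>B))"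
      using prim_root_count_bound[OF n j V y K[unfolded Y_def]] unfolding D_def Zs_def w_def Y_def .
    thus ?thesis using 1 2 by linarith
  qed
  have "(\<Sum>a\<in>{1..Y}. real (N a x)) - y * (\<Sum>n\<in>{1..X}. real (R n) / real n)
     = (\<Sum>n\<in>{1..X}. real (card {a\<in>{1..Y}. lambda_prim_root a n}) - y * (real (R n) / real n))"
    unfolding swap_prim_root_count X_def[symmetric] sum_subtractf sum_distrib_left ..
  also have "\<bar>\<dots>\<bar> \<le> (\<Sum>n\<in>{1..X}. W ^ j * D n + 2 * y * (exp (z * (2 + ln W)) / z ^ j))"
    by (rule order_trans[OF sum_abs], intro sum_mono each)
  also have "\<dots> = W ^ j * (\<Sum>n\<in>{1..X}. D n) + 2 * y * real X * (exp (z * (2 + ln W)) / z ^ j)"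
    by (simp add: sum.distrib sum_distrib_left)
  also have "(\<Sum>n\<in>{1..X}. D n) = (1 + real Y powr (3/4)) * (\<Sum>n\<in>{1..X}. w n) + real X * V + (\<Sum>n\<in>{1..X}. Zs n)"
    unfolding D_def sum.distrib by (simp add: sum_distrib_right[symmetric] algebra_simps)
  also have "\<dots> \<le> (1 + real Y powr (3/4)) * (real X * (1 + ln (real X))) + real X * V
          + (\<Sum>k=4..K. real X * real Y powr (- (real k - 1) / 4) *
            (2 * real Y ^ k * (\<Sum>l=1..Y ^ k. (real (tau k l))\<^sup>2)) / V ^ (2 * k - 1))"
    unfolding w_def Zs_def
    by (intro add_mono mult_left_mono sum_two_power_omega_le sum_excess_bound K V Y1 order_refl) (use X1 in auto)
  finally show ?thesis using W1 unfolding W_def by (simp add: mult_left_mono)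
qed

section \<open>Choice of parameters\<close>

text \<open>The claim amounts to a comparison with \<open>V ^ (2 * k)\<close>, that is, exponent
  \<open>1.94 k\<close> of \<open>Y\<close>. Per unit of \<open>k\<close> the sieve costs
  \<open>1 + 1.1\<close> and the cofactors gain \<open>1/4 - 1/(4k)\<close>. For
  \<open>k >= 4\<close> this is at most 1.9125, which leaves room for the factor 2 and for
  \<open>exp (0.01 k^2 + C k)\<close>.\<close>

lemma level_term_bound:
  "\<exists>l0::real. \<forall>Y k. ln (real Y) \<ge> l0 \<and> k \<ge> 4 \<and> real k \<le> ln (real Y) / 4 + 1 \<longrightarrow>
     real Y powr (- (real k - 1) / 4) * (2 * real Y ^ k * (\<Sum>l=1..Y ^ k. (real (tau k l))\<^sup>2))
        / (real Y powr 0.97) ^ (2 * k - 1) \<le> real Y powr 0.97"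
proof -
  obtain C where C: "C \<ge> 0" "\<And>k X. (\<Sum>m\<in>{1..X}. (real (tau k m))\<^sup>2) \<le> real X powr (2 * 0.55) * exp (0.01 * real k ^ 2 + C * real k)"
    using sum_tau_squared_le[of "0.55" "0.01"] by auto
  have "real Y powr (- (real k - 1) / 4) * (2 * real Y ^ k * (\<Sum>l=1..Y ^ k. (real (tau k l))\<^sup>2))
        / (real Y powr 0.97) ^ (2 * k - 1) \<le> real Y powr 0.97"
    \<comment> \<open>The lower bound on \<open>ln Y\<close> makes \<open>C k + 1\<close> at most
      \<open>k ln Y / 100\<close>; the upper bound on \<open>k\<close> does the same for
      \<open>0.01 k^2\<close>.\<close>
    if Y: "ln (real Y) \<ge> 100 * (C + 1)" and k: "k \<ge> 4" "real k \<le> ln (real Y) / 4 + 1" for Y k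
  proof -
    define l where "l = ln (real Y)"
    have l: "l \<ge> 100 * (C + 1)" "l \<ge> 100" using Y C(1) by (auto simp: l_def)
    have Y0: "real Y > 0" using l(2) by (cases "Y = 0") (auto simp: l_def)
    have pw: "real Y powr a = exp (a * l)" for a using Y0 by (simp add: powr_def l_def)
    have pn: "real Y ^ k = exp (real k * l)" using Y0 by (simp add: exp_of_nat_mult l_def)
    define V where "V = real Y powr 0.97"
    have V0: "V > 0" using Y0 by (simp add: V_def)
    have V2: "V ^ (2 * k - 1) * V = exp (0.97 * l * (2 * real k))"
    proof -
      have "V ^ (2 * k - 1) * V = V ^ (2 * k)" using k(1) by (simp flip: power_Suc2)
      also have "\<dots> = exp (real (2 * k) * (0.97 * l))" unfolding V_def pw by (simp only: exp_of_nat_mult)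
      finally show ?thesis by (simp add: mult_ac)
    qed
    have "real (Y ^ k) powr (2 * 0.55) = exp (1.1 * (real k * l))"
      using Y0 by (simp add: powr_def l_def ln_realpow)
    hence T: "(\<Sum>l=1..Y ^ k. (real (tau k l))\<^sup>2) \<le> exp (1.1 * (real k * l)) * exp (0.01 * real k ^ 2 + C * real k)"
      using C(2)[of k "Y ^ k"] by simp
    have "real Y powr (- (real k - 1) / 4) * (2 * real Y ^ k * (\<Sum>l=1..Y ^ k. (real (tau k l))\<^sup>2))
       \<le> exp (- (real k - 1) / 4 * l) * (exp 1 * exp (real k * l) * (exp (1.1 * (real k * l)) * exp (0.01 * real k ^ 2 + C * real k)))"
      unfolding pw pn using T exp_ge_add_one_self[of 1] by (intro mult_mono mult_nonneg_nonneg sum_nonneg) auto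
    also have "\<dots> = exp (- (real k - 1) / 4 * l + 1 + real k * l + 1.1 * (real k * l) + 0.01 * real k ^ 2 + C * real k)"
      by (simp only: exp_add mult_ac)
    also have "\<dots> \<le> exp (0.97 * l * (2 * real k))"
    proof -
      have "real k \<le> l" using k(2) l(2) by (simp add: l_def)
      hence 1: "real k * real k \<le> real k * l" by (intro mult_left_mono) auto
      have 2: "l * 4 \<le> l * real k" using k(1) l(2) by (intro mult_left_mono) auto
      have 3: "real k * (100 * (C + 1)) \<le> real k * l" using l(1) by (intro mult_left_mono) auto
      define p q c where "p = real k * l" and "q = real k * real k" and "c = C * real k"
      have "q \<le> p" "4 * l \<le> p" "100 * c + 100 * real k \<le> p"
        using 1 2 3 by (simp_all add: p_def q_def c_def algebra_simps)
      moreover have "real k \<ge> 4" using k(1) by simp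
      ultimately have "- p / 4 + l / 4 + 1 + p + 11/10 * p + 1/100 * q + c \<le> 194/100 * p"
        using l(2) by linarith
      moreover have "- (real k - 1) / 4 * l + 1 + real k * l + 1.1 * (real k * l) + 0.01 * real k ^ 2 + C * real k
          = - p / 4 + l / 4 + 1 + p + 11/10 * p + 1/100 * q + c"
        by (simp add: p_def q_def c_def power2_eq_square field_simps)
      moreover have "0.97 * l * (2 * real k) = 194/100 * p" by (simp add: p_def)
      ultimately have "- (real k - 1) / 4 * l + 1 + real k * l + 1.1 * (real k * l) + 0.01 * real k ^ 2 + C * real k
          \<le> 0.97 * l * (2 * real k)" by (simp only:)
      thus ?thesis by simp
    qed
    finally show ?thesis unfolding V2[symmetric] V_def[symmetric] using V0 by (simp add: pos_divide_le_eq mult.commute)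
  qed
  thus ?thesis by blast
qed

text \<open>In order, the conditions admit the level bound, control the base \<open>W\<close>, make
  \<open>j\<close> positive, control the numerator in Rankin's trick, absorb the rounding of
  \<open>j\<close>, and absorb the polynomial factors in \<open>L\<close>.\<close>

lemma final_parameters:
  "\<exists>L0\<ge>10. \<forall>L\<ge>L0. l0 \<le> 4 * L \<and> 1 + 2 * L ^ 2 \<le> L ^ 3 \<and> 1 \<le> 0.02 * L / ln L \<and>
     sqrt L * (2 + 3 * ln L) \<le> 0.002 * L \<and> ln L / 2 \<le> 0.001 * L \<and> 4 + L + 2 * L ^ 2 \<le> exp (0.016 * L)"
proof -
  have "eventually (\<lambda>L::real. L \<ge> 10) at_top" by (rule eventually_ge_at_top)
  moreover have "eventually (\<lambda>L::real. l0 \<le> 4 * L) at_top" by real_asymp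
  moreover have "eventually (\<lambda>L::real. 1 + 2 * L ^ 2 \<le> L ^ 3) at_top" by real_asymp
  moreover have "eventually (\<lambda>L::real. 1 \<le> 0.02 * L / ln L) at_top" by real_asymp
  moreover have "eventually (\<lambda>L::real. sqrt L * (2 + 3 * ln L) \<le> 0.002 * L) at_top" by real_asymp
  moreover have "eventually (\<lambda>L::real. ln L / 2 \<le> 0.001 * L) at_top" by real_asymp
  moreover have "eventually (\<lambda>L::real. 4 + L + 2 * L ^ 2 \<le> exp (0.016 * L)) at_top" by real_asymp
  ultimately have "eventually (\<lambda>L. L \<ge> 10 \<and> l0 \<le> 4 * L \<and> 1 + 2 * L ^ 2 \<le> L ^ 3 \<and> 1 \<le> 0.02 * L / ln L \<and>
     sqrt L * (2 + 3 * ln L) \<le> 0.002 * L \<and> ln L / 2 \<le> 0.001 * L \<and> 4 + L + 2 * L ^ 2 \<le> exp (0.016 * L)) at_top"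
    by eventually_elim simp
  then obtain L1 where "\<And>L. L \<ge> L1 \<Longrightarrow> L \<ge> 10 \<and> l0 \<le> 4 * L \<and> 1 + 2 * L ^ 2 \<le> L ^ 3 \<and> 1 \<le> 0.02 * L / ln L \<and>
     sqrt L * (2 + 3 * ln L) \<le> 0.002 * L \<and> ln L / 2 \<le> 0.001 * L \<and> 4 + L + 2 * L ^ 2 \<le> exp (0.016 * L)"
    unfolding eventually_at_top_linorder by blast
  thus ?thesis by (intro exI[of _ "max 10 L1"]) auto
qed

theorem theorem2p1:
  shows "\<exists>c>0. \<exists>C>0. \<exists>x0. \<forall>x y. x \<ge> x0 \<and> y > exp (4.2 * sqrt (ln x)) \<longrightarrow>
     \<bar>(1 / y) * (\<Sum>a\<in>{1..nat \<lfloor>y\<rfloor>}. real (N a x))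
        - (\<Sum>n\<in>{1..nat \<lfloor>x\<rfloor>}. real (R n) / real n)\<bar>
       \<le> C * x * exp (- c * sqrt (ln x))"
proof -
  obtain l0 :: real where l0: "\<And>Y k. ln (real Y) \<ge> l0 \<Longrightarrow> k \<ge> 4 \<Longrightarrow> real k \<le> ln (real Y) / 4 + 1 \<Longrightarrow>
     real Y powr (- (real k - 1) / 4) * (2 * real Y ^ k * (\<Sum>l=1..Y ^ k. (real (tau k l))\<^sup>2))
        / (real Y powr 0.97) ^ (2 * k - 1) \<le> real Y powr 0.97"
    using level_term_bound by blast
  obtain L0 where L0: "L0 \<ge> 10" "\<And>L. L \<ge> L0 \<Longrightarrow> l0 \<le> 4 * L \<and> 1 + 2 * L ^ 2 \<le> L ^ 3 \<and> 1 \<le> 0.02 * L / ln L \<and>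
     sqrt L * (2 + 3 * ln L) \<le> 0.002 * L \<and> ln L / 2 \<le> 0.001 * L \<and> 4 + L + 2 * L ^ 2 \<le> exp (0.016 * L)"
    using final_parameters[of l0] by blast
  have main: "\<bar>(1 / y) * (\<Sum>a\<in>{1..nat \<lfloor>y\<rfloor>}. real (N a x)) - (\<Sum>n\<in>{1..nat \<lfloor>x\<rfloor>}. real (R n) / real n)\<bar>
       \<le> 3 * x * exp (- 0.007 * sqrt (ln x))" if x: "x \<ge> exp (L0 ^ 2)" and y: "y > exp (4.2 * sqrt (ln x))" for x y
  proof -
    define L where "L = sqrt (ln x)"
    have x0: "x > 0" using x by (rule less_le_trans[OF exp_gt_zero])
    have lnx: "ln x \<ge> L0 ^ 2" using x x0 by (simp add: ln_ge_iff)
    hence LL0: "L \<ge> L0" unfolding L_def using L0(1) by (intro real_le_rsqrt)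
    have L10: "L \<ge> 10" using LL0 L0(1) by simp
    have lnx0: "ln x \<ge> 0" using lnx by (rule order_trans[OF zero_le_power2])
    have L2: "L ^ 2 = ln x" using lnx0 by (simp add: L_def)
    have x1: "x \<ge> 1" using lnx0 x0 by simp
    note P = L0(2)[OF LL0]
    have lnL: "ln L > 0" using L10 by simp
    have yL: "y > exp (4.2 * L)" using y by (simp add: L_def)
    have y0: "y > 0" using yL by (rule less_trans[OF exp_gt_zero])
    have ly: "ln y \<ge> 4.2 * L" by (rule iffD2[OF ln_ge_iff[OF y0] less_imp_le[OF yL]])
    have y2: "y \<ge> 2" using yL L10 exp_ge_add_one_self[of "4.2 * L"] by linarith
    define X where "X = nat \<lfloor>x\<rfloor>"
    define Y where "Y = nat \<lfloor>y\<rfloor>"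
    have X: "X \<ge> 1" "real X \<le> x" using x1 by (auto simp: X_def le_nat_floor)
    have Y: "Y \<ge> 1" "real Y \<le> y" "real Y \<ge> y / 2"
      using y2 by (auto simp: Y_def le_nat_floor) linarith
    have lnX: "0 \<le> ln (real X)" "ln (real X) \<le> L ^ 2" using X x0 by (auto simp: L2)
    \<comment> \<open>Rounding \<open>y\<close> down costs at most \<open>ln 2 <= 1\<close>, which
      fits into the margin \<open>0.2 * L\<close> between 4.2 and 4.\<close>
    have lY: "ln (real Y) \<ge> 4 * L"
    proof -
      have "ln (y / 2) \<le> ln (real Y)" using Y y2 by (subst ln_le_cancel_iff) auto
      moreover have "ln (y / 2) = ln y - ln 2" using y2 by (simp add: ln_div)
      moreover have "ln (2::real) \<le> 1" using ln_le_minus_one[of "2::real"] by simp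
      ultimately show ?thesis using ly L10 by linarith
    qed
    \<comment> \<open>The least \<open>K\<close> with \<open>X ^ 4 <= Y ^ K\<close>. As
      \<open>ln X <= L ^ 2\<close> and \<open>ln Y >= 4 * L\<close>, it is at most
      \<open>L + 1\<close>, within the range where the level bound holds.\<close>
    define K where "K = nat \<lceil>4 * ln (real X) / ln (real Y)\<rceil>"
    have lY0: "ln (real Y) > 0" using lY L10 by linarith
    have K1: "4 * ln (real X) \<le> real K * ln (real Y)"
    proof -
      have "4 * ln (real X) / ln (real Y) \<le> real K" unfolding K_def by linarith
      thus ?thesis using lY0 by (simp add: pos_divide_le_eq)
    qed
    have XK: "X ^ 4 \<le> Y ^ K"
    proof -
      have "ln (real X ^ 4) \<le> ln (real Y ^ K)" using K1 X Y by (simp add: ln_realpow)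
      hence "real X ^ 4 \<le> real Y ^ K" using X Y by (subst (asm) ln_le_cancel_iff) auto
      thus ?thesis by (metis of_nat_le_iff of_nat_power)
    qed
    have K2: "real K \<le> L + 1"
    proof -
      have "4 * ln (real X) / ln (real Y) \<le> 4 * L ^ 2 / (4 * L)"
        using lnX lY L10 by (intro frac_le) auto
      also have "\<dots> = L" using L10 by (simp add: power2_eq_square)
      finally have "4 * ln (real X) / ln (real Y) \<le> L" .
      moreover have "0 \<le> 4 * ln (real X) / ln (real Y)" using lnX lY0 by simp
      ultimately show ?thesis unfolding K_def by linarith
    qed
    define V where "V = real Y powr 0.97"
    have V0: "V > 0" using Y by (simp add: V_def)
    \<comment> \<open>Because \<open>W <= L ^ 3\<close>, this keeps the number of subsets at
      \<open>exp (3 * 0.02 * L)\<close>, while a high power of \<open>z\<close> is still available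
      against the tail.\<close>
    define j where "j = nat \<lfloor>0.02 * L / ln L\<rfloor>"
    have j: "j > 0" "real j \<le> 0.02 * L / ln L" "real j \<ge> 0.02 * L / ln L - 1"
    proof -
      define r where "r = 0.02 * L / ln L"
      have "r \<ge> 1" using P by (simp add: r_def)
      thus "j > 0" "real j \<le> 0.02 * L / ln L" "real j \<ge> 0.02 * L / ln L - 1"
        unfolding j_def r_def[symmetric] by linarith+
    qed
    \<comment> \<open>A balance in the tail \<open>exp (z * (2 + ln W)) / z ^ j\<close>: the
      numerator is \<open>exp\<close> of order \<open>sqrt L * ln L\<close>, and the denominator is
      about \<open>exp (0.01 * L)\<close>.\<close>
    define z where "z = sqrt L"
    have z0: "z > 0" using L10 by (simp add: z_def)
    define W where "W = 1 + 2 * ln (real X)"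
    have W: "1 \<le> W" "W \<le> L ^ 3" using lnX P by (auto simp: W_def)
    have Wj: "W ^ j \<le> exp (0.06 * L)"
    proof -
      have "W ^ j \<le> (L ^ 3) ^ j" using W by (intro power_mono) auto
      also have "\<dots> = exp (real (3 * j) * ln L)"
        using L10 by (simp only: exp_of_nat_mult power_mult) simp
      also have "\<dots> \<le> exp (0.06 * L)"
      proof -
        have "real j * ln L \<le> 0.02 * L" using j(2) lnL by (simp add: pos_le_divide_eq)
        thus ?thesis by simp
      qed
      finally show ?thesis .
    qed
    define Ts where "Ts = (\<Sum>k=4..K. real X * real Y powr (- (real k - 1) / 4) *
            (2 * real Y ^ k * (\<Sum>l=1..Y ^ k. (real (tau k l))\<^sup>2)) / V ^ (2 * k - 1))"
    have "Ts \<le> (\<Sum>k=4..K. real X * V)" unfolding Ts_def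
    proof (rule sum_mono)
      fix k assume k: "k \<in> {4..K}"
      have kl: "real k \<le> ln (real Y) / 4 + 1" using k K2 lY by simp
      have "real Y powr (- (real k - 1) / 4) * (2 * real Y ^ k * (\<Sum>l=1..Y ^ k. (real (tau k l))\<^sup>2)) / V ^ (2 * k - 1) \<le> V"
        unfolding V_def by (rule l0) (use k kl lY P in auto)
      hence "real X * (real Y powr (- (real k - 1) / 4) * (2 * real Y ^ k * (\<Sum>l=1..Y ^ k. (real (tau k l))\<^sup>2)) / V ^ (2 * k - 1)) \<le> real X * V"
        by (intro mult_left_mono) auto
      thus "real X * real Y powr (- (real k - 1) / 4) * (2 * real Y ^ k * (\<Sum>l=1..Y ^ k. (real (tau k l))\<^sup>2)) / V ^ (2 * k - 1) \<le> real X * V"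
        by (simp only: times_divide_eq_right mult.assoc)
    qed
    also have "\<dots> \<le> real K * (real X * V)"
      using V0 by (simp add: mult_right_mono)
    also have "\<dots> \<le> (L + 1) * (real X * V)" using K2 V0 by (intro mult_right_mono) auto
    finally have Ts: "Ts \<le> (L + 1) * (real X * V)" .
    have Y34: "1 + real Y powr (3/4) \<le> 2 * V"
    proof -
      have "real Y powr 0 \<le> V" "real Y powr (3/4) \<le> V" unfolding V_def using Y(1) by (intro powr_mono; simp)+
      thus ?thesis using Y by simp
    qed
    define T1 where "T1 = W ^ j * ((1 + real Y powr (3/4)) * (real X * (1 + ln (real X))) + real X * V + Ts)"
    define T2 where "T2 = 2 * y * real X * (exp (z * (2 + ln W)) / z ^ j)"
    have total: "\<bar>(\<Sum>a\<in>{1..Y}. real (N a x)) - y * (\<Sum>n\<in>{1..X}. real (R n) / real n)\<bar> \<le> T1 + T2"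
      unfolding T1_def T2_def Ts_def W_def X_def Y_def
      by (rule total_bound) (use j V0 y2 x1 z0 XK in \<open>auto simp: X_def Y_def\<close>)
    \<comment> \<open>The saving \<open>y powr (- 0.03)\<close> is evaluated with
      \<open>ln y >= 4.2 * L\<close>.\<close>
    have Vy: "V \<le> y * exp (- 0.126 * L)"
    proof -
      have "V \<le> y powr 0.97" unfolding V_def using Y by (intro powr_mono2) auto
      also have "\<dots> = exp (0.97 * ln y)" using y2 by (simp add: powr_def)
      also have "\<dots> \<le> exp (ln y - 0.126 * L)" using ly by simp
      also have "\<dots> = exp (ln y) * exp (- 0.126 * L)" by (simp only: exp_add[symmetric]) simp
      also have "exp (ln y) = y" using y0 by simp
      finally show ?thesis .
    qed
    have "T1 \<le> exp (0.06 * L) * (2 * V * (real X * (1 + L ^ 2)) + real X * V + (L + 1) * (real X * V))"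
      unfolding T1_def
    proof (intro mult_mono add_mono)
      have "0 \<le> Ts" unfolding Ts_def using V0 by (intro sum_nonneg divide_nonneg_nonneg mult_nonneg_nonneg) auto
      thus "0 \<le> (1 + real Y powr (3/4)) * (real X * (1 + ln (real X))) + real X * V + Ts"
        using V0 lnX by (intro add_nonneg_nonneg mult_nonneg_nonneg) auto
    qed (use Wj Y34 lnX Ts V0 in auto)
    also have "\<dots> = exp (0.06 * L) * (real X * V * (4 + L + 2 * L ^ 2))" by (simp add: algebra_simps)
    also have "\<dots> \<le> exp (0.06 * L) * (x * (y * exp (- 0.126 * L)) * exp (0.016 * L))"
      using X Vy P V0 L10 x0 y2 by (intro mult_left_mono mult_mono mult_nonneg_nonneg add_nonneg_nonneg) auto
    also have "\<dots> = y * (x * (exp (0.06 * L) * exp (- 0.126 * L) * exp (0.016 * L)))" by (simp only: mult_ac)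
    also have "exp (0.06 * L) * exp (- 0.126 * L) * exp (0.016 * L) = exp (- 0.05 * L)"
      by (simp only: exp_add[symmetric]) (simp add: algebra_simps)
    also have "y * (x * exp (- 0.05 * L)) \<le> y * (x * exp (- 0.007 * L))"
      using x0 y2 L10 by (intro mult_left_mono) auto
    finally have T1: "T1 \<le> y * (x * exp (- 0.007 * L))" .
    have "exp (z * (2 + ln W)) / z ^ j \<le> exp (0.002 * L) / exp (0.01 * L - ln L / 2)"
    proof (intro frac_le)
      have "ln W \<le> ln (L ^ 3)" using W L10 by (subst ln_le_cancel_iff) auto
      also have "\<dots> = 3 * ln L" using L10 by (simp add: ln_realpow)
      finally have "z * (2 + ln W) \<le> z * (2 + 3 * ln L)" using z0 by (intro mult_left_mono) auto
      also have "\<dots> \<le> 0.002 * L" using P by (simp add: z_def)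
      finally show "exp (z * (2 + ln W)) \<le> exp (0.002 * L)" by simp
      \<comment> \<open>The 1 lost by the floor in \<open>j\<close> becomes the loss of
        \<open>ln L / 2\<close> in the exponent.\<close>
      have "0.02 * L / ln L \<le> real j + 1" using j(3) by linarith
      hence "0.02 * L \<le> (real j + 1) * ln L" by (simp only: pos_divide_le_eq[OF lnL])
      hence "0.01 * L - ln L / 2 \<le> real j * (ln L / 2)" by (simp add: algebra_simps)
      hence "exp (0.01 * L - ln L / 2) \<le> exp (real j * (ln L / 2))" by simp
      also have "\<dots> = exp (ln L / 2) ^ j" by (rule exp_of_nat_mult)
      also have "exp (ln L / 2) = z" using L10 by (simp add: z_def ln_sqrt[symmetric])
      finally show "exp (0.01 * L - ln L / 2) \<le> z ^ j" .
    qed auto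
    also have "\<dots> = exp (- 0.008 * L + ln L / 2)" by (simp only: exp_diff[symmetric]) (simp add: algebra_simps)
    also have "\<dots> \<le> exp (- 0.007 * L)" using P by simp
    finally have "T2 \<le> 2 * y * x * exp (- 0.007 * L)"
      unfolding T2_def using X y2 x0 z0 by (intro mult_mono mult_nonneg_nonneg) auto
    hence "T1 + T2 \<le> y * (3 * x * exp (- 0.007 * L))" using T1 by (simp add: algebra_simps)
    hence fin: "\<bar>(\<Sum>a\<in>{1..Y}. real (N a x)) - y * (\<Sum>n\<in>{1..X}. real (R n) / real n)\<bar> \<le> y * (3 * x * exp (- 0.007 * L))"
      using total by linarith
    have "(1 / y) * (\<Sum>a\<in>{1..Y}. real (N a x)) - (\<Sum>n\<in>{1..X}. real (R n) / real n)
       = ((\<Sum>a\<in>{1..Y}. real (N a x)) - y * (\<Sum>n\<in>{1..X}. real (R n) / real n)) / y"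
      using y2 by (simp add: diff_divide_distrib)
    also have "\<bar>\<dots>\<bar> = \<bar>(\<Sum>a\<in>{1..Y}. real (N a x)) - y * (\<Sum>n\<in>{1..X}. real (R n) / real n)\<bar> / y"
      using y2 by (simp only: abs_divide)
    also have "\<dots> \<le> 3 * x * exp (- 0.007 * L)" using fin y2 by (simp add: pos_divide_le_eq mult.commute)
    finally show ?thesis unfolding X_def Y_def L_def .
  qed
  show ?thesis
  proof (intro exI conjI allI impI)
    \<comment> \<open>Unification fixes the witnesses \<open>c = 0.007\<close>, \<open>C = 3\<close>
      and \<open>x0 = exp (L0 ^ 2)\<close>. The 3 adds the factor 1 from the character sums and 2
      from the tails, and \<open>x0\<close> makes \<open>sqrt (ln x)\<close> at least
      \<open>L0\<close>.\<close>
    fix x y :: real assume "x \<ge> exp (L0 ^ 2) \<and> y > exp (4.2 * sqrt (ln x))"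
    thus "\<bar>(1 / y) * (\<Sum>a\<in>{1..nat \<lfloor>y\<rfloor>}. real (N a x)) - (\<Sum>n\<in>{1..nat \<lfloor>x\<rfloor>}. real (R n) / real n)\<bar>
       \<le> 3 * x * exp (- 0.007 * sqrt (ln x))" using main by blast
  qed auto
qed

end
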